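(* Let $b_1,\dots,b_m\in C^\infty(\mathbb T^3;\mathbb R)$, $b=(b_1,\dots,b_m):\mathbb T^3\to\mathbb R^m$, and $\Gamma_b(x)=b(x)b(x)^{\mathsf T}\in\operatorname{Sym}_m$. The following statements hold. (i) $\mathcal S_\infty=\{P\circ b:P\in\mathbb R[z_1,\dots,z_m]_{\mathrm{odd}}\}$. (ii) One has $\overline{\mathcal S_\infty}^{\,C^0}=C(\mathbb T^3)$ if and only if $b(x)\ne0$ for every $x$ and $\Gamma_b$ is injective. (iii) For every integer $k\ge1$, one has $\overline{\mathcal S_\infty}^{\,C^k}=C^k(\mathbb T^3)$ if and only if $\Gamma_b$ is a smooth embedding. In particular, the profiles $b_1,\dots,b_m$ are cubically saturating, i.e. $\overline{\mathcal S_\infty}^{\,H^1(\mathbb T^3)}=H^1(\mathbb T^3)$, whenever $\Gamma_b$ is a smooth embedding.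
   Context: $\mathbb T^3=(\mathbb R/2\pi\mathbb Z)^3$; all function spaces are real. $\operatorname{Sym}_m$ is the space of real symmetric $m\times m$ matrices, and $\mathbb R[z_1,\dots,z_m]_{\mathrm{odd}}=\{P\in\mathbb R[z_1,\dots,z_m]:P(-z)=-P(z)\}$. Saturation closure: $\mathcal S_0=\{b_1,\dots,b_m\}$, $\mathcal S_{n+1}=\mathcal S_n\cup\{\phi b_jb_k:\phi\in\mathcal S_n,\ 1\le j,k\le m\}$, $\mathcal S_\infty=\operatorname{span}_{\mathbb R}\bigcup_{n\ge0}\mathcal S_n$. *)

theory Defs
  imports "HOL-Analysis.Analysis" "HOL-Library.Poly_Mapping"
begin

section \<open>The torus\<close>

definition torus_rel :: "real^3 \<Rightarrow> real^3 \<Rightarrow> bool" where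
  "torus_rel x y \<longleftrightarrow> (\<forall>i. \<exists>n::int. x $ i - y $ i = 2 * pi * of_int n)"

lemma torus_rel_equivp: "equivp torus_rel"
proof (rule equivpI)
  show "reflp torus_rel"
    unfolding torus_rel_def by (intro reflpI allI exI[of _ 0]) simp
  show "symp torus_rel"
  proof (rule sympI)
    fix x y assume *: "torus_rel x y"
    show "torus_rel y x"
      unfolding torus_rel_def
    proof
      fix i
      obtain n :: int where "x $ i - y $ i = 2 * pi * of_int n"
        using * unfolding torus_rel_def by blast
      then have "y $ i - x $ i = 2 * pi * of_int (- n)" by simp
      then show "\<exists>n::int. y $ i - x $ i = 2 * pi * of_int n" by blast
    qed
  qed
  show "transp torus_rel"
  proof (rule transpI)
    fix x y z assume *: "torus_rel x y" "torus_rel y z"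
    show "torus_rel x z"
      unfolding torus_rel_def
    proof
      fix i
      obtain n k :: int where "x $ i - y $ i = 2 * pi * of_int n" "y $ i - z $ i = 2 * pi * of_int k"
        using * unfolding torus_rel_def by blast
      then have "x $ i - z $ i = 2 * pi * of_int (n + k)" by (simp add: algebra_simps)
      then show "\<exists>n::int. x $ i - z $ i = 2 * pi * of_int n" by blast
    qed
  qed
qed

quotient_type torus3 = "real^3" / torus_rel
  by (rule torus_rel_equivp)

abbreviation proj :: "real^3 \<Rightarrow> torus3" where
  "proj \<equiv> abs_torus3"

text \<open>The torus carries the quotient topology.\<close>

instantiation torus3 :: topological_space
begin

definition open_torus3 :: "torus3 set \<Rightarrow> bool" where
  "open_torus3 U \<longleftrightarrow> open (proj -` U)"

instance
proof
  show "open (UNIV :: torus3 set)" by (simp add: open_torus3_def)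
  show "open (S \<inter> T)" if "open S" "open T" for S T :: "torus3 set"
    using that by (simp add: open_torus3_def open_Int)
  show "open (\<Union>K)" if "\<forall>S\<in>K. open S" for K :: "torus3 set set"
    using that by (simp add: open_torus3_def vimage_Union open_UN)
qed

end

lemma proj_eq_iff: "proj x = proj y \<longleftrightarrow> torus_rel x y"
  by (rule torus3.abs_eq_iff)

lemma proj_rep: "proj (rep_torus3 p) = p"
  by (rule Quotient3_abs_rep[OF Quotient3_torus3])

lemma continuous_on_torus_iff:
  fixes f :: "torus3 \<Rightarrow> 'a::topological_space"
  shows "continuous_on UNIV f \<longleftrightarrow> continuous_on UNIV (f \<circ> proj)"
  by (simp add: continuous_on_open_vimage open_torus3_def vimage_comp comp_def)


section \<open>Spaces of differentiable functions\<close>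

text \<open>Derivatives of a function on the torus are those of its periodic lift to \<open>\<real>\<^sup>3\<close>. For a
  differentiable lift, the value does not depend on the representative, see
  \<open>partial_proj\<close> below.\<close>

definition partial :: "3 \<Rightarrow> (torus3 \<Rightarrow> 'a::real_normed_vector) \<Rightarrow> torus3 \<Rightarrow> 'a" where
  "partial j f p = frechet_derivative (f \<circ> proj) (at (rep_torus3 p)) (axis j 1)"

lemma partial_proj:
  assumes "\<forall>x. (f \<circ> proj) differentiable (at x)"
  shows "partial j f (proj x) = frechet_derivative (f \<circ> proj) (at x) (axis j 1)"
proof -
  define y where "y = rep_torus3 (proj x)"
  define v where "v = y - x"
  have rel: "torus_rel y x"
    using proj_rep[of "proj x"] by (simp add: y_def proj_eq_iff[symmetric])
  have "proj (z + v) = proj z" for z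
    using rel by (simp add: proj_eq_iff torus_rel_def v_def)
  then have periodic: "(f \<circ> proj) \<circ> (\<lambda>z. z + v) = f \<circ> proj" by auto
  have "((f \<circ> proj) has_derivative frechet_derivative (f \<circ> proj) (at y)) (at (x + v))"
    using assms by (simp add: v_def frechet_derivative_works[symmetric])
  moreover have "((\<lambda>z. z + v) has_derivative (\<lambda>h. h)) (at x)"
    by (auto intro!: derivative_eq_intros)
  ultimately have "((f \<circ> proj) \<circ> (\<lambda>z. z + v) has_derivative
      frechet_derivative (f \<circ> proj) (at y) \<circ> (\<lambda>h. h)) (at x)"
    by (rule diff_chain_at[rotated])
  then have "((f \<circ> proj) has_derivative frechet_derivative (f \<circ> proj) (at y)) (at x)"
    by (simp only: periodic) (simp add: comp_def)
  then have "frechet_derivative (f \<circ> proj) (at y) = frechet_derivative (f \<circ> proj) (at x)"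
    by (rule frechet_derivative_at)
  then show ?thesis by (simp add: partial_def y_def)
qed

primrec Ck :: "nat \<Rightarrow> (torus3 \<Rightarrow> 'a::real_normed_vector) set" where
  "Ck 0 = {f. continuous_on UNIV f}"
| "Ck (Suc k) = {f. (\<forall>x. (f \<circ> proj) differentiable (at x)) \<and> (\<forall>j. partial j f \<in> Ck k)}"

definition Cinf :: "(torus3 \<Rightarrow> 'a::real_normed_vector) set" where
  "Cinf = (\<Inter>k. Ck k)"

text \<open>A list \<open>[j\<^sub>1, \<dots>, j\<^sub>n]\<close> stands for the iterated derivative in the directions
  \<open>j\<^sub>1, \<dots>, j\<^sub>n\<close>; a multi-index is thus counted once for each of its orderings, which only
  changes the norm up to equivalence.\<close>

definition Ck_norm :: "nat \<Rightarrow> (torus3 \<Rightarrow> real) \<Rightarrow> real" where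
  "Ck_norm k f = (\<Sum>js\<in>{js. length js \<le> k}. SUP x. \<bar>foldr partial js f x\<bar>)"

definition closure_in ::
    "('a \<Rightarrow> real) set \<Rightarrow> (('a \<Rightarrow> real) \<Rightarrow> real) \<Rightarrow> ('a \<Rightarrow> real) set \<Rightarrow> ('a \<Rightarrow> real) set" where
  "closure_in X N S = {f \<in> X. \<forall>\<epsilon>>0. \<exists>g\<in>S \<inter> X. N (\<lambda>x. f x - g x) < \<epsilon>}"


section \<open>The Sobolev space \<open>H\<^sup>1\<close>\<close>

definition torus_measure :: "torus3 measure" where
  "torus_measure = distr (restrict_space lborel {x. \<forall>i. 0 \<le> x $ i \<and> x $ i < 2 * pi}) borel proj"

definition L2 :: "(torus3 \<Rightarrow> real) set" where
  "L2 = {f \<in> borel_measurable torus_measure. integrable torus_measure (\<lambda>x. (f x)\<^sup>2)}"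

definition weak_partial :: "3 \<Rightarrow> (torus3 \<Rightarrow> real) \<Rightarrow> (torus3 \<Rightarrow> real) \<Rightarrow> bool" where
  "weak_partial j f g \<longleftrightarrow>
    (\<forall>\<phi>\<in>Cinf. (\<integral>x. f x * partial j \<phi> x \<partial>torus_measure) = - (\<integral>x. g x * \<phi> x \<partial>torus_measure))"

text \<open>Elements are represented by functions rather than by classes modulo null sets, so that
  \<open>H1_norm\<close> is a seminorm. The weak derivative is unique only almost everywhere; the
  norm does not depend on the choice.\<close>

definition H1 :: "(torus3 \<Rightarrow> real) set" where
  "H1 = {f \<in> L2. \<forall>j. \<exists>g\<in>L2. weak_partial j f g}"

definition H1_norm :: "(torus3 \<Rightarrow> real) \<Rightarrow> real" where
  "H1_norm f = sqrt ((\<integral>x. (f x)\<^sup>2 \<partial>torus_measure) +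
    (\<Sum>j\<in>UNIV. \<integral>x. ((SOME g. g \<in> L2 \<and> weak_partial j f g) x)\<^sup>2 \<partial>torus_measure))"


section \<open>Smooth embeddings\<close>

text \<open>Embeddings into a linear subspace \<open>V\<close> of a normed space.\<close>

definition smooth_embedding :: "'a::real_normed_vector set \<Rightarrow> (torus3 \<Rightarrow> 'a) \<Rightarrow> bool" where
  "smooth_embedding V f \<longleftrightarrow>
     f \<in> Cinf \<and> range f \<subseteq> V \<and>
     (\<forall>x. inj (frechet_derivative (f \<circ> proj) (at x))) \<and>
     embedding_map euclidean (top_of_set V) f"

definition Sym :: "(real^'m^'m) set" where
  "Sym = {A. transpose A = A}"

definition Gamma_mat :: "(torus3 \<Rightarrow> real^'m) \<Rightarrow> torus3 \<Rightarrow> real^'m^'m" where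
  "Gamma_mat b x = (\<chi> i j. b x $ i * b x $ j)"


section \<open>Odd polynomials and the saturation closure\<close>

text \<open>Polynomials in the variables \<open>z\<^sub>i\<close>, \<open>i :: 'm\<close>, are finitely supported maps from exponent
  vectors to coefficients.\<close>

type_synonym 'm mpolynomial = "('m \<Rightarrow>\<^sub>0 nat) \<Rightarrow>\<^sub>0 real"

definition poly_eval :: "'m::finite mpolynomial \<Rightarrow> real^'m \<Rightarrow> real" where
  "poly_eval P z =
    (\<Sum>\<alpha>\<in>Poly_Mapping.keys P.
       Poly_Mapping.lookup P \<alpha> * (\<Prod>i\<in>UNIV. (z $ i) ^ Poly_Mapping.lookup \<alpha> i))"

definition odd_polys :: "'m::finite mpolynomial set" where
  "odd_polys = {P. \<forall>z. poly_eval P (- z) = - poly_eval P z}"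

primrec sat :: "(torus3 \<Rightarrow> real^'m) \<Rightarrow> nat \<Rightarrow> (torus3 \<Rightarrow> real) set" where
  "sat b 0 = {(\<lambda>x. b x $ j) | j. True}"
| "sat b (Suc n) = sat b n \<union> {(\<lambda>x. \<phi> x * b x $ j * b x $ k) | \<phi> j k. \<phi> \<in> sat b n}"

definition fun_span :: "('a \<Rightarrow> real) set \<Rightarrow> ('a \<Rightarrow> real) set" where
  "fun_span S = {(\<lambda>x. \<Sum>\<phi>\<in>A. c \<phi> * \<phi> x) | A c. finite A \<and> A \<subseteq> S}"

definition sat_inf :: "(torus3 \<Rightarrow> real^'m) \<Rightarrow> (torus3 \<Rightarrow> real) set" where
  "sat_inf b = fun_span (\<Union>n. sat b n)"

definition cubically_saturating :: "(torus3 \<Rightarrow> real^'m) \<Rightarrow> bool" where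
  "cubically_saturating b \<longleftrightarrow> closure_in H1 H1_norm (sat_inf b) = H1"

end

theory Submission
  imports Defs
begin

text \<open>
  The saturation multiplies a profile again and again by products \<open>b\<^sub>j b\<^sub>k\<close>, so its elements are the
  monomials of odd degree in \<open>b\<close>; an odd polynomial function equals its own odd part, in which only
  such monomials survive (\<open>sat_inf_eq_odd_polys\<close>).

  The odd polynomials in \<open>b\<close> are no algebra, but the even ones are: they are the polynomials in the
  entries of \<open>\<Gamma> = b b\<^sup>T\<close>, and they multiply each \<open>b\<^sub>j\<close> into the saturation closure. If \<open>b\<close> has no zero,
  then \<open>f = \<Sum>\<^sub>j (f b\<^sub>j / |b|\<^sup>2) b\<^sub>j\<close>, so everything reduces to the density of the polynomials in \<open>\<Gamma>\<close>
  (\<open>approximable_sat_inf\<close>). In the uniform norm this is the Stone--Weierstrass theorem, and separation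
  of points is injectivity of \<open>\<Gamma>\<close> (\<open>polys_dense_C0\<close>).

  In \<open>C\<^sup>k\<close> it is an argument in the style of Nachbin (\<open>polys_dense_Ck\<close>). The closure of the algebra is
  stable under composition with \<open>C\<^sup>k\<close> functions of several variables, because these are approximated by
  polynomials in \<open>C\<^sup>k\<close> (\<open>Ck_polynomial_approximation\<close>). As \<open>\<Gamma>\<close> is an immersion, three linear functions
  of \<open>\<Gamma>\<close> form a chart near a given point (\<open>Ck_inverse_function\<close>), so a function supported near that
  point is locally a function of \<open>\<Gamma>\<close>; as \<open>\<Gamma>\<close> is injective, a cut-off function depending on \<open>\<Gamma>\<close> alone
  makes this a global statement (\<open>local_approximation\<close>). A partition of unity finishes the proof.

  Conversely, elements of the saturation closure vanish where \<open>b\<close> does, have equal modulus at two points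
  with the same \<open>\<Gamma>\<close>, since such points have \<open>b(y) = \<plusminus> b(x)\<close>, and have zero derivative in each direction
  in the kernel of \<open>d\<Gamma>\<close>, since that is the kernel of \<open>db\<close> where \<open>b \<noteq> 0\<close>. Each of these properties passes
  to limits in \<open>C\<^sup>0\<close> or \<open>C\<^sup>1\<close> and fails for suitable trigonometric functions
  (\<open>dense_imp_nonzero_inj\<close>, \<open>dense_C1_imp_immersion\<close>).

  For \<open>H\<^sup>1\<close>, density in \<open>C\<^sup>1\<close> leaves the density of smooth functions in \<open>H\<^sup>1\<close> (\<open>smooth_dense_H1\<close>). Fourier
  sums commute with weak derivatives and are best approximations in \<open>L\<^sup>2\<close>, so they converge in \<open>H\<^sup>1\<close> as
  soon as trigonometric polynomials are dense in \<open>L\<^sup>2\<close>.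
\<close>

section \<open>Functions of class \<open>C\<^sup>k\<close> on open sets\<close>

definition pd :: "'n::finite \<Rightarrow> (real^'n \<Rightarrow> real) \<Rightarrow> real^'n \<Rightarrow> real" where
  "pd j f x = frechet_derivative f (at x) (axis j 1)"

text \<open>The recursion follows that of \<open>Ck\<close>, but on subsets of \<open>\<real>\<^sup>n\<close>: charts of the torus, balls
  carrying polynomial approximations and the whole space are treated alike.\<close>

primrec Cdiff :: "nat \<Rightarrow> (real^'n) set \<Rightarrow> (real^'n::finite \<Rightarrow> real) \<Rightarrow> bool" where
  "Cdiff 0 S f = continuous_on S f"
| "Cdiff (Suc k) S f = ((\<forall>x\<in>S. f differentiable (at x)) \<and> (\<forall>j. Cdiff k S (pd j f)))"

text \<open>A bound by \<open>M\<close> on all iterated partial derivatives of order at most \<open>k\<close>, each ordering of the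
  directions being counted. It replaces the norm \<open>Ck_norm\<close> in all estimates, because it satisfies
  the same recursion as \<open>Cdiff\<close>.\<close>

primrec Cbound :: "nat \<Rightarrow> (real^'n) set \<Rightarrow> real \<Rightarrow> (real^'n::finite \<Rightarrow> real) \<Rightarrow> bool" where
  "Cbound 0 S M f = (\<forall>x\<in>S. \<bar>f x\<bar> \<le> M)"
| "Cbound (Suc k) S M f = ((\<forall>x\<in>S. \<bar>f x\<bar> \<le> M) \<and> (\<forall>j. Cbound k S M (pd j f)))"

lemma pd_eqI: "(f has_derivative f') (at x) \<Longrightarrow> pd j f x = f' (axis j 1)"
  unfolding pd_def by (metis frechet_derivative_at)

lemma has_derivative_pd:
  fixes f :: "real^'n::finite \<Rightarrow> real"
  assumes "f differentiable (at x)"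
  shows "(f has_derivative (\<lambda>h. \<Sum>j\<in>UNIV. h $ j * pd j f x)) (at x)"
proof -
  let ?D = "frechet_derivative f (at x)"
  have D: "(f has_derivative ?D) (at x)"
    using assms frechet_derivative_works by blast
  then have lin: "linear ?D"
    by (rule has_derivative_linear)
  have "?D h = (\<Sum>j\<in>UNIV. h $ j * pd j f x)" for h
  proof -
    have "?D h = ?D (\<Sum>j\<in>UNIV. h $ j *\<^sub>R axis j 1)"
      by (simp add: basis_expansion flip: scalar_mult_eq_scaleR)
    also have "\<dots> = (\<Sum>j\<in>UNIV. h $ j * pd j f x)"
      by (simp add: linear_sum[OF lin] linear_cmul[OF lin] pd_def)
    finally show ?thesis .
  qed
  then show ?thesis using D by (metis (no_types, lifting) ext)
qed

lemma frechet_derivative_cong_open: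
  assumes "open S" "x \<in> S" "\<And>y. y \<in> S \<Longrightarrow> f y = g y"
  shows "frechet_derivative f (at x) = frechet_derivative g (at x)"
proof -
  have "(f has_derivative D) (at x) \<longleftrightarrow> (g has_derivative D) (at x)" for D
    using assms has_derivative_transform_within_open[of f D x UNIV S g]
      has_derivative_transform_within_open[of g D x UNIV S f] by auto
  then show ?thesis unfolding frechet_derivative_def by simp
qed

lemma differentiable_cong_open:
  assumes "open S" "x \<in> S" "\<And>y. y \<in> S \<Longrightarrow> f y = g y"
  shows "f differentiable (at x) \<longleftrightarrow> g differentiable (at x)"
  using assms has_derivative_transform_within_open[of f _ x UNIV S g]
      has_derivative_transform_within_open[of g _ x UNIV S f] unfolding differentiable_def by auto

lemma pd_cong_open:
  assumes "open S" "x \<in> S" "\<And>y. y \<in> S \<Longrightarrow> f y = g y"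
  shows "pd j f x = pd j g x"
  unfolding pd_def using frechet_derivative_cong_open[OF assms] by simp

lemma Cdiff_cong:
  assumes "open S" "\<And>x. x \<in> S \<Longrightarrow> f x = g x"
  shows "Cdiff k S f \<longleftrightarrow> Cdiff k S g"
  using assms(2)
proof (induction k arbitrary: f g)
  case 0
  then show ?case by (simp cong: continuous_on_cong)
next
  case (Suc k)
  have "Cdiff k S (pd j f) \<longleftrightarrow> Cdiff k S (pd j g)" for j
    by (rule Suc.IH, rule pd_cong_open[OF assms(1)]) (use Suc.prems in auto)
  moreover have "f differentiable (at x) \<longleftrightarrow> g differentiable (at x)" if "x \<in> S" for x
    using that Suc.prems by (intro differentiable_cong_open[OF assms(1)]) auto
  ultimately show ?case by simp
qed

lemma Cbound_cong:
  assumes "open S" "\<And>x. x \<in> S \<Longrightarrow> f x = g x"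
  shows "Cbound k S M f \<longleftrightarrow> Cbound k S M g"
  using assms(2)
proof (induction k arbitrary: f g)
  case 0
  then show ?case by simp
next
  case (Suc k)
  have "Cbound k S M (pd j f) \<longleftrightarrow> Cbound k S M (pd j g)" for j
    by (rule Suc.IH, rule pd_cong_open[OF assms(1)]) (use Suc.prems in auto)
  then show ?case using Suc.prems by auto
qed

lemma Cdiff_subset: "Cdiff k T f \<Longrightarrow> S \<subseteq> T \<Longrightarrow> Cdiff k S f"
  by (induction k arbitrary: f) (auto intro: continuous_on_subset)

lemma Cbound_subset: "Cbound k T M f \<Longrightarrow> S \<subseteq> T \<Longrightarrow> Cbound k S M f"
  by (induction k arbitrary: f) auto

lemma Cbound_mono: "Cbound k S M f \<Longrightarrow> M \<le> N \<Longrightarrow> Cbound k S N f"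
  by (induction k arbitrary: f) (simp_all, (meson order_trans)+)

lemma Cbound_pointwise: "Cbound k S M f \<Longrightarrow> x \<in> S \<Longrightarrow> \<bar>f x\<bar> \<le> M"
  by (cases k) auto

lemma Cbound_SucD: "Cbound (Suc k) S M f \<Longrightarrow> Cbound k S M f"
  by (induction k arbitrary: f) auto

text \<open>Differentiability is local. This lets a function with compact support in a chart be extended
  by zero.\<close>

lemma Cdiff_Un:
  "open S \<Longrightarrow> open T \<Longrightarrow> Cdiff k S f \<Longrightarrow> Cdiff k T f \<Longrightarrow> Cdiff k (S \<union> T) f"
  by (induction k arbitrary: f) (auto intro: continuous_on_open_Un)

lemma Cdiff_continuous: "Cdiff k S f \<Longrightarrow> continuous_on S f"
  by (cases k) (auto simp: continuous_on_eq_continuous_within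
      intro: continuous_at_imp_continuous_at_within differentiable_imp_continuous_within)

lemma Cdiff_SucD: "Cdiff (Suc k) S f \<Longrightarrow> Cdiff k S f"
proof (induction k arbitrary: f)
  case 0
  then show ?case by (metis Cdiff.simps(1) Cdiff_continuous)
next
  case (Suc k)
  then show ?case by auto
qed

lemma Cdiff_mono: "Cdiff k S f \<Longrightarrow> l \<le> k \<Longrightarrow> Cdiff l S f"
  by (induction k) (auto simp: le_Suc_eq simp del: Cdiff.simps dest: Cdiff_SucD)

lemma Cdiff_pd: "Cdiff (Suc k) S f \<Longrightarrow> Cdiff k S (pd j f)"
  by simp

lemma pd_const [simp]: "pd j (\<lambda>x. c) = (\<lambda>x. 0)"
  by (auto simp: pd_def)

lemma Cdiff_const [simp]: "Cdiff k S (\<lambda>x. c)"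
  by (induction k arbitrary: c) auto

lemma pd_add:
  assumes "f differentiable (at x)" "g differentiable (at x)"
  shows "pd j (\<lambda>x. f x + g x) x = pd j f x + pd j g x"
proof -
  have "((\<lambda>x. f x + g x) has_derivative
      (\<lambda>h. frechet_derivative f (at x) h + frechet_derivative g (at x) h)) (at x)"
    using assms by (intro has_derivative_add) (auto simp: frechet_derivative_works[symmetric])
  from pd_eqI[OF this] show ?thesis by (simp add: pd_def)
qed

lemma pd_mult:
  assumes "f differentiable (at x)" "g differentiable (at x)"
  shows "pd j (\<lambda>x. f x * g x) x = pd j f x * g x + f x * pd j g x"
proof -
  have "((\<lambda>x. f x * g x) has_derivative
      (\<lambda>h. f x * frechet_derivative g (at x) h + frechet_derivative f (at x) h * g x)) (at x)"
    using assms by (intro has_derivative_mult) (auto simp: frechet_derivative_works[symmetric])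
  from pd_eqI[OF this] show ?thesis by (simp add: pd_def)
qed

lemma Cdiff_add:
  assumes "open S"
  shows "Cdiff k S f \<Longrightarrow> Cdiff k S g \<Longrightarrow> Cdiff k S (\<lambda>x. f x + g x)"
proof (induction k arbitrary: f g)
  case 0
  then show ?case by (auto intro: continuous_intros)
next
  case (Suc k)
  have "Cdiff k S (pd j (\<lambda>x. f x + g x))" for j
  proof -
    have "Cdiff k S (\<lambda>x. pd j f x + pd j g x)" using Suc by auto
    moreover have "pd j (\<lambda>x. f x + g x) x = pd j f x + pd j g x" if "x \<in> S" for x
      using Suc.prems that by (intro pd_add) auto
    ultimately show ?thesis using Cdiff_cong[OF assms] by (metis (no_types, lifting))
  qed
  then show ?case using Suc.prems by auto
qed

lemma Cdiff_mult:
  assumes "open S"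
  shows "Cdiff k S f \<Longrightarrow> Cdiff k S g \<Longrightarrow> Cdiff k S (\<lambda>x. f x * g x)"
proof (induction k arbitrary: f g)
  case 0
  then show ?case by (auto intro: continuous_intros)
next
  case (Suc k)
  have "Cdiff k S (pd j (\<lambda>x. f x * g x))" for j
  proof -
    have "Cdiff k S (\<lambda>x. pd j f x * g x + f x * pd j g x)"
      using Suc.prems[THEN Cdiff_SucD] Suc.prems by (intro Cdiff_add[OF assms] Suc.IH) simp_all
    moreover have "pd j (\<lambda>x. f x * g x) x = pd j f x * g x + f x * pd j g x" if "x \<in> S" for x
      using Suc.prems that by (intro pd_mult) auto
    ultimately show ?thesis using Cdiff_cong[OF assms] by (metis (no_types, lifting))
  qed
  then show ?case using Suc.prems by auto
qed

lemma Cdiff_cmult: "open S \<Longrightarrow> Cdiff k S f \<Longrightarrow> Cdiff k S (\<lambda>x. c * f x)"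
  by (rule Cdiff_mult) auto

lemma Cdiff_uminus: "open S \<Longrightarrow> Cdiff k S f \<Longrightarrow> Cdiff k S (\<lambda>x. - f x)"
  using Cdiff_cmult[of S k f "-1"] by simp

lemma Cdiff_diff: "open S \<Longrightarrow> Cdiff k S f \<Longrightarrow> Cdiff k S g \<Longrightarrow> Cdiff k S (\<lambda>x. f x - g x)"
  using Cdiff_add[of S k f "\<lambda>x. - g x"] Cdiff_uminus[of S k g] by simp

lemma Cdiff_sum:
  assumes "open S" "\<And>i. i \<in> A \<Longrightarrow> Cdiff k S (f i)"
  shows "Cdiff k S (\<lambda>x. \<Sum>i\<in>A. f i x)"
  using assms(2) by (induction A rule: infinite_finite_induct) (auto intro: Cdiff_add[OF assms(1)])

lemma Cdiff_prod:
  assumes "open S" "\<And>i. i \<in> A \<Longrightarrow> Cdiff k S (f i)"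
  shows "Cdiff k S (\<lambda>x. \<Prod>i\<in>A. f i x)"
  using assms(2) by (induction A rule: infinite_finite_induct) (auto intro: Cdiff_mult[OF assms(1)])

lemma Cdiff_inverse:
  assumes "open S" "\<And>x. x \<in> S \<Longrightarrow> f x \<noteq> 0"
  shows "Cdiff k S f \<Longrightarrow> Cdiff k S (\<lambda>x. inverse (f x))"
proof (induction k)
  case 0
  then show ?case using assms by (auto intro: continuous_intros)
next
  case (Suc k)
  have der: "((\<lambda>x. inverse (f x)) has_derivative
      (\<lambda>h. - (inverse (f x) * frechet_derivative f (at x) h * inverse (f x)))) (at x)"
    if "x \<in> S" for x
    using that Suc.prems assms(2)
    by (intro Deriv.has_derivative_inverse) (simp_all add: frechet_derivative_works[symmetric])
  have "Cdiff k S (pd j (\<lambda>x. inverse (f x)))" for j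
  proof -
    have "Cdiff k S (\<lambda>x. - (inverse (f x) * pd j f x * inverse (f x)))"
      using Suc Cdiff_SucD[OF Suc.prems] by (intro Cdiff_uminus Cdiff_mult assms) auto
    moreover have "pd j (\<lambda>x. inverse (f x)) x = - (inverse (f x) * pd j f x * inverse (f x))"
      if "x \<in> S" for x
      using pd_eqI[OF der[OF that]] by (simp add: pd_def)
    ultimately show ?thesis using Cdiff_cong[OF assms(1)] by (metis (no_types, lifting))
  qed
  then show ?case using der by simp (blast intro: differentiableI)
qed

lemma Cdiff_linear:
  assumes "bounded_linear f"
  shows "Cdiff k S f"
proof (cases k)
  case 0
  then show ?thesis using assms by (simp add: linear_continuous_on)
next
  case (Suc l)
  have d: "(f has_derivative f) (at x)" for x
    using assms by (rule bounded_linear_imp_has_derivative)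
  then have "pd j f = (\<lambda>x. f (axis j 1))" for j
    by (intro ext pd_eqI)
  then show ?thesis using Suc d by simp (blast intro: differentiableI)
qed

lemma Cdiff_component: "Cdiff k S (\<lambda>x. x $ i)"
  by (rule Cdiff_linear) (rule bounded_linear_vec_nth)

lemma Cdiff_real_polynomial_function:
  assumes "open S" "real_polynomial_function p"
  shows "Cdiff k S p"
  using assms(2)
  by induction (auto intro: Cdiff_linear Cdiff_add[OF assms(1)] Cdiff_mult[OF assms(1)])

lemma pd_compose:
  fixes f :: "real^'n::finite \<Rightarrow> real" and g :: "real^'m::finite \<Rightarrow> real^'n"
  assumes "f differentiable (at (g x))" "\<And>i. (\<lambda>x. g x $ i) differentiable (at x)"
  shows "(\<lambda>x. f (g x)) differentiable (at x)"
    and "pd j (\<lambda>x. f (g x)) x = (\<Sum>i\<in>UNIV. pd i f (g x) * pd j (\<lambda>x. g x $ i) x)"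
proof -
  have "((\<lambda>x. g x $ i) has_derivative (\<lambda>h. (\<chi> i. frechet_derivative (\<lambda>x. g x $ i) (at x) h) $ i)) (at x)" for i
    using assms(2) by (simp add: frechet_derivative_works[symmetric])
  then have "(g has_derivative (\<lambda>h. \<chi> i. frechet_derivative (\<lambda>x. g x $ i) (at x) h)) (at x)"
    by (subst has_derivative_componentwise_within) (auto simp: Basis_vec_def inner_axis)
  from diff_chain_at[OF this has_derivative_pd[OF assms(1)]]
  have d: "((\<lambda>x. f (g x)) has_derivative
      (\<lambda>h. \<Sum>i\<in>UNIV. frechet_derivative (\<lambda>x. g x $ i) (at x) h * pd i f (g x))) (at x)"
    by (simp add: o_def)
  then show "(\<lambda>x. f (g x)) differentiable (at x)" by (blast intro: differentiableI)
  show "pd j (\<lambda>x. f (g x)) x = (\<Sum>i\<in>UNIV. pd i f (g x) * pd j (\<lambda>x. g x $ i) x)"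
    using pd_eqI[OF d, of j] by (simp add: pd_def mult.commute)
qed

text \<open>By the chain rule a partial derivative of \<open>f \<circ> g\<close> is a sum of products of derivatives of the
  components of \<open>g\<close> with functions \<open>pd i f \<circ> g\<close>. These have one derivative less, so that
  induction on \<open>k\<close> applies to them.\<close>

lemma Cdiff_compose:
  fixes f :: "real^'n::finite \<Rightarrow> real" and g :: "real^'m::finite \<Rightarrow> real^'n"
  assumes "open S" "g ` S \<subseteq> T"
  shows "Cdiff k T f \<Longrightarrow> (\<And>i. Cdiff k S (\<lambda>x. g x $ i)) \<Longrightarrow> Cdiff k S (\<lambda>x. f (g x))"
proof (induction k arbitrary: f)
  case 0
  have "continuous_on S (\<lambda>x. \<chi> i. g x $ i)"
    using 0 by (intro continuous_on_vec_lambda) auto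
  then have "continuous_on S g" by simp
  then show ?case using 0 assms continuous_on_compose2[of T f S g] by simp
next
  case (Suc k)
  note C = pd_compose[of f g]
  have "Cdiff k S (pd j (\<lambda>x. f (g x)))" for j
  proof -
    have "Cdiff k S (\<lambda>x. \<Sum>i\<in>UNIV. pd i f (g x) * pd j (\<lambda>x. g x $ i) x)"
      using Suc.prems Suc.IH[OF _ Cdiff_SucD[OF Suc.prems(2)]]
      by (intro Cdiff_sum Cdiff_mult assms) auto
    moreover have "pd j (\<lambda>x. f (g x)) x = (\<Sum>i\<in>UNIV. pd i f (g x) * pd j (\<lambda>x. g x $ i) x)"
      if "x \<in> S" for x
      using Suc.prems that assms by (intro C) auto
    ultimately show ?thesis using Cdiff_cong[OF assms(1)] by (metis (no_types, lifting))
  qed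
  moreover have "(\<lambda>x. f (g x)) differentiable (at x)" if "x \<in> S" for x
    using Suc.prems that assms by (intro C) auto
  ultimately show ?case by simp
qed

lemma has_derivative_sin_cos_linear:
  assumes "bounded_linear (l :: 'a::real_normed_vector \<Rightarrow> real)"
  shows "((\<lambda>x. sin (l x + c)) has_derivative (\<lambda>h. cos (l x + c) * l h)) (at x)"
    and "((\<lambda>x. cos (l x + c)) has_derivative (\<lambda>h. - sin (l x + c) * l h)) (at x)"
proof -
  have "((\<lambda>x. l x + c) has_derivative l) (at x)"
    by (rule has_derivative_add_const[OF bounded_linear_imp_has_derivative[OF assms]])
  then show "((\<lambda>x. sin (l x + c)) has_derivative (\<lambda>h. cos (l x + c) * l h)) (at x)"
    and "((\<lambda>x. cos (l x + c)) has_derivative (\<lambda>h. - sin (l x + c) * l h)) (at x)"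
    using has_derivative_sin has_derivative_cos by (fastforce simp: mult.commute)+
qed

lemma pd_sin_cos_linear:
  fixes l :: "real^'n::finite \<Rightarrow> real"
  assumes "bounded_linear l"
  shows "pd j (\<lambda>x. sin (l x + c)) = (\<lambda>x. l (axis j 1) * cos (l x + c))"
    and "pd j (\<lambda>x. cos (l x + c)) = (\<lambda>x. - l (axis j 1) * sin (l x + c))"
  using has_derivative_sin_cos_linear[OF assms, where c = c, THEN pd_eqI]
  by (auto simp: mult.commute)

lemma Cdiff_sin_cos_linear:
  assumes "bounded_linear (l :: real^'n::finite \<Rightarrow> real)"
  shows "Cdiff k UNIV (\<lambda>x. sin (l x + c)) \<and> Cdiff k UNIV (\<lambda>x. cos (l x + c))"
proof (induction k)
  case 0
  show ?case using linear_continuous_on[OF assms, of UNIV]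
    by (auto intro!: continuous_intros)
next
  case (Suc k)
  then show ?case
    using has_derivative_sin_cos_linear[OF assms, of c, THEN differentiableI]
    by (simp add: pd_sin_cos_linear[OF assms] Cdiff_cmult Cdiff_uminus)
qed

lemma has_derivative_max_power:
  "((\<lambda>t::real. max 0 t ^ (n + 2)) has_real_derivative (real (n + 2) * max 0 t ^ (n + 1))) (at t)"
proof (cases t "0::real" rule: linorder_cases)
  case less
  have "((\<lambda>t::real. 0) has_real_derivative (real (n + 2) * max 0 t ^ (n + 1))) (at t)"
    using less by (auto intro!: derivative_eq_intros)
  then show ?thesis
    by (rule has_field_derivative_transform_within_open[of _ _ _ "{..<0}"]) (use less in auto)
next
  case greater
  have "((\<lambda>t::real. t ^ (n+2)) has_real_derivative (real (n + 2) * max 0 t ^ (n + 1))) (at t)"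
    using greater by (intro DERIV_pow[THEN DERIV_cong]) simp
  then show ?thesis
    by (rule has_field_derivative_transform_within_open[of _ _ _ "{0<..}"]) (use greater in auto)
next
  case equal
  have "((\<lambda>h::real. max 0 h ^ (n+1)) \<longlongrightarrow> max 0 0 ^ (n+1)) (at 0)"
    by (intro tendsto_intros)
  then have "((\<lambda>h::real. max 0 h ^ (n+1)) \<longlongrightarrow> 0) (at 0)" by simp
  moreover have "\<forall>\<^sub>F h in at 0. max 0 h ^ (n+1) = (max 0 h ^ (n + 2) - max 0 0 ^ (n+2)) / (h::real)"
    by (auto simp: eventually_at_filter max_def)
  ultimately have "((\<lambda>h::real. (max 0 h ^ (n + 2) - max 0 0 ^ (n+2)) / h) \<longlongrightarrow> 0) (at 0)"
    by (rule Lim_transform_eventually)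
  then show ?thesis using equal by (simp add: DERIV_def)
qed

text \<open>One power more than the order of differentiability makes the positive part smooth enough. This
  provides cut-off functions of class \<open>C\<^sup>k\<close> without the exponential bump; a fixed \<open>k\<close> suffices
  throughout.\<close>

lemma Cdiff_max_power:
  assumes "open S"
  shows "Cdiff k S w \<Longrightarrow> Cdiff k S (\<lambda>x. max 0 (w x) ^ (k + 1))"
proof (induction k)
  case 0
  then show ?case by (auto intro!: continuous_intros)
next
  case (Suc k)
  have der: "((\<lambda>x. max 0 (w x) ^ (k + 2)) has_derivative
     (\<lambda>h. frechet_derivative w (at x) h * (real (k + 2) * max 0 (w x) ^ (k + 1)))) (at x)" if "x \<in> S" for x
    by (rule has_derivative_compose[OF _ has_derivative_max_power[unfolded has_field_derivative_def], THEN has_derivative_eq_rhs])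
      (use Suc.prems that in \<open>auto simp: frechet_derivative_works[symmetric] mult.commute fun_eq_iff\<close>)
  have "Cdiff k S (pd j (\<lambda>x. max 0 (w x) ^ (k + 2)))" for j
  proof -
    have "Cdiff k S (\<lambda>x. pd j w x * (real (k + 2) * max 0 (w x) ^ (k + 1)))"
      using Suc Cdiff_SucD[OF Suc.prems] by (intro Cdiff_mult Cdiff_const assms) auto
    moreover have "pd j (\<lambda>x. max 0 (w x) ^ (k + 2)) x = pd j w x * (real (k + 2) * max 0 (w x) ^ (k + 1))"
      if "x \<in> S" for x
      using pd_eqI[OF der[OF that]] by (simp add: pd_def)
    ultimately show ?thesis using Cdiff_cong[OF assms] by (metis (no_types, lifting))
  qed
  then show ?case using der by simp (blast intro: differentiableI)
qed

section \<open>Derivative bounds\<close>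

lemma Cbound_add:
  assumes "open S"
  shows "Cdiff k S f \<Longrightarrow> Cdiff k S g \<Longrightarrow> Cbound k S M f \<Longrightarrow> Cbound k S N g \<Longrightarrow>
    Cbound k S (M + N) (\<lambda>x. f x + g x)"
proof (induction k arbitrary: f g)
  case 0
  then show ?case by (force intro: abs_triangle_ineq[THEN order_trans])
next
  case (Suc k)
  have "Cbound k S (M + N) (pd j (\<lambda>x. f x + g x))" for j
  proof -
    have "Cbound k S (M + N) (\<lambda>x. pd j f x + pd j g x)" using Suc by auto
    moreover have "pd j (\<lambda>x. f x + g x) x = pd j f x + pd j g x" if "x \<in> S" for x
      using Suc.prems that by (intro pd_add) auto
    ultimately show ?thesis using Cbound_cong[OF assms] by (metis (no_types, lifting))
  qed
  moreover have "\<bar>f x + g x\<bar> \<le> M + N" if "x \<in> S" for x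
    using Suc.prems that by (force intro: abs_triangle_ineq[THEN order_trans])
  ultimately show ?case by simp
qed

lemma Cbound_0: "0 \<le> M \<Longrightarrow> Cbound k S M (\<lambda>x. 0)"
  by (induction k) auto

lemma Cbound_sum:
  assumes "open S" "\<And>i. i \<in> A \<Longrightarrow> Cdiff k S (f i)" "\<And>i. i \<in> A \<Longrightarrow> Cbound k S (M i) (f i)"
  shows "Cbound k S (\<Sum>i\<in>A. M i) (\<lambda>x. \<Sum>i\<in>A. f i x)"
  using assms(2-) by (induction A rule: infinite_finite_induct)
    (simp_all add: Cbound_0 Cbound_add[OF assms(1)] Cdiff_sum[OF assms(1)])

text \<open>The Leibniz rule produces two terms for every derivative taken, whence the factor \<open>2 ^ k\<close>.\<close>

lemma Cbound_mult:
  assumes "open S" "0 \<le> M" "0 \<le> N"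
  shows "Cdiff k S f \<Longrightarrow> Cdiff k S g \<Longrightarrow> Cbound k S M f \<Longrightarrow> Cbound k S N g \<Longrightarrow>
    Cbound k S (2 ^ k * M * N) (\<lambda>x. f x * g x)"
proof (induction k arbitrary: f g)
  case 0
  then show ?case using assms by (auto simp: abs_mult intro: mult_mono)
next
  case (Suc k)
  have "Cbound k S (2 ^ Suc k * M * N) (pd j (\<lambda>x. f x * g x))" for j
  proof -
    note D = Suc.prems(1,2)[THEN Cdiff_SucD] Suc.prems(1,2)[THEN Cdiff_pd]
      Suc.prems(3,4)[THEN Cbound_SucD]
    have "Cbound k S (2 ^ k * M * N + 2 ^ k * M * N) (\<lambda>x. pd j f x * g x + f x * pd j g x)"
      using D Suc.prems(3,4) by (intro Cbound_add Cdiff_mult assms Suc.IH) simp_all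
    moreover have "pd j (\<lambda>x. f x * g x) x = pd j f x * g x + f x * pd j g x" if "x \<in> S" for x
      using Suc.prems that by (intro pd_mult) auto
    ultimately show ?thesis using Cbound_cong[OF assms(1)] by (metis (no_types, lifting) mult_2 mult.assoc power_Suc)
  qed
  moreover have "\<bar>f x * g x\<bar> \<le> 2 ^ Suc k * M * N" if "x \<in> S" for x
  proof -
    have "\<bar>f x * g x\<bar> \<le> 1 * (M * N)"
      using Suc.prems that assms by (auto simp: abs_mult intro: mult_mono)
    also have "\<dots> \<le> 2 ^ Suc k * (M * N)"
      using assms by (intro mult_right_mono one_le_power) auto
    finally show ?thesis by (simp add: mult.assoc)
  qed
  ultimately show ?case by simp
qed

text \<open>Composition with a fixed map with bounded derivatives is a bounded operation: \<open>C\<close> depends on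
  the inner map only. So an approximation of \<open>f\<close> in \<open>C\<^sup>k\<close> gives one of \<open>f \<circ> g\<close>.\<close>

lemma Cbound_compose:
  fixes g :: "real^'m::finite \<Rightarrow> real^'n::finite"
  assumes "open S" "g ` S \<subseteq> T" "0 \<le> M"
  shows "(\<And>i. Cdiff k S (\<lambda>x. g x $ i)) \<Longrightarrow> (\<And>i. Cbound k S M (\<lambda>x. g x $ i)) \<Longrightarrow>
    \<exists>C\<ge>0. \<forall>\<delta>\<ge>0. \<forall>f. Cdiff k T f \<longrightarrow> Cbound k T \<delta> f \<longrightarrow> Cbound k S (C * \<delta>) (\<lambda>x. f (g x))"
proof (induction k)
  case 0
  show ?case using assms by (intro exI[of _ 1]) auto
next
  case (Suc k)
  from Suc.IH[OF Cdiff_SucD[OF Suc.prems(1)] Cbound_SucD[OF Suc.prems(2)]]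
  obtain C where C: "C \<ge> 0" "\<And>\<delta> f. \<delta> \<ge> 0 \<Longrightarrow> Cdiff k T f \<Longrightarrow> Cbound k T \<delta> f \<Longrightarrow>
      Cbound k S (C * \<delta>) (\<lambda>x. f (g x))"
    by blast
  define K where "K = max 1 (real CARD('n) * (2 ^ k * C * M))"
  have "Cbound (Suc k) S (K * \<delta>) (\<lambda>x. f (g x))"
    if f: "\<delta> \<ge> 0" "Cdiff (Suc k) T f" "Cbound (Suc k) T \<delta> f" for \<delta> f
  proof -
    have "Cbound k S (K * \<delta>) (pd j (\<lambda>x. f (g x)))" for j
    proof -
      have D: "Cdiff k S (\<lambda>x. pd i f (g x))" for i
        by (rule Cdiff_compose[OF assms(1,2) _ Suc.prems(1)[THEN Cdiff_SucD]]) (use f in simp)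
      have B: "Cbound k S (C * \<delta>) (\<lambda>x. pd i f (g x))" for i
        by (rule C(2)) (use f in simp_all)
      have "Cbound k S (2 ^ k * (C * \<delta>) * M) (\<lambda>x. pd i f (g x) * pd j (\<lambda>x. g x $ i) x)" for i
        by (rule Cbound_mult[OF assms(1) _ assms(3) D _ B]) (use Suc.prems C f in simp_all)
      moreover have "Cdiff k S (\<lambda>x. pd i f (g x) * pd j (\<lambda>x. g x $ i) x)" for i
        by (rule Cdiff_mult[OF assms(1) D]) (use Suc.prems in simp)
      ultimately have "Cbound k S (\<Sum>i\<in>(UNIV::'n set). 2 ^ k * (C * \<delta>) * M) (\<lambda>x. \<Sum>i\<in>UNIV. pd i f (g x) * pd j (\<lambda>x. g x $ i) x)"
        by (intro Cbound_sum assms(1))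
      then have "Cbound k S (K * \<delta>) (\<lambda>x. \<Sum>i\<in>UNIV. pd i f (g x) * pd j (\<lambda>x. g x $ i) x)"
        by (rule Cbound_mono)
          (use f(1) mult_right_mono[of "real CARD('n) * (2 ^ k * C * M)" K \<delta>] in \<open>simp add: K_def mult_ac\<close>)
      moreover have "pd j (\<lambda>x. f (g x)) x = (\<Sum>i\<in>UNIV. pd i f (g x) * pd j (\<lambda>x. g x $ i) x)"
        if "x \<in> S" for x
        by (rule pd_compose(2)) (use Suc.prems(1) f that assms in auto)
      ultimately show ?thesis
        using Cbound_cong[OF assms(1), of "pd j (\<lambda>x. f (g x))"
            "\<lambda>x. \<Sum>i\<in>UNIV. pd i f (g x) * pd j (\<lambda>x. g x $ i) x"] by simp
    qed
    moreover have "\<bar>f (g x)\<bar> \<le> K * \<delta>" if "x \<in> S" for x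
    proof -
      have "\<bar>f (g x)\<bar> \<le> \<delta>" using f that assms by auto
      also have "\<dots> \<le> K * \<delta>" using f(1) mult_right_mono[of 1 K \<delta>] by (simp add: K_def)
      finally show ?thesis .
    qed
    ultimately show ?thesis by simp
  qed
  then show ?case by (intro exI[of _ K]) (auto simp: K_def)
qed

section \<open>Polynomial approximation in \<open>C\<^sup>k\<close>\<close>

text \<open>The convolution of \<open>F\<close> with a kernel that is cut off outside a box.\<close>

definition conv :: "real^'n \<Rightarrow> real^'n \<Rightarrow> (real^'n \<Rightarrow> real) \<Rightarrow> (real^'n::finite \<Rightarrow> real) \<Rightarrow> real^'n \<Rightarrow> real" where
  "conv a b \<psi> F x = integral (cbox a b) (\<lambda>y. F (x - y) * \<psi> y)"

lemma Cdiff_SucE: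
  assumes "Cdiff (Suc k) UNIV F"
  shows "F differentiable (at x)" "continuous_on UNIV (pd j F)"
  using assms Cdiff_continuous[of k UNIV "pd j F"] by auto

lemma continuous_on_UNIV_compose:
  assumes "continuous_on UNIV F" "continuous_on S g"
  shows "continuous_on S (\<lambda>x. F (g x))"
  using continuous_on_compose2[OF assms] by simp

lemma continuous_on_snd_compose:
  assumes "continuous_on T \<psi>"
  shows "continuous_on (S \<times> T) (\<lambda>p. \<psi> (snd p))"
  by (rule continuous_on_compose2[OF assms]) (auto intro: continuous_intros)

lemma conv_integrable:
  fixes F :: "real^'n::finite \<Rightarrow> real"
  assumes "continuous_on UNIV F" "continuous_on (cbox a b) \<psi>"
  shows "(\<lambda>y. F (x - y) * \<psi> y) integrable_on cbox a b"
  by (intro integrable_continuous continuous_intros continuous_on_UNIV_compose[OF assms(1)] assms(2))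

lemma conv_continuous:
  fixes F :: "real^'n::finite \<Rightarrow> real"
  assumes "continuous_on UNIV F" "continuous_on (cbox a b) \<psi>"
  shows "continuous_on UNIV (conv a b \<psi> F)"
proof -
  have "continuous_on (UNIV \<times> cbox a b) (\<lambda>(x, y). F (x - y) * \<psi> y)"
    unfolding split_beta
    by (intro continuous_intros continuous_on_UNIV_compose[OF assms(1)] continuous_on_snd_compose[OF assms(2)])
  from integral_continuous_on_param[OF this] show ?thesis
    by (simp add: conv_def[abs_def])
qed

text \<open>Derivatives fall on \<open>F\<close>, so the kernel need not be differentiable. Hence convolution
  approximates \<open>F\<close> together with its derivatives as soon as it approximates continuous functions.\<close>

lemma conv_pd:
  fixes F :: "real^'n::finite \<Rightarrow> real"
  assumes F: "\<And>x. F differentiable (at x)" "\<And>j. continuous_on UNIV (pd j F)"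
    and \<psi>: "continuous_on (cbox a b) \<psi>"
  shows "conv a b \<psi> F differentiable (at x)" "pd j (conv a b \<psi> F) x = conv a b \<psi> (pd j F) x"
proof -
  define e :: "'n \<Rightarrow> (real^'n) \<Rightarrow>\<^sub>L real" where "e j = Blinfun (\<lambda>h. h $ j)" for j
  have e: "blinfun_apply (e j) h = h $ j" for j h
    by (simp add: e_def bounded_linear_Blinfun_apply bounded_linear_vec_nth)
  define fx where "fx x y = (\<Sum>j\<in>UNIV. (pd j F (x - y) * \<psi> y) *\<^sub>R e j)" for x y
  have fx: "blinfun_apply (fx x y) h = (\<Sum>j\<in>UNIV. h $ j * pd j F (x - y)) * \<psi> y" for x y h
    by (simp add: fx_def e blinfun.sum_left blinfun.scaleR_left sum_distrib_left mult_ac)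
  have FC: "continuous_on UNIV F"
    using F(1) by (simp add: continuous_on_eq_continuous_within differentiable_imp_continuous_within)
  have "((\<lambda>x. integral (cbox a b) (\<lambda>y. F (x - y) * \<psi> y)) has_derivative
      integral (cbox a b) (fx x)) (at x within UNIV)" (is "(?c has_derivative blinfun_apply ?I) _")
  proof (rule leibniz_rule)
    fix x y :: "real^'n"
    have "((\<lambda>x. x - y) has_derivative (\<lambda>h. h)) (at x)"
      by (auto intro!: derivative_eq_intros)
    from has_derivative_compose[OF this has_derivative_pd[OF F(1)]]
    have "((\<lambda>x. F (x - y)) has_derivative (\<lambda>h. \<Sum>j\<in>UNIV. h $ j * pd j F (x - y))) (at x)" .
    then show "((\<lambda>x. F (x - y) * \<psi> y) has_derivative blinfun_apply (fx x y)) (at x within UNIV)"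
      using has_derivative_mult_left[of "\<lambda>x. F (x - y)" _ "at x" "\<psi> y"] by (simp add: fx[abs_def])
  next
    show "(\<lambda>y. F (x - y) * \<psi> y) integrable_on cbox a b" for x
      by (rule conv_integrable[OF FC \<psi>])
  next
    show "continuous_on (UNIV \<times> cbox a b) (\<lambda>(x, y). fx x y)"
      unfolding split_beta fx_def
      by (intro continuous_intros continuous_on_UNIV_compose[OF F(2)] continuous_on_snd_compose[OF \<psi>])
  qed auto
  then have d: "(conv a b \<psi> F has_derivative ?I) (at x)"
    by (simp add: conv_def[abs_def])
  then show "conv a b \<psi> F differentiable (at x)" by (rule differentiableI)
  have "fx x integrable_on cbox a b"
    unfolding fx_def
    by (intro integrable_continuous continuous_intros continuous_on_UNIV_compose[OF F(2)] \<psi>)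
  then have "?I (axis j 1) = integral (cbox a b) (\<lambda>y. fx x y (axis j 1))"
    by (rule blinfun_apply_integral)
  also have "\<dots> = conv a b \<psi> (pd j F) x"
    by (simp add: fx conv_def axis_def if_distrib[of "\<lambda>c. c * _"] cong: if_cong)
  finally show "pd j (conv a b \<psi> F) x = conv a b \<psi> (pd j F) x"
    using pd_eqI[OF d] by simp
qed

lemma Cdiff_conv:
  assumes "continuous_on (cbox a b) \<psi>"
  shows "Cdiff k UNIV F \<Longrightarrow> Cdiff k UNIV (conv a b \<psi> F)"
proof (induction k arbitrary: F)
  case 0
  then show ?case using conv_continuous assms by simp
next
  case (Suc k)
  note F = Cdiff_SucE[OF Suc.prems]
  have "pd j (conv a b \<psi> F) = conv a b \<psi> (pd j F)" for j
    using conv_pd(2)[OF F assms] by auto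
  then show ?case using Suc conv_pd(1)[OF F assms] by simp
qed

text \<open>Two kernels that are uniformly close give convolutions close in \<open>C\<^sup>k\<close>; applied to the difference
  of a bump function and a polynomial approximating it.\<close>

lemma Cbound_conv_small:
  fixes F :: "real^'n::finite \<Rightarrow> real"
  assumes "continuous_on (cbox a b) \<psi>" "\<And>y. y \<in> cbox a b \<Longrightarrow> \<bar>\<psi> y\<bar> \<le> \<delta>" "0 \<le> \<delta>" "0 \<le> M"
  shows "Cdiff k UNIV F \<Longrightarrow> Cbound k UNIV M F \<Longrightarrow>
    Cbound k UNIV (M * \<delta> * Henstock_Kurzweil_Integration.content (cbox a b)) (conv a b \<psi> F)"
proof (induction k arbitrary: F)
  have *: "\<bar>conv a b \<psi> F x\<bar> \<le> M * \<delta> * Henstock_Kurzweil_Integration.content (cbox a b)"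
    if F: "continuous_on UNIV F" "\<And>x. \<bar>F x\<bar> \<le> M" for F x
  proof -
    have "norm (conv a b \<psi> F x) \<le> M * \<delta> * Henstock_Kurzweil_Integration.content (cbox a b)"
      unfolding conv_def using assms F(2)
      by (intro has_integral_bound[OF _ integrable_integral[OF conv_integrable[OF F(1) assms(1)]]])
        (auto simp: abs_mult intro: mult_mono)
    then show ?thesis by simp
  qed
  {
    case 0
    then show ?case using * by simp
  next
    case (Suc k)
    note F = Cdiff_SucE[OF Suc.prems(1)]
    have "pd j (conv a b \<psi> F) = conv a b \<psi> (pd j F)" for j
      using conv_pd(2)[OF F assms(1)] by auto
    then show ?case using Suc *[OF Cdiff_continuous[OF Suc.prems(1)]] by simp
  }
qed

lemma pd_zero_outside:
  assumes "\<And>x. norm x > R \<Longrightarrow> F x = 0" "norm x > R"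
  shows "pd j F x = 0"
proof -
  have "open {x::real^'n. norm x > R}"
    by (intro open_Collect_less continuous_intros)
  then have "pd j F x = pd j (\<lambda>x. 0) x"
    by (rule pd_cong_open) (use assms in auto)
  then show ?thesis by simp
qed

lemma compact_support_Cbound:
  "Cdiff k UNIV F \<Longrightarrow> (\<And>x. norm x > R \<Longrightarrow> F x = 0) \<Longrightarrow> \<exists>M\<ge>0. Cbound k UNIV M F"
proof (induction k arbitrary: F)
  have *: "\<exists>M\<ge>0. \<forall>x. \<bar>F x\<bar> \<le> M"
    if F: "continuous_on UNIV F" "\<And>x. norm x > R \<Longrightarrow> F x = 0" for F :: "real^'a \<Rightarrow> real"
  proof -
    have "bounded (F ` cball 0 R)"
      by (intro compact_imp_bounded compact_continuous_image continuous_on_subset[OF F(1)]) auto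
    then obtain M where M: "\<And>x. norm x \<le> R \<Longrightarrow> \<bar>F x\<bar> \<le> M"
      unfolding bounded_iff by fastforce
    have "\<bar>F x\<bar> \<le> max 0 M" for x using M[of x] F(2)[of x] by (cases "norm x \<le> R") auto
    then show ?thesis by (intro exI[of _ "max 0 M"]) auto
  qed
  {
    case 0
    then show ?case using *[of F] by simp
  next
    case (Suc k)
    have "\<exists>M\<ge>0. Cbound k UNIV M (pd j F)" for j
      using Suc.prems pd_zero_outside[of R F] by (intro Suc.IH) auto
    then obtain N where N: "\<And>j. N j \<ge> 0 \<and> Cbound k UNIV (N j) (pd j F)" by metis
    obtain M where M: "M \<ge> 0" "\<And>x. \<bar>F x\<bar> \<le> M"
      using *[OF Cdiff_continuous[OF Suc.prems(1)] Suc.prems(2)] by auto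
    have "Cbound k UNIV (M + (\<Sum>j\<in>UNIV. N j)) (pd j F)" for j
    proof (rule Cbound_mono)
      show "Cbound k UNIV (N j) (pd j F)" using N by auto
      show "N j \<le> M + (\<Sum>j\<in>UNIV. N j)" using M(1) N member_le_sum[of j UNIV N] by force
    qed
    moreover have "\<bar>F x\<bar> \<le> M + (\<Sum>j\<in>UNIV. N j)" for x
      using M(2)[of x] N sum_nonneg[of UNIV N] by force
    ultimately show ?case using M(1) N by (intro exI[of _ "M + (\<Sum>j\<in>UNIV. N j)"]) (auto simp: sum_nonneg)
  }
qed

lemma compact_support_uniformly_continuous:
  fixes F :: "real^'n::finite \<Rightarrow> real"
  assumes F: "continuous_on UNIV F" "\<And>x. norm x > R \<Longrightarrow> F x = 0" and "\<epsilon> > 0"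
  shows "\<exists>\<eta>>0. \<forall>x y. norm y \<le> \<eta> \<longrightarrow> \<bar>F x - F (x - y)\<bar> \<le> \<epsilon>"
proof -
  have "uniformly_continuous_on (cball 0 (R + 2)) F"
    by (intro compact_uniformly_continuous continuous_on_subset[OF F(1)]) auto
  then obtain d where d: "d > 0" "\<And>x y. x \<in> cball 0 (R + 2) \<Longrightarrow> y \<in> cball 0 (R + 2) \<Longrightarrow>
      dist y x < d \<Longrightarrow> dist (F y) (F x) < \<epsilon>"
    unfolding uniformly_continuous_on_def using assms(3) by metis
  have "\<bar>F x - F (x - y)\<bar> \<le> \<epsilon>" if "norm y \<le> min 1 (d/2)" for x y
  proof (cases "norm x \<le> R + 1")
    case True
    then have "norm (x - y) \<le> R + 2" using that norm_triangle_ineq4[of x y] by linarith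
    then have "dist (F x) (F (x - y)) < \<epsilon>" using True that d(1) by (intro d(2)) (auto simp: dist_norm norm_minus_commute)
    then show ?thesis by (simp add: dist_norm)
  next
    case False
    then have "norm (x - y) > R" using that norm_triangle_ineq2[of x y] by linarith
    then show ?thesis using False F(2) assms(3) by simp
  qed
  then show ?thesis using d(1) by (intro exI[of _ "min 1 (d/2)"]) auto
qed

text \<open>Kernels of mass one concentrated near the origin form an approximate identity. The claim for
  \<open>k = 0\<close> is uniform continuity, and it is applied to every partial derivative in turn; one radius
  serves the finitely many of them.\<close>

lemma Cbound_conv_approx_identity:
  fixes F :: "real^'n::finite \<Rightarrow> real"
  assumes "\<epsilon> > 0"
  shows "Cdiff k UNIV F \<Longrightarrow> (\<And>x. norm x > R \<Longrightarrow> F x = 0) \<Longrightarrow>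
    \<exists>\<eta>>0. \<forall>\<psi>. continuous_on (cbox a b) \<psi> \<longrightarrow> (\<forall>y\<in>cbox a b. 0 \<le> \<psi> y) \<longrightarrow>
       (\<forall>y\<in>cbox a b. norm y > \<eta> \<longrightarrow> \<psi> y = 0) \<longrightarrow> integral (cbox a b) \<psi> = 1 \<longrightarrow>
       Cbound k UNIV \<epsilon> (\<lambda>x. F x - conv a b \<psi> F x)"
proof (induction k arbitrary: F)
  have *: "\<exists>\<eta>>0. \<forall>\<psi>. continuous_on (cbox a b) \<psi> \<longrightarrow> (\<forall>y\<in>cbox a b. 0 \<le> \<psi> y) \<longrightarrow>
       (\<forall>y\<in>cbox a b. norm y > \<eta> \<longrightarrow> \<psi> y = 0) \<longrightarrow> integral (cbox a b) \<psi> = 1 \<longrightarrow>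
       (\<forall>x. \<bar>F x - conv a b \<psi> F x\<bar> \<le> \<epsilon>)"
    if F: "continuous_on UNIV F" "\<And>x. norm x > R \<Longrightarrow> F x = 0" for F :: "real^'n \<Rightarrow> real"
  proof -
    obtain \<eta> where \<eta>: "\<eta> > 0" "\<And>x y. norm y \<le> \<eta> \<Longrightarrow> \<bar>F x - F (x - y)\<bar> \<le> \<epsilon>"
      using compact_support_uniformly_continuous[OF F(1) F(2) assms] by metis
    have "\<bar>F x - conv a b \<psi> F x\<bar> \<le> \<epsilon>"
      if \<psi>: "continuous_on (cbox a b) \<psi>" "\<forall>y\<in>cbox a b. 0 \<le> \<psi> y"
        "\<forall>y\<in>cbox a b. norm y > \<eta> \<longrightarrow> \<psi> y = 0" "integral (cbox a b) \<psi> = 1" for \<psi> x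
    proof -
      note I = integrable_continuous[OF \<psi>(1)]
      have "F x - conv a b \<psi> F x = integral (cbox a b) (\<lambda>y. F x * \<psi> y) - conv a b \<psi> F x"
        by (simp add: \<psi>(4))
      also have "\<dots> = integral (cbox a b) (\<lambda>y. F x * \<psi> y - F (x - y) * \<psi> y)"
        unfolding conv_def
        by (rule integral_diff[symmetric]) (use I conv_integrable[OF F(1) \<psi>(1)] in \<open>auto intro: integrable_on_mult_right\<close>)
      finally have eq: "F x - conv a b \<psi> F x = integral (cbox a b) (\<lambda>y. F x * \<psi> y - F (x - y) * \<psi> y)" .
      have "norm (F x - conv a b \<psi> F x) \<le> integral (cbox a b) (\<lambda>y. \<epsilon> * \<psi> y)"
        unfolding eq
      proof (rule integral_norm_bound_integral)
        show "(\<lambda>y. F x * \<psi> y - F (x - y) * \<psi> y) integrable_on cbox a b"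
          by (intro integrable_diff integrable_on_mult_right I conv_integrable[OF F(1) \<psi>(1)])
        show "(\<lambda>y. \<epsilon> * \<psi> y) integrable_on cbox a b" by (intro integrable_on_mult_right I)
        fix y assume y: "y \<in> cbox a b"
        show "norm (F x * \<psi> y - F (x - y) * \<psi> y) \<le> \<epsilon> * \<psi> y"
        proof (cases "norm y \<le> \<eta>")
          case True
          have "norm (F x * \<psi> y - F (x - y) * \<psi> y) = \<bar>F x - F (x - y)\<bar> * \<psi> y"
            using \<psi>(2) y by (simp add: abs_mult flip: left_diff_distrib)
          also have "\<dots> \<le> \<epsilon> * \<psi> y" using \<eta>(2)[OF True] \<psi>(2) y by (intro mult_right_mono) auto
          finally show ?thesis .
        qed (use \<psi>(3) y in auto)
      qed
      then show ?thesis by (simp add: \<psi>(4))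
    qed
    then show ?thesis using \<eta>(1) by blast
  qed
  {
    case 0
    then show ?case using *[of F] by simp
  next
    case (Suc k)
    note F = Cdiff_SucE[OF Suc.prems(1)]
    let ?P = "\<lambda>\<eta> \<psi>. continuous_on (cbox a b) \<psi> \<and> (\<forall>y\<in>cbox a b. 0 \<le> \<psi> y) \<and>
       (\<forall>y\<in>cbox a b. norm y > \<eta> \<longrightarrow> \<psi> y = 0) \<and> integral (cbox a b) \<psi> = 1"
    have "\<exists>\<eta>>0. \<forall>\<psi>. ?P \<eta> \<psi> \<longrightarrow> Cbound k UNIV \<epsilon> (\<lambda>x. pd j F x - conv a b \<psi> (pd j F) x)" for j
    proof -
      have "pd j F x = 0" if "norm x > R" for x
        using Suc.prems(2) that by (rule pd_zero_outside)
      from Suc.IH[OF Cdiff_pd[OF Suc.prems(1)] this] show ?thesis by (simp add: imp_conjL)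
    qed
    then have "\<forall>j. \<exists>\<eta>>0. \<forall>\<psi>. ?P \<eta> \<psi> \<longrightarrow> Cbound k UNIV \<epsilon> (\<lambda>x. pd j F x - conv a b \<psi> (pd j F) x)"
      by (rule allI)
    from choice[OF this] obtain \<eta> where "\<forall>j. 0 < \<eta> j \<and>
        (\<forall>\<psi>. ?P (\<eta> j) \<psi> \<longrightarrow> Cbound k UNIV \<epsilon> (\<lambda>x. pd j F x - conv a b \<psi> (pd j F) x))" by (elim exE)
    then have \<eta>: "\<And>j. \<eta> j > 0"
      "\<And>j \<psi>. ?P (\<eta> j) \<psi> \<Longrightarrow> Cbound k UNIV \<epsilon> (\<lambda>x. pd j F x - conv a b \<psi> (pd j F) x)" by simp_all
    obtain \<eta>0 where \<eta>0: "\<eta>0 > 0" "\<And>\<psi> x. ?P \<eta>0 \<psi> \<Longrightarrow> \<bar>F x - conv a b \<psi> F x\<bar> \<le> \<epsilon>"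
      using *[OF Cdiff_continuous[OF Suc.prems(1)] Suc.prems(2)] by auto
    define h where "h = min \<eta>0 (Min (range \<eta>))"
    have h: "h > 0" "h \<le> \<eta>0" "\<And>j. h \<le> \<eta> j"
      using \<eta>(1) \<eta>0(1) by (auto simp: h_def min.coboundedI2)
    have "Cbound (Suc k) UNIV \<epsilon> (\<lambda>x. F x - conv a b \<psi> F x)" if "?P h \<psi>" for \<psi>
    proof -
      have P: "?P \<eta>0 \<psi>" "\<And>j. ?P (\<eta> j) \<psi>" using that h(2) h(3) by (auto dest: order_le_less_trans)
      then have c: "continuous_on (cbox a b) \<psi>" by simp
      have "pd j (\<lambda>x. F x - conv a b \<psi> F x) = (\<lambda>x. pd j F x - conv a b \<psi> (pd j F) x)" for j
      proof
        fix x
        have "(F has_derivative frechet_derivative F (at x)) (at x)"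
          "(conv a b \<psi> F has_derivative frechet_derivative (conv a b \<psi> F) (at x)) (at x)"
          using F(1) conv_pd(1)[OF F c] by (simp_all add: frechet_derivative_works[symmetric])
        from pd_eqI[OF has_derivative_diff[OF this], of j]
        show "pd j (\<lambda>x. F x - conv a b \<psi> F x) x = pd j F x - conv a b \<psi> (pd j F) x"
          using conv_pd(2)[OF F c, of j x] by (simp add: pd_def)
      qed
      then show ?thesis using \<eta>(2)[OF P(2)] \<eta>0(2)[OF P(1)] by simp
    qed
    then show ?case using h(1) by auto
  }
qed

lemma exists_bump_kernel:
  fixes a b :: "real^'n::finite"
  assumes "\<eta> > 0" "0 \<in> box a b"
  shows "\<exists>\<psi>. continuous_on (cbox a b) \<psi> \<and> (\<forall>y\<in>cbox a b. 0 \<le> \<psi> y) \<and>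
    (\<forall>y\<in>cbox a b. norm y > \<eta> \<longrightarrow> \<psi> y = 0) \<and> integral (cbox a b) \<psi> = (1::real)"
proof -
  define f where "f y = max 0 (\<eta> - norm y)" for y :: "real^'n"
  have f: "continuous_on (cbox a b) f"
    unfolding f_def by (intro continuous_intros)
  have 0: "0 \<in> cbox a b" using assms(2) box_subset_cbox by blast
  have "integral (cbox a b) f \<noteq> 0"
  proof
    assume "integral (cbox a b) f = 0"
    then have "(f has_integral 0) (cbox a b)"
      using integrable_integral[OF integrable_continuous[OF f]] by simp
    from has_integral_0_cbox_imp_0[OF f _ this _ 0] have "f 0 = 0"
      using assms(2) by (force simp: f_def)
    then show False using assms(1) by (simp add: f_def)
  qed
  moreover have "integral (cbox a b) f \<ge> 0"
    by (rule integral_nonneg[OF integrable_continuous[OF f]]) (auto simp: f_def)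
  ultimately have I: "integral (cbox a b) f > 0" by simp
  show ?thesis
  proof (intro exI conjI)
    show "continuous_on (cbox a b) (\<lambda>y. f y / integral (cbox a b) f)"
      using f I by (intro continuous_intros) auto
    show "integral (cbox a b) (\<lambda>y. f y / integral (cbox a b) f) = 1" using I by simp
  qed (use I in \<open>auto simp: f_def\<close>)
qed

text \<open>A polynomial in \<open>x - z\<close> is a finite sum of products of a polynomial in \<open>x\<close> and a continuous
  function of \<open>z\<close>. Integrating against a function of \<open>z\<close> therefore leaves a polynomial in \<open>x\<close>.\<close>

lemma real_polynomial_function_diff_separable:
  fixes q :: "real^'n::finite \<Rightarrow> real"
  assumes "real_polynomial_function q"
  shows "\<exists>ps. (\<forall>(p, r)\<in>set ps. real_polynomial_function p \<and> continuous_on UNIV r) \<and>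
     (\<forall>x z. q (x - z) = (\<Sum>(p, r)\<leftarrow>ps. p x * r z))"
  using assms
proof induction
  case (linear f)
  then have "f (x - z) = f x - f z" for x z by (simp add: linear_diff bounded_linear.linear)
  moreover have "continuous_on UNIV (\<lambda>z. - f z)"
    using linear by (intro continuous_intros linear_continuous_on)
  ultimately show ?case using linear
    by (intro exI[of _ "[(f, \<lambda>_. 1), (\<lambda>_. 1, \<lambda>z. - f z)]"])
      (auto intro: real_polynomial_function.intros)
next
  case (const c)
  show ?case
    by (intro exI[of _ "[(\<lambda>_. c, \<lambda>_. 1)]"]) (auto intro: real_polynomial_function.intros)
next
  case (add f g)
  then obtain ps qs where "(\<forall>(p, r)\<in>set ps. real_polynomial_function p \<and> continuous_on UNIV r) \<and>
     (\<forall>x z. f (x - z) = (\<Sum>(p, r)\<leftarrow>ps. p x * r z))"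
     "(\<forall>(p, r)\<in>set qs. real_polynomial_function p \<and> continuous_on UNIV r) \<and>
     (\<forall>x z. g (x - z) = (\<Sum>(p, r)\<leftarrow>qs. p x * r z))" by blast
  then show ?case by (intro exI[of _ "ps @ qs"]) auto
next
  case (mult f g)
  then obtain ps qs where ps: "(\<forall>(p, r)\<in>set ps. real_polynomial_function p \<and> continuous_on UNIV r)"
     "(\<forall>x z. f (x - z) = (\<Sum>(p, r)\<leftarrow>ps. p x * r z))"
     and qs: "(\<forall>(p, r)\<in>set qs. real_polynomial_function p \<and> continuous_on UNIV r)"
     "(\<forall>x z. g (x - z) = (\<Sum>(p, r)\<leftarrow>qs. p x * r z))" by blast
  define m where "m = map (\<lambda>((p, r), (p', r')). (\<lambda>x. p x * p' x, \<lambda>z. r z * r' z :: real)) (List.product ps qs)"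
  have "(\<Sum>(p, r)\<leftarrow>ps. p x * r z) * (\<Sum>(p, r)\<leftarrow>qs. p x * r z) = (\<Sum>(p, r)\<leftarrow>m. p x * r z)" for x z
    unfolding m_def
    by (induction ps) (auto simp: algebra_simps o_def split_beta sum_list_const_mult[symmetric])
  moreover have "\<forall>(p, r)\<in>set m. real_polynomial_function p \<and> continuous_on UNIV r"
    using ps(1) qs(1) unfolding m_def by (fastforce intro: real_polynomial_function.intros continuous_intros)
  ultimately show ?case using ps(2) qs(2) by (intro exI[of _ m]) auto
qed

lemma real_polynomial_function_integral:
  fixes F :: "real^'n::finite \<Rightarrow> real"
  assumes "real_polynomial_function q" "continuous_on UNIV F"
  shows "real_polynomial_function (\<lambda>x. integral (cbox a b) (\<lambda>z. F z * q (x - z)))"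
proof -
  obtain ps where ps: "(\<forall>(p, r)\<in>set ps. real_polynomial_function p \<and> continuous_on UNIV r)"
     "\<And>x z. q (x - z) = (\<Sum>(p, r)\<leftarrow>ps. p x * r z)"
    using real_polynomial_function_diff_separable[OF assms(1)] by blast
  from ps(1) have "real_polynomial_function (\<lambda>x. integral (cbox a b) (\<lambda>z. F z * (\<Sum>(p, r)\<leftarrow>ps. p x * r z)))
    \<and> (\<forall>x. (\<lambda>z. F z * (\<Sum>(p, r)\<leftarrow>ps. p x * r z)) integrable_on cbox a b)"
  proof (induction ps)
    case Nil
    then show ?case by (auto intro: real_polynomial_function.intros(2))
  next
    case (Cons pr ps)
    obtain p r where pr: "pr = (p, r)" by force
    then have r: "continuous_on UNIV r" using Cons.prems by simp
    have i: "(\<lambda>z. p x * (F z * r z)) integrable_on cbox a b" for x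
      by (intro integrable_continuous continuous_intros continuous_on_subset[OF assms(2)]
        continuous_on_subset[OF r]) auto
    have e: "(\<lambda>z. F z * (\<Sum>(p, r)\<leftarrow>pr # ps. p x * r z)) =
        (\<lambda>z. p x * (F z * r z) + F z * (\<Sum>(p, r)\<leftarrow>ps. p x * r z))" for x
      by (auto simp: pr algebra_simps)
    have "integral (cbox a b) (\<lambda>z. F z * (\<Sum>(p, r)\<leftarrow>pr # ps. p x * r z)) =
        p x * integral (cbox a b) (\<lambda>z. F z * r z) + integral (cbox a b) (\<lambda>z. F z * (\<Sum>(p, r)\<leftarrow>ps. p x * r z))" for x
      unfolding e using i Cons by (subst integral_add) auto
    then show ?case using Cons pr i unfolding e
      by (auto intro!: real_polynomial_function.intros(2-) integrable_add)
  qed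
  then show ?thesis by (simp add: ps(2))
qed

text \<open>The substitution \<open>z = x - y\<close>. The last assumption says that the truncation box of the kernel is
  large enough to be invisible at the point \<open>x\<close>.\<close>

lemma conv_swap:
  fixes F :: "real^'n::finite \<Rightarrow> real"
  assumes F: "continuous_on UNIV F" "\<And>x. x \<notin> cbox a' b' \<Longrightarrow> F x = 0" and q: "continuous_on UNIV q"
    and sub: "\<And>y. x - y \<in> cbox a' b' \<Longrightarrow> y \<in> cbox a b"
  shows "conv a b q F x = integral (cbox a' b') (\<lambda>z. F z * q (x - z))"
proof -
  have "(\<lambda>z. F z * q (x - z)) integrable_on cbox a' b'"
    by (intro integrable_continuous continuous_intros continuous_on_UNIV_compose[OF q] continuous_on_subset[OF F(1)]) auto
  then have "((\<lambda>z. F z * q (x - z)) has_integral integral (cbox a' b') (\<lambda>z. F z * q (x - z))) (cbox a' b')"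
    (is "(_ has_integral ?I) _") by (rule integrable_integral)
  from has_integral_affinity[OF this, of "-1" x]
  have "((\<lambda>y. F (x - y) * q y) has_integral ?I) ((\<lambda>y. x - y) ` cbox a' b')"
    by simp
  then have "((\<lambda>y. F (x - y) * q y) has_integral ?I) UNIV"
  proof (rule has_integral_on_superset)
    fix y assume "y \<notin> (\<lambda>y. x - y) ` cbox a' b'"
    then have "x - y \<notin> cbox a' b'" by (metis diff_diff_eq2 add_diff_cancel_left' image_eqI)
    then show "F (x - y) * q y = 0" using F(2) by simp
  qed auto
  moreover have "((\<lambda>y. F (x - y) * q y) has_integral conv a b q F x) (cbox a b)"
    unfolding conv_def using conv_integrable[OF F(1) continuous_on_subset[OF q]] by (intro integrable_integral) auto
  then have "((\<lambda>y. F (x - y) * q y) has_integral conv a b q F x) UNIV"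
    by (rule has_integral_on_superset) (use sub F(2) in auto)
  ultimately show ?thesis using has_integral_unique by blast
qed

text \<open>Convolution with a continuous bump function approximates \<open>F\<close> in \<open>C\<^sup>k\<close>. By Weierstrass the bump
  function is uniformly close to a polynomial on a large box, and replacing it by this polynomial
  changes the convolution little in \<open>C\<^sup>k\<close>. On the ball the new convolution is a polynomial, because
  the compact support of \<open>F\<close> makes the truncation of the kernel irrelevant there.\<close>

theorem Ck_polynomial_approximation:
  fixes F :: "real^'n::finite \<Rightarrow> real"
  assumes F: "Cdiff k UNIV F" "\<And>x. norm x > R \<Longrightarrow> F x = 0" and "\<epsilon> > 0"
  obtains p where "real_polynomial_function p" "Cbound k (ball 0 \<rho>) \<epsilon> (\<lambda>x. F x - p x)"
proof -
  define r where "r = \<bar>\<rho>\<bar> + \<bar>R\<bar> + 1"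
  define a where "a = (\<chi> i. - r :: real^'n)"
  define b where "b = (\<chi> i. r :: real^'n)"
  define a' where "a' = (\<chi> i. - \<bar>R\<bar> :: real^'n)"
  define b' where "b' = (\<chi> i. \<bar>R\<bar> :: real^'n)"
  have "0 \<in> box a b" by (auto simp: mem_box_cart a_def b_def r_def)
  obtain \<eta> where "\<eta> > 0" and \<eta>: "\<forall>\<psi>. continuous_on (cbox a b) \<psi> \<longrightarrow> (\<forall>y\<in>cbox a b. 0 \<le> \<psi> y) \<longrightarrow>
       (\<forall>y\<in>cbox a b. norm y > \<eta> \<longrightarrow> \<psi> y = 0) \<longrightarrow> integral (cbox a b) \<psi> = 1 \<longrightarrow>
       Cbound k UNIV (\<epsilon>/2) (\<lambda>x. F x - conv a b \<psi> F x)"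
  proof -
    have "\<exists>\<eta>>0. \<forall>\<psi>. continuous_on (cbox a b) \<psi> \<longrightarrow> (\<forall>y\<in>cbox a b. 0 \<le> \<psi> y) \<longrightarrow>
       (\<forall>y\<in>cbox a b. norm y > \<eta> \<longrightarrow> \<psi> y = 0) \<longrightarrow> integral (cbox a b) \<psi> = 1 \<longrightarrow>
       Cbound k UNIV (\<epsilon>/2) (\<lambda>x. F x - conv a b \<psi> F x)"
      by (rule Cbound_conv_approx_identity[OF half_gt_zero[OF assms(3)] F(1)]) (rule F(2))
    then show thesis using that by (elim exE conjE)
  qed
  obtain \<psi> where \<psi>: "continuous_on (cbox a b) \<psi>" "\<forall>y\<in>cbox a b. 0 \<le> \<psi> y"
    "\<forall>y\<in>cbox a b. norm y > \<eta> \<longrightarrow> \<psi> y = 0" "integral (cbox a b) \<psi> = (1::real)"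
    using exists_bump_kernel[OF \<open>\<eta> > 0\<close> \<open>0 \<in> box a b\<close>] by (elim exE conjE)
  obtain M where M: "M \<ge> 0" "Cbound k UNIV M F"
  proof -
    have "\<exists>M\<ge>0. Cbound k UNIV M F" by (rule compact_support_Cbound[OF F(1)]) (rule F(2))
    then show thesis using that by blast
  qed
  let ?V = "Henstock_Kurzweil_Integration.content (cbox a b)"
  \<comment> \<open>Changing the kernel by at most \<open>\<delta>\<close> changes the convolution in \<open>C\<^sup>k\<close> by at most \<open>M \<delta> V\<close>.\<close>
  define \<delta> where "\<delta> = \<epsilon> / 2 / (M * ?V + 1)"
  have MV: "M * ?V \<ge> 0" using M(1) by simp
  have \<delta>: "\<delta> > 0" "M * \<delta> * ?V \<le> \<epsilon> / 2"
    using MV assms(3) by (auto simp: \<delta>_def field_simps add_pos_nonneg)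
  obtain q where q: "real_polynomial_function q" "\<And>y. y \<in> cbox a b \<Longrightarrow> \<bar>\<psi> y - q y\<bar> < \<delta>"
    by (rule Stone_Weierstrass_real_polynomial_function[OF compact_cbox \<psi>(1) \<delta>(1)]) blast
  have qc: "continuous_on S q" for S
    using q(1) by (simp add: continuous_on_polymonial_function real_polynomial_function_eq)
  have \<psi>q: "continuous_on (cbox a b) (\<lambda>y. \<psi> y - q y)"
    by (intro continuous_intros \<psi>(1) qc)
  define p where "p x = integral (cbox a' b') (\<lambda>z. F z * q (x - z))" for x
  have FC: "continuous_on UNIV F" using F(1) by (rule Cdiff_continuous)
  have "Cbound k UNIV (\<epsilon>/2 + \<epsilon>/2) (\<lambda>x. (F x - conv a b \<psi> F x) + conv a b (\<lambda>y. \<psi> y - q y) F x)"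
  proof (rule Cbound_add)
    show "Cbound k UNIV (\<epsilon>/2) (\<lambda>x. F x - conv a b \<psi> F x)" using \<eta> \<psi> by simp
    have "Cbound k UNIV (M * \<delta> * ?V) (conv a b (\<lambda>y. \<psi> y - q y) F)"
      by (rule Cbound_conv_small[OF \<psi>q _ _ M(1) F(1) M(2)]) (use q(2) \<delta>(1) in \<open>auto intro: less_imp_le\<close>)
    then show "Cbound k UNIV (\<epsilon>/2) (conv a b (\<lambda>y. \<psi> y - q y) F)"
      using \<delta>(2) by (rule Cbound_mono)
  qed (use F(1) \<psi>(1) \<psi>q in \<open>auto intro: Cdiff_diff Cdiff_conv\<close>)
  moreover have "conv a b (\<lambda>y. \<psi> y - q y) F x = conv a b \<psi> F x - conv a b q F x" for x
    unfolding conv_def right_diff_distrib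
    by (rule integral_diff) (intro conv_integrable FC \<psi>(1) qc)+
  ultimately have "Cbound k UNIV \<epsilon> (\<lambda>x. F x - conv a b q F x)" by simp
  then have B: "Cbound k (ball 0 \<rho>) \<epsilon> (\<lambda>x. F x - conv a b q F x)"
    by (rule Cbound_subset) auto
  have eq: "conv a b q F x = p x" if "x \<in> ball 0 \<rho>" for x
    unfolding p_def
  proof (rule conv_swap[OF FC _ qc])
    fix z assume z: "z \<notin> cbox a' b'"
    then obtain i where "\<not> (- \<bar>R\<bar> \<le> z $ i \<and> z $ i \<le> \<bar>R\<bar>)"
      by (auto simp: mem_box_cart a'_def b'_def)
    then have "\<bar>z $ i\<bar> > \<bar>R\<bar>" by linarith
    then have "norm z > R" using component_le_norm_cart[of z i] by linarith
    then show "F z = 0" by (rule F(2))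
  next
    fix y assume y: "x - y \<in> cbox a' b'"
    have "- r \<le> y $ i \<and> y $ i \<le> r" for i
    proof -
      have "\<bar>x $ i\<bar> \<le> \<bar>\<rho>\<bar>" using that component_le_norm_cart[of x i] by auto
      moreover have "- \<bar>R\<bar> \<le> x $ i - y $ i \<and> x $ i - y $ i \<le> \<bar>R\<bar>"
        using y by (auto simp: mem_box_cart a'_def b'_def)
      ultimately show ?thesis unfolding r_def by linarith
    qed
    then show "y \<in> cbox a b" by (auto simp: mem_box_cart a_def b_def)
  qed
  have "real_polynomial_function p"
    unfolding p_def by (rule real_polynomial_function_integral[OF q(1) FC])
  moreover have "Cbound k (ball 0 \<rho>) \<epsilon> (\<lambda>x. F x - p x)"
    using B Cbound_cong[of "ball 0 \<rho>" "\<lambda>x. F x - conv a b q F x" "\<lambda>x. F x - p x"] eq by simp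
  ultimately show ?thesis by (rule that)
qed

section \<open>Functions of class \<open>C\<^sup>k\<close> on the torus\<close>

lemma continuous_on_proj: "continuous_on S proj"
proof (rule continuous_on_subset)
  show "continuous_on UNIV proj"
    by (simp add: continuous_on_open_vimage open_torus3_def)
qed simp

lemma torus_rel_rep_proj: "torus_rel (rep_torus3 (proj x)) x"
  using proj_rep[of "proj x"] by (simp add: proj_eq_iff)

lemma proj_surj: "\<exists>x. p = proj x"
  by (rule exI[of _ "rep_torus3 p"]) (simp only: proj_rep)

lemma all_torus_iff: "(\<forall>p. P p) \<longleftrightarrow> (\<forall>x. P (proj x))"
proof (intro iffI allI)
  fix p assume "\<forall>x. P (proj x)"
  then have "P (proj (rep_torus3 p))" ..
  then show "P p" by (simp only: proj_rep)
qed simp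

lemma compact_UNIV_torus: "compact (UNIV :: torus3 set)"
proof -
  let ?Q = "cbox (0::real^3) (\<chi> i. 2 * pi)"
  have "p \<in> proj ` ?Q" for p
  proof -
    define x where "x = rep_torus3 p"
    define y where "y = (\<chi> i. x $ i - 2 * pi * of_int \<lfloor>x $ i / (2 * pi)\<rfloor>)"
    have "0 \<le> y $ i \<and> y $ i \<le> 2 * pi" for i
    proof -
      have "of_int \<lfloor>x $ i / (2 * pi)\<rfloor> \<le> x $ i / (2 * pi)" "x $ i / (2 * pi) \<le> of_int \<lfloor>x $ i / (2 * pi)\<rfloor> + 1"
        by linarith+
      then have "of_int \<lfloor>x $ i / (2 * pi)\<rfloor> * (2 * pi) \<le> x $ i" "x $ i \<le> (of_int \<lfloor>x $ i / (2 * pi)\<rfloor> + 1) * (2 * pi)"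
        using pi_gt_zero by (simp_all only: pos_le_divide_eq pos_divide_le_eq mult_pos_pos zero_less_numeral)
      then show ?thesis by (auto simp: y_def algebra_simps)
    qed
    then have "y \<in> ?Q" by (simp add: mem_box_cart)
    moreover have "proj x = proj y"
      by (auto simp: proj_eq_iff torus_rel_def y_def)
    ultimately show ?thesis using proj_rep[of p] by (auto simp: x_def)
  qed
  then have "UNIV = proj ` ?Q" by auto
  then show ?thesis
    using compact_continuous_image[OF continuous_on_proj compact_cbox] by metis
qed

lemma partial_o_proj:
  fixes f :: "torus3 \<Rightarrow> real"
  assumes "\<forall>x. (f \<circ> proj) differentiable (at x)"
  shows "partial j f \<circ> proj = pd j (f \<circ> proj)"
  using partial_proj[OF assms] by (auto simp: pd_def)

lemma Ck_iff_Cdiff: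
  fixes f :: "torus3 \<Rightarrow> real"
  shows "f \<in> Ck k \<longleftrightarrow> Cdiff k UNIV (f \<circ> proj)"
proof (induction k arbitrary: f)
  case 0
  show ?case by (simp add: continuous_on_torus_iff)
next
  case (Suc k)
  have "Cdiff k UNIV (partial j f \<circ> proj) \<longleftrightarrow> Cdiff k UNIV (pd j (f \<circ> proj))"
    if "\<forall>x. (f \<circ> proj) differentiable (at x)" for j
    using partial_o_proj[OF that] by simp
  then show ?case unfolding Ck.simps Cdiff.simps mem_Collect_eq Suc by blast
qed

lemma Ck_continuous: "(f :: torus3 \<Rightarrow> real) \<in> Ck k \<Longrightarrow> continuous_on UNIV f"
  unfolding continuous_on_torus_iff Ck_iff_Cdiff by (rule Cdiff_continuous)

lemma Ck_const [simp]: "(\<lambda>x. c :: real) \<in> Ck k"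
  by (simp add: Ck_iff_Cdiff o_def)

lemma Ck_add: "f \<in> Ck k \<Longrightarrow> g \<in> Ck k \<Longrightarrow> (\<lambda>x. f x + g x :: real) \<in> Ck k"
  unfolding Ck_iff_Cdiff o_def by (rule Cdiff_add) auto

lemma Ck_mult: "f \<in> Ck k \<Longrightarrow> g \<in> Ck k \<Longrightarrow> (\<lambda>x. f x * g x :: real) \<in> Ck k"
  unfolding Ck_iff_Cdiff o_def by (rule Cdiff_mult) auto

lemma Ck_diff: "f \<in> Ck k \<Longrightarrow> g \<in> Ck k \<Longrightarrow> (\<lambda>x. f x - g x :: real) \<in> Ck k"
  unfolding Ck_iff_Cdiff o_def by (rule Cdiff_diff) auto

lemma Ck_sum: "(\<And>i. i \<in> A \<Longrightarrow> f i \<in> Ck k) \<Longrightarrow> (\<lambda>x. \<Sum>i\<in>A. f i x :: real) \<in> Ck k"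
  unfolding Ck_iff_Cdiff o_def by (rule Cdiff_sum) auto

lemma Ck_inverse: "f \<in> Ck k \<Longrightarrow> (\<And>x. f x \<noteq> 0) \<Longrightarrow> (\<lambda>x. inverse (f x) :: real) \<in> Ck k"
  unfolding Ck_iff_Cdiff o_def by (rule Cdiff_inverse) auto

lemma CinfI: "(\<And>k. f \<in> Ck k) \<Longrightarrow> f \<in> Cinf"
  by (auto simp: Cinf_def)

lemma CinfD: "f \<in> Cinf \<Longrightarrow> f \<in> Ck k"
  by (auto simp: Cinf_def)

lemma Cinf_add: "f \<in> Cinf \<Longrightarrow> g \<in> Cinf \<Longrightarrow> (\<lambda>x. f x + g x :: real) \<in> Cinf"
  by (simp add: Cinf_def Ck_add)

lemma Cinf_mult: "f \<in> Cinf \<Longrightarrow> g \<in> Cinf \<Longrightarrow> (\<lambda>x. f x * g x :: real) \<in> Cinf"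
  by (simp add: Cinf_def Ck_mult)

lemma Cinf_const: "(\<lambda>x. c :: real) \<in> Cinf"
  by (intro CinfI Ck_const)

lemma Cinf_sum: "(\<And>i. i \<in> A \<Longrightarrow> f i \<in> Cinf) \<Longrightarrow> (\<lambda>x. \<Sum>i\<in>A. f i x :: real) \<in> Cinf"
  by (simp add: Cinf_def Ck_sum)

lemma Cinf_partial: "(f :: torus3 \<Rightarrow> real) \<in> Cinf \<Longrightarrow> partial j f \<in> Cinf"
proof (rule CinfI)
  fix k assume "f \<in> Cinf"
  then have "f \<in> Ck (Suc k)" by (rule CinfD)
  then show "partial j f \<in> Ck k" by simp
qed

lemma continuous_torus_bounded:
  fixes f :: "torus3 \<Rightarrow> real"
  assumes "continuous_on UNIV f"
  obtains M where "M \<ge> 0" "\<And>x. \<bar>f x\<bar> \<le> M"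
proof -
  have "bounded (range f)"
    by (rule compact_imp_bounded[OF compact_continuous_image[OF assms compact_UNIV_torus]])
  then obtain M where "\<forall>y\<in>range f. norm y \<le> M" unfolding bounded_iff by blast
  then have M: "\<bar>f x\<bar> \<le> M" for x by simp
  then have "M \<ge> 0" using abs_ge_zero order_trans by blast
  then show ?thesis using M that by blast
qed

text \<open>Compactness of the torus bounds every derivative.\<close>

lemma Ck_Cbound:
  "(f :: torus3 \<Rightarrow> real) \<in> Ck k \<Longrightarrow> \<exists>M\<ge>0. Cbound k UNIV M (f \<circ> proj)"
proof (induction k arbitrary: f)
  case 0
  then have "continuous_on UNIV f" by simp
  then obtain M where "M \<ge> 0" "\<And>x. \<bar>f x\<bar> \<le> M"
    using continuous_torus_bounded by blast
  then show ?case by auto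
next
  case (Suc k)
  obtain M where M: "M \<ge> 0" "\<And>x. \<bar>f x\<bar> \<le> M"
    using continuous_torus_bounded[OF Ck_continuous[OF Suc.prems]] by blast
  have "\<forall>j. \<exists>M\<ge>0. Cbound k UNIV M (partial j f \<circ> proj)"
    using Suc.prems by (intro allI Suc.IH) simp
  from choice[OF this] obtain N where "\<forall>j. N j \<ge> 0 \<and> Cbound k UNIV (N j) (partial j f \<circ> proj)"
    by (elim exE)
  then have N: "\<And>j. N j \<ge> 0" "\<And>j. Cbound k UNIV (N j) (partial j f \<circ> proj)" by blast+
  have "Cbound k UNIV (M + (\<Sum>j\<in>UNIV. N j)) (pd j (f \<circ> proj))" for j
  proof (rule Cbound_mono)
    show "Cbound k UNIV (N j) (pd j (f \<circ> proj))"
      using N(2)[of j] partial_o_proj[of f j] Suc.prems by simp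
    show "N j \<le> M + (\<Sum>j\<in>UNIV. N j)" using M(1) N(1) member_le_sum[of j UNIV N] by force
  qed
  moreover have "\<bar>f x\<bar> \<le> M + (\<Sum>j\<in>UNIV. N j)" for x
    using M(2)[of x] N(1) sum_nonneg[of UNIV N] by force
  ultimately have "Cbound (Suc k) UNIV (M + (\<Sum>j\<in>UNIV. N j)) (f \<circ> proj)"
    unfolding Cbound.simps comp_apply by blast
  moreover have "M + (\<Sum>j\<in>UNIV. N j) \<ge> 0" using M(1) N(1) by (simp add: sum_nonneg)
  ultimately show ?case by blast
qed

text \<open>The derivatives in \<open>Ck_norm\<close> are taken from the right end of the list, while \<open>Cbound\<close> peels off the
  innermost derivative first; hence lists are split at their last element.\<close>

lemma Cbound_iff_foldr_partial:
  "(f :: torus3 \<Rightarrow> real) \<in> Ck k \<Longrightarrow>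
    Cbound k UNIV M (f \<circ> proj) \<longleftrightarrow> (\<forall>js. length js \<le> k \<longrightarrow> (\<forall>x. \<bar>foldr partial js f x\<bar> \<le> M))"
proof (induction k arbitrary: f)
  case 0
  show ?case by (simp add: all_torus_iff[of "\<lambda>x. \<bar>f x\<bar> \<le> M"])
next
  case (Suc k)
  have "Cbound k UNIV M (pd j (f \<circ> proj)) \<longleftrightarrow>
      (\<forall>js. length js \<le> k \<longrightarrow> (\<forall>x. \<bar>foldr partial js (partial j f) x\<bar> \<le> M))" for j
    using Suc.IH[of "partial j f"] Suc.prems partial_o_proj[of f j] by (simp del: o_apply)
  moreover have "(\<forall>js. length js \<le> Suc k \<longrightarrow> (\<forall>x. \<bar>foldr partial js f x\<bar> \<le> M)) \<longleftrightarrow>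
      (\<forall>x. \<bar>f x\<bar> \<le> M) \<and> (\<forall>j js. length js \<le> k \<longrightarrow> (\<forall>x. \<bar>foldr partial js (partial j f) x\<bar> \<le> M))"
    (is "?L \<longleftrightarrow> ?R")
  proof
    assume L: ?L
    have "\<bar>foldr partial js (partial j f) x\<bar> \<le> M" if "length js \<le> k" for j js x
      using L[rule_format, of "js @ [j]" x] that by simp
    moreover have "\<bar>f x\<bar> \<le> M" for x using L[rule_format, of "[]" x] by simp
    ultimately show ?R by blast
  next
    assume R: ?R
    show ?L
    proof (intro allI impI)
      fix js :: "3 list" and x assume "length js \<le> Suc k"
      then show "\<bar>foldr partial js f x\<bar> \<le> M"
        using R by (cases js rule: rev_cases) auto
    qed
  qed
  ultimately show ?case
    unfolding Cbound.simps comp_apply all_torus_iff[of "\<lambda>x. \<bar>f x\<bar> \<le> M"] by blast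
qed

text \<open>Membership in the \<open>C\<^sup>k\<close> closure of \<open>S\<close>, phrased with \<open>Cbound\<close>; see \<open>closure_in_Ck\<close>.\<close>

definition approximable :: "nat \<Rightarrow> (torus3 \<Rightarrow> real) set \<Rightarrow> (torus3 \<Rightarrow> real) \<Rightarrow> bool" where
  "approximable k S f \<longleftrightarrow> f \<in> Ck k \<and> (\<forall>\<epsilon>>0. \<exists>g\<in>S. Cbound k UNIV \<epsilon> ((\<lambda>x. f x - g x) \<circ> proj))"

lemma finite_lists_le: "finite {js :: 3 list. length js \<le> k}"
  using finite_lists_length_le[of "UNIV :: 3 set" k] by simp

lemma Ck_norm_le:
  assumes "f \<in> Ck k" "Cbound k UNIV M (f \<circ> proj)"
  shows "Ck_norm k f \<le> real (card {js :: 3 list. length js \<le> k}) * M"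
proof -
  have "(SUP x. \<bar>foldr partial js f x\<bar>) \<le> M" if "length js \<le> k" for js
    using assms Cbound_iff_foldr_partial[OF assms(1)] that by (intro cSUP_least) auto
  then show ?thesis unfolding Ck_norm_def by (intro sum_bounded_above) auto
qed

lemma Cbound_Ck_norm:
  assumes "f \<in> Ck k"
  shows "Cbound k UNIV (Ck_norm k f) (f \<circ> proj)"
proof -
  obtain M where "Cbound k UNIV M (f \<circ> proj)" using Ck_Cbound[OF assms] by blast
  then have M: "\<And>js x. length js \<le> k \<Longrightarrow> \<bar>foldr partial js f x\<bar> \<le> M"
    using Cbound_iff_foldr_partial[OF assms] by blast
  have "\<bar>foldr partial js f x\<bar> \<le> Ck_norm k f" if "length js \<le> k" for js x
  proof -
    have bdd: "bdd_above (range (\<lambda>x. \<bar>foldr partial js f x\<bar>))" if "length js \<le> k" for js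
      by (rule bdd_aboveI2) (rule M[OF that])
    have nonneg: "0 \<le> (SUP x. \<bar>foldr partial js f x\<bar>)" if "length js \<le> k" for js
      using cSUP_upper2[OF bdd[OF that] UNIV_I, of 0 undefined] by simp
    have "\<bar>foldr partial js f x\<bar> \<le> (SUP x. \<bar>foldr partial js f x\<bar>)"
      using cSUP_upper[OF UNIV_I bdd[OF that]] .
    also have "\<dots> \<le> Ck_norm k f"
      unfolding Ck_norm_def using that nonneg by (intro member_le_sum finite_lists_le) auto
    finally show ?thesis .
  qed
  then show ?thesis using Cbound_iff_foldr_partial[OF assms] by blast
qed

lemma closure_in_Ck:
  assumes "S \<subseteq> Ck k"
  shows "closure_in (Ck k) (Ck_norm k) S = {f. approximable k S f}"
proof (intro equalityI subsetI)
  fix f assume f: "f \<in> closure_in (Ck k) (Ck_norm k) S"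
  have "\<exists>g\<in>S. Cbound k UNIV \<epsilon> ((\<lambda>x. f x - g x) \<circ> proj)" if \<epsilon>: "\<epsilon> > 0" for \<epsilon>
  proof -
    have "\<forall>\<epsilon>>0. \<exists>g\<in>S \<inter> Ck k. Ck_norm k (\<lambda>x. f x - g x) < \<epsilon>"
      using f by (simp add: closure_in_def)
    then obtain g where g: "g \<in> S" "Ck_norm k (\<lambda>x. f x - g x) < \<epsilon>"
      using \<epsilon> by blast
    then have "(\<lambda>x. f x - g x) \<in> Ck k" using f assms by (intro Ck_diff) (auto simp: closure_in_def)
    from Cbound_mono[OF Cbound_Ck_norm[OF this] less_imp_le[OF g(2)]] g(1) show ?thesis ..
  qed
  then show "f \<in> {f. approximable k S f}" using f by (auto simp: closure_in_def approximable_def)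
next
  fix f assume f: "f \<in> {f. approximable k S f}"
  let ?N = "real (card {js :: 3 list. length js \<le> k})"
  have "\<exists>g\<in>S \<inter> Ck k. Ck_norm k (\<lambda>x. f x - g x) < \<epsilon>" if "\<epsilon> > 0" for \<epsilon>
  proof -
    have "\<epsilon> / (?N + 1) > 0" using that by (intro divide_pos_pos) auto
    then obtain g where g: "g \<in> S" "Cbound k UNIV (\<epsilon> / (?N + 1)) ((\<lambda>x. f x - g x) \<circ> proj)"
      using f unfolding approximable_def by blast
    then have "(\<lambda>x. f x - g x) \<in> Ck k" using f assms by (intro Ck_diff) (auto simp: approximable_def)
    from Ck_norm_le[OF this g(2)] have "Ck_norm k (\<lambda>x. f x - g x) \<le> ?N * (\<epsilon> / (?N + 1))" .
    also have "\<dots> < \<epsilon>" using that by (simp add: divide_simps add_nonneg_pos)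
    finally show ?thesis using g assms by blast
  qed
  then show "f \<in> closure_in (Ck k) (Ck_norm k) S" using f by (auto simp: closure_in_def approximable_def)
qed

section \<open>Trigonometric functions and separation of points\<close>

text \<open>The phase \<open>m \<cdot> x\<close> of the plane wave with integer frequency \<open>m\<close>.\<close>

definition freq_dot :: "(3 \<Rightarrow> int) \<Rightarrow> real^3 \<Rightarrow> real" where
  "freq_dot m x = (\<Sum>i\<in>UNIV. of_int (m i) * x $ i)"

text \<open>The phase \<open>c\<close> covers sine and cosine at once and makes the family closed under partial derivatives
  up to scalars.\<close>

definition trig :: "(3 \<Rightarrow> int) \<Rightarrow> real \<Rightarrow> torus3 \<Rightarrow> real" where
  "trig m c p = cos (freq_dot m (rep_torus3 p) + c)"

lemma bounded_linear_freq_dot: "bounded_linear (freq_dot m)"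
  unfolding freq_dot_def[abs_def]
  by (intro bounded_linear_sum bounded_linear_const_mult bounded_linear_vec_nth)

lemma freq_dot_axis: "freq_dot m (axis j 1) = of_int (m j)"
  by (simp add: freq_dot_def axis_def if_distrib[of "\<lambda>c. _ * c"] cong: if_cong)

lemma cos_add_2pi_int: "cos (x + 2 * pi * of_int n) = cos x"
  using cos.plus_of_int[of x n] by (simp add: mult_ac)

text \<open>Integer frequencies make the phase well defined modulo \<open>2 \<pi>\<close>, so the choice of representative is
  irrelevant.\<close>

lemma trig_proj: "trig m c (proj x) = cos (freq_dot m x + c)"
proof -
  obtain n :: "3 \<Rightarrow> int" where n: "\<And>i. rep_torus3 (proj x) $ i - x $ i = 2 * pi * of_int (n i)"
    using torus_rel_rep_proj[of x] unfolding torus_rel_def by metis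
  have "freq_dot m (rep_torus3 (proj x)) - freq_dot m x = (\<Sum>i\<in>UNIV. of_int (m i) * (2 * pi * of_int (n i)))"
    by (simp add: freq_dot_def sum_subtractf[symmetric] right_diff_distrib[symmetric] n)
  also have "\<dots> = 2 * pi * of_int (\<Sum>i\<in>UNIV. m i * n i)"
    by (simp add: sum_distrib_left mult_ac)
  finally have "freq_dot m (rep_torus3 (proj x)) + c = (freq_dot m x + c) + 2 * pi * of_int (\<Sum>i\<in>UNIV. m i * n i)"
    by simp
  then show ?thesis unfolding trig_def by (simp only: cos_add_2pi_int)
qed

lemma trig_Cinf: "trig m c \<in> Cinf"
proof (rule CinfI)
  have "trig m c \<circ> proj = (\<lambda>x. cos (freq_dot m x + c))" by (auto simp: trig_proj)
  then show "trig m c \<in> Ck k" for k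
    using Cdiff_sin_cos_linear[OF bounded_linear_freq_dot] by (simp add: Ck_iff_Cdiff)
qed

lemma partial_trig: "partial j (trig m c) = (\<lambda>p. of_int (m j) * trig m (c + pi/2) p)"
proof -
  have e: "trig m c \<circ> proj = (\<lambda>x. cos (freq_dot m x + c))" by (auto simp: trig_proj)
  have "\<forall>x. (trig m c \<circ> proj) differentiable (at x)"
    using CinfD[OF trig_Cinf, of m c 1] by simp
  from partial_o_proj[OF this, of j]
  have "partial j (trig m c) (proj x) = - of_int (m j) * sin (freq_dot m x + c)" for x
    unfolding e pd_sin_cos_linear[OF bounded_linear_freq_dot] freq_dot_axis by (metis comp_apply)
  moreover have "trig m (c + pi/2) (proj x) = - sin (freq_dot m x + c)" for x
    using cos_add[of "freq_dot m x + c" "pi/2"] by (simp add: trig_proj add.assoc)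
  ultimately show ?thesis by (metis (no_types, opaque_lifting) ext mult_minus_left mult_minus_right proj_rep)
qed

text \<open>A smooth function that vanishes exactly at the point represented by \<open>y\<close>. It shows that the torus is
  Hausdorff and serves as test function for injectivity.\<close>

definition bump_at :: "real^3 \<Rightarrow> torus3 \<Rightarrow> real" where
  "bump_at y p = (\<Sum>i\<in>UNIV. 1 - trig (\<lambda>k. if k = i then 1 else 0) (- y $ i) p)"

lemma bump_at_proj: "bump_at y (proj x) = (\<Sum>i\<in>UNIV. 1 - cos (x $ i - y $ i))"
proof -
  have "freq_dot (\<lambda>k. if k = i then 1 else 0) x = x $ i" for i
    by (simp add: freq_dot_def if_distrib[of of_int] if_distrib[of "\<lambda>c. c * _"] cong: if_cong)
  then show ?thesis by (simp add: bump_at_def trig_proj)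
qed

lemma bump_at_Cinf: "bump_at y \<in> Cinf"
  unfolding bump_at_def[abs_def]
  by (intro CinfI Ck_sum Ck_diff Ck_const CinfD[OF trig_Cinf])

lemma bump_at_nonneg: "bump_at y p \<ge> 0"
proof -
  obtain x where p: "p = proj x" using proj_surj by blast
  show ?thesis unfolding p bump_at_proj by (intro sum_nonneg) simp
qed

lemma bump_at_eq_0: "bump_at y p = 0 \<longleftrightarrow> p = proj y"
proof -
  obtain x where p: "p = proj x" using proj_surj by blast
  have "bump_at y p = 0 \<longleftrightarrow> (\<forall>i. cos (x $ i - y $ i) = 1)"
    unfolding p bump_at_proj by (subst sum_nonneg_eq_0_iff) auto
  also have "\<dots> \<longleftrightarrow> torus_rel x y"
    unfolding torus_rel_def cos_one_2pi_int by (metis mult.commute mult.left_commute)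
  finally show ?thesis unfolding p proj_eq_iff .
qed

instance torus3 :: t2_space
proof
  fix p q :: torus3 assume "p \<noteq> q"
  obtain y where q: "q = proj y" using proj_surj by blast
  have c: "continuous_on UNIV (bump_at y)"
    using CinfD[OF bump_at_Cinf] by (rule Ck_continuous)
  have pos: "bump_at y p > 0"
    using bump_at_eq_0[of y p] bump_at_nonneg[of y p] \<open>p \<noteq> q\<close> q by (simp add: less_le)
  let ?U = "{x. bump_at y x > bump_at y p / 2}" and ?V = "{x. bump_at y x < bump_at y p / 2}"
  have "open ?U" "open ?V"
    by (intro open_Collect_less c continuous_on_const)+
  moreover have "p \<in> ?U" "q \<in> ?V" "?U \<inter> ?V = {}" using pos bump_at_eq_0[of y q] q by auto
  ultimately show "\<exists>U V. open U \<and> open V \<and> p \<in> U \<and> q \<in> V \<and> U \<inter> V = {}" by blast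
qed

section \<open>The inverse function theorem in class \<open>C\<^sup>k\<close>\<close>

definition jac :: "(real^'n \<Rightarrow> real^'n) \<Rightarrow> real^'n \<Rightarrow> real^'n^'n::finite" where
  "jac f x = (\<chi> a j. pd j (\<lambda>x. f x $ a) x)"

lemma has_derivative_jac:
  assumes "\<And>a. (\<lambda>x. f x $ a) differentiable (at x)"
  shows "(f has_derivative (\<lambda>h. jac f x *v h)) (at x)"
proof -
  have "((\<lambda>x. f x $ a) has_derivative (\<lambda>h. (jac f x *v h) $ a)) (at x)" for a
    using has_derivative_pd[OF assms[of a]] by (simp add: jac_def matrix_vector_mult_def mult.commute)
  then show ?thesis
    by (subst has_derivative_componentwise_within) (auto simp: Basis_vec_def inner_axis)
qed

lemma Cdiff_det:
  assumes "open S" "\<And>i j. Cdiff k S (\<lambda>x. A x $ i $ j)"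
  shows "Cdiff k S (\<lambda>x. det (A x :: real^'n^'n::finite))"
  unfolding det_def by (intro Cdiff_sum Cdiff_mult Cdiff_prod Cdiff_const assms)

text \<open>The inverse function theorem yields a differentiable local inverse \<open>g\<close>. By Cramer's rule its partial derivatives
  are \<open>H \<circ> g\<close>, where \<open>H\<close> is rational in the entries of the Jacobian matrix, hence of class
  \<open>C\<^sup>k\<^sup>-\<^sup>1\<close>. This equation raises the differentiability of \<open>g\<close> step by step up to \<open>k\<close>.\<close>

theorem Ck_inverse_function:
  fixes f :: "real^'n::finite \<Rightarrow> real^'n"
  assumes U: "open U" "x0 \<in> U" and f: "\<And>a. Cdiff k U (\<lambda>x. f x $ a)" and "1 \<le> k"
    and det: "det (jac f x0) \<noteq> 0"
  shows "\<exists>U' V g. open U' \<and> U' \<subseteq> U \<and> x0 \<in> U' \<and> open V \<and> homeomorphism U' V f g \<and>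
    (\<forall>j. Cdiff k V (\<lambda>y. g y $ j))"
proof -
  obtain k' where k': "k = Suc k'" using \<open>1 \<le> k\<close> by (cases k) auto
  define E :: "'n \<Rightarrow> 'n \<Rightarrow> (real^'n) \<Rightarrow>\<^sub>L (real^'n)" where "E a j = Blinfun (\<lambda>h. h $ j *\<^sub>R axis a 1)" for a j
  have E: "blinfun_apply (E a j) h = h $ j *\<^sub>R axis a 1" for a j h
    unfolding E_def
    by (simp add: bounded_linear_Blinfun_apply bounded_linear_scaleR_const bounded_linear_vec_nth)
  define f' where "f' x = (\<Sum>a\<in>UNIV. \<Sum>j\<in>UNIV. pd j (\<lambda>x. f x $ a) x *\<^sub>R E a j)" for x
  have f': "blinfun_apply (f' x) h = jac f x *v h" for x h
  proof -
    have "blinfun_apply (f' x) h = (\<Sum>a\<in>UNIV. (\<Sum>j\<in>UNIV. pd j (\<lambda>x. f x $ a) x * h $ j) *\<^sub>R axis a 1)"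
      by (simp add: f'_def blinfun.sum_left blinfun.scaleR_left E scaleR_sum_left)
    then show ?thesis
      by (simp add: vec_eq_iff jac_def matrix_vector_mult_def axis_def if_distrib[of "\<lambda>c. _ * c"] cong: if_cong)
  qed
  have der: "(f has_derivative blinfun_apply (f' x)) (at x)" if "x \<in> U" for x
    unfolding f'[abs_def] using f that by (intro has_derivative_jac) (auto simp: k')
  have cont: "continuous_on U f'"
  proof -
    have "continuous_on U (pd j (\<lambda>x. f x $ a))" for j a
      by (rule Cdiff_continuous[of k']) (use f[of a] in \<open>simp add: k'\<close>)
    then show ?thesis unfolding f'_def[abs_def] by (intro continuous_intros)
  qed
  obtain A where A: "A ** jac f x0 = mat 1"
    using det unfolding invertible_det_nz[symmetric] invertible_def by blast
  define invf where "invf = Blinfun (\<lambda>h. A *v h)"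
  have invf: "blinfun_apply invf h = A *v h" for h
    by (simp add: invf_def bounded_linear_Blinfun_apply matrix_vector_mul_bounded_linear)
  have "invf o\<^sub>L f' x0 = id_blinfun"
    by (intro blinfun_eqI) (simp add: invf f' matrix_vector_mul_assoc A)
  from inverse_function_theorem[OF U(1) der cont U(2) this]
  obtain U' V g g' where U': "open U'" "U' \<subseteq> U" "x0 \<in> U'" and V: "open V" and hom: "homeomorphism U' V f g"
    and g: "\<And>y. y \<in> V \<Longrightarrow> (g has_derivative (g' y)) (at y)"
    and g': "\<And>y. y \<in> V \<Longrightarrow> g' y = inv (blinfun_apply (f'(g y)))"
    and bij: "\<And>y. y \<in> V \<Longrightarrow> bij (blinfun_apply (f'(g y)))"
    by metis
  have gV: "g ` V = U'" using hom by (simp add: homeomorphism_def)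
  have detU: "det (jac f x) \<noteq> 0" if x: "x \<in> U'" for x
  proof -
    obtain y where y: "y \<in> V" "x = g y" using x gV by blast
    have "blinfun_apply (f' x) = (\<lambda>h. jac f x *v h)" by (rule ext) (rule f')
    then have "inj (\<lambda>h. jac f x *v h)" using bij[OF y(1)] by (simp add: y(2) bij_def)
    then have "\<exists>B. B ** jac f x = mat 1" by (simp only: matrix_left_invertible_injective)
    then have "invertible (jac f x)" by (simp only: invertible_left_inverse)
    then show ?thesis by (simp add: invertible_det_nz)
  qed
  define H where "H i j x = det (\<chi> a l. if l = j then axis i 1 $ a else jac f x $ a $ l) * inverse (det (jac f x))"
    for i j x
  have pdg: "pd i (\<lambda>y. g y $ j) y = H i j (g y)" and gd: "(\<lambda>y. g y $ j) differentiable (at y)"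
    if y: "y \<in> V" for i j y
  proof -
    have d: "((\<lambda>y. g y $ j) has_derivative (\<lambda>h. g' y h $ j)) (at y)" for j
      by (rule bounded_linear.has_derivative[OF bounded_linear_vec_nth g[OF y]])
    then show "(\<lambda>y. g y $ j) differentiable (at y)" by (rule differentiableI)
    have sol: "jac f (g y) *v g' y (axis i 1) = axis i 1"
      using surj_f_inv_f[OF bij_is_surj[OF bij[OF y]], of "axis i 1"] by (simp only: g'[OF y] f')
    have "g y \<in> U'" using gV y by blast
    from cramer[OF detU[OF this], THEN iffD1, OF sol]
    have "g' y (axis i 1) = (\<chi> j. det (\<chi> a l. if l = j then axis i 1 $ a else jac f (g y) $ a $ l) / det (jac f (g y)))"
      .
    then show "pd i (\<lambda>y. g y $ j) y = H i j (g y)"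
      using pd_eqI[OF d] by (simp add: H_def divide_inverse)
  qed
  have jacC: "Cdiff k' U' (\<lambda>x. jac f x $ a $ l)" for a l
    by (rule Cdiff_subset[OF _ U'(2)]) (use f[of a] in \<open>simp add: jac_def k'\<close>)
  have H: "Cdiff k' U' (H i j)" for i j
  proof -
    have "Cdiff k' U' (\<lambda>x. (\<chi> a l. if l = j then axis i 1 $ a else jac f x $ a $ l) $ a $ l)" for a l
      by (cases "l = j") (simp_all add: jacC)
    then have "Cdiff k' U' (\<lambda>x. det (\<chi> a l. if l = j then axis i 1 $ a else jac f x $ a $ l))"
      by (rule Cdiff_det[OF U'(1)])
    moreover have "Cdiff k' U' (\<lambda>x. inverse (det (jac f x)))"
      by (rule Cdiff_inverse[OF U'(1) detU Cdiff_det[OF U'(1) jacC]])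
    ultimately show ?thesis unfolding H_def by (rule Cdiff_mult[OF U'(1)])
  qed
  have "Cdiff l V (\<lambda>y. g y $ j)" if "l \<le> k" for l j
    using that
  proof (induction l arbitrary: j)
    case 0
    have "continuous_on V g" using hom by (simp add: homeomorphism_def)
    then show ?case by (auto intro: continuous_intros)
  next
    case (Suc l)
    have "Cdiff l V (pd i (\<lambda>y. g y $ j))" for i
    proof -
      have "Cdiff l V (\<lambda>y. H i j (g y))"
      proof (rule Cdiff_compose[OF V])
        show "g ` V \<subseteq> U'" using gV by simp
        show "Cdiff l U' (H i j)" by (rule Cdiff_mono[OF H]) (use Suc.prems k' in simp)
        show "Cdiff l V (\<lambda>y. g y $ j)" for j by (rule Suc.IH) (use Suc.prems in simp)
      qed
      moreover have "Cdiff l V (pd i (\<lambda>y. g y $ j)) \<longleftrightarrow> Cdiff l V (\<lambda>y. H i j (g y))"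
        by (rule Cdiff_cong[OF V]) (rule pdg)
      ultimately show ?thesis by simp
    qed
    then show ?case using gd by simp
  qed
  then show ?thesis using U' V hom by blast
qed

section \<open>The algebra of polynomials in a map\<close>

text \<open>The algebra generated by the coordinates of \<open>\<gamma>\<close> and the constants.\<close>

definition polys :: "(torus3 \<Rightarrow> 'e::euclidean_space) \<Rightarrow> (torus3 \<Rightarrow> real) set" where
  "polys \<gamma> = {(\<lambda>p. q (\<gamma> p)) | q. real_polynomial_function q}"

definition smooth_components :: "(torus3 \<Rightarrow> 'e::euclidean_space) \<Rightarrow> bool" where
  "smooth_components \<gamma> \<longleftrightarrow> (\<forall>B\<in>Basis. (\<lambda>p. \<gamma> p \<bullet> B) \<in> Cinf)"

lemma polys_Cinf:
  assumes "smooth_components \<gamma>" "f \<in> polys \<gamma>"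
  shows "f \<in> Cinf"
proof -
  obtain q where f: "f = (\<lambda>p. q (\<gamma> p))" and q: "real_polynomial_function q"
    using assms(2) by (auto simp: polys_def)
  show ?thesis unfolding f using q
  proof induction
    case (linear l)
    have "l (\<gamma> p) = (\<Sum>B\<in>Basis. (\<gamma> p \<bullet> B) * l B)" for p
    proof -
      have "l (\<gamma> p) = l (\<Sum>B\<in>Basis. (\<gamma> p \<bullet> B) *\<^sub>R B)" by (simp add: euclidean_representation)
      also have "\<dots> = (\<Sum>B\<in>Basis. (\<gamma> p \<bullet> B) * l B)"
        using bounded_linear.linear[OF linear] by (simp add: linear_sum linear_cmul)
      finally show ?thesis .
    qed
    then show ?case
      using assms(1) by (auto simp: smooth_components_def intro!: Cinf_sum Cinf_mult Cinf_const)
  qed (auto intro: Cinf_add Cinf_mult Cinf_const)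
qed

lemma polys_mult: "f \<in> polys \<gamma> \<Longrightarrow> g \<in> polys \<gamma> \<Longrightarrow> (\<lambda>p. f p * g p) \<in> polys \<gamma>"
  unfolding polys_def by (force intro: real_polynomial_function.intros(4))

lemma polys_add: "f \<in> polys \<gamma> \<Longrightarrow> g \<in> polys \<gamma> \<Longrightarrow> (\<lambda>p. f p + g p) \<in> polys \<gamma>"
  unfolding polys_def by (force intro: real_polynomial_function.intros(3))

lemma polys_const: "(\<lambda>p. c) \<in> polys \<gamma>"
  unfolding polys_def mem_Collect_eq by (rule exI[of _ "\<lambda>_. c"]) auto

lemma approximable_add:
  assumes S: "\<And>f g. f \<in> S \<Longrightarrow> g \<in> S \<Longrightarrow> (\<lambda>p. f p + g p) \<in> S" "S \<subseteq> Ck k"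
    and "approximable k S f" "approximable k S g"
  shows "approximable k S (\<lambda>p. f p + g p)"
  unfolding approximable_def
proof (intro conjI allI impI)
  show "(\<lambda>p. f p + g p) \<in> Ck k" using assms by (auto simp: approximable_def intro: Ck_add)
  fix \<epsilon> :: real assume "\<epsilon> > 0"
  then have "\<epsilon>/2 > 0" by simp
  then obtain f' g' where f': "f' \<in> S" "Cbound k UNIV (\<epsilon>/2) ((\<lambda>x. f x - f' x) \<circ> proj)"
    and g': "g' \<in> S" "Cbound k UNIV (\<epsilon>/2) ((\<lambda>x. g x - g' x) \<circ> proj)"
    using assms(3,4) unfolding approximable_def by metis
  have D: "Cdiff k UNIV ((\<lambda>x. f x - f' x) \<circ> proj)" "Cdiff k UNIV ((\<lambda>x. g x - g' x) \<circ> proj)"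
    using f' g' assms by (auto simp: approximable_def intro!: Ck_diff Ck_iff_Cdiff[THEN iffD1])
  have "Cbound k UNIV (\<epsilon>/2 + \<epsilon>/2) (\<lambda>x. ((\<lambda>x. f x - f' x) \<circ> proj) x + ((\<lambda>x. g x - g' x) \<circ> proj) x)"
    by (rule Cbound_add[OF open_UNIV D f'(2) g'(2)])
  moreover have "(\<lambda>x. ((\<lambda>x. f x - f' x) \<circ> proj) x + ((\<lambda>x. g x - g' x) \<circ> proj) x) =
      (\<lambda>x. (f x + g x) - (f' x + g' x)) \<circ> proj" by auto
  ultimately have "Cbound k UNIV \<epsilon> ((\<lambda>x. (f x + g x) - (f' x + g' x)) \<circ> proj)" by simp
  then show "\<exists>h\<in>S. Cbound k UNIV \<epsilon> ((\<lambda>x. (f x + g x) - h x) \<circ> proj)"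
    using S(1)[OF f'(1) g'(1)] by (rule bexI[of _ "\<lambda>p. f' p + g' p"])
qed

lemma approximable_sum:
  assumes S: "\<And>f g. f \<in> S \<Longrightarrow> g \<in> S \<Longrightarrow> (\<lambda>p. f p + g p) \<in> S" "S \<subseteq> Ck k" "(\<lambda>p. 0) \<in> S"
    and "finite A" "\<And>i. i \<in> A \<Longrightarrow> approximable k S (f i)"
  shows "approximable k S (\<lambda>p. \<Sum>i\<in>A. f i p)"
  using assms(4,5)
proof (induction A rule: finite_induct)
  case empty
  then show ?case using S(3) by (auto simp: approximable_def o_def intro!: bexI[of _ "\<lambda>p. 0"] Cbound_0)
next
  case (insert i A)
  then have "approximable k S (\<lambda>p. f i p + (\<Sum>i\<in>A. f i p))"
    by (intro approximable_add[OF S(1,2)]) auto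
  with insert show ?case by simp
qed

lemma approximable_mult_fixed:
  assumes "approximable k S f" "g \<in> Ck k" "S \<subseteq> Ck k"
  shows "approximable k {(\<lambda>p. s p * g p) | s. s \<in> S} (\<lambda>p. f p * g p)"
  unfolding approximable_def
proof (intro conjI allI impI)
  show "(\<lambda>p. f p * g p) \<in> Ck k" using assms by (auto simp: approximable_def intro: Ck_mult)
  obtain M where M: "M \<ge> 0" "Cbound k UNIV M (g \<circ> proj)" using Ck_Cbound[OF assms(2)] by blast
  fix \<epsilon> :: real assume "\<epsilon> > 0"
  define \<delta> where "\<delta> = \<epsilon> / (2 ^ k * M + 1)"
  have M1: "2 ^ k * M \<ge> 0" using M(1) by simp
  have \<delta>: "\<delta> > 0" "2 ^ k * \<delta> * M \<le> \<epsilon>" using M1 \<open>\<epsilon> > 0\<close> by (auto simp: \<delta>_def field_simps add_pos_nonneg)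
  obtain s where s: "s \<in> S" "Cbound k UNIV \<delta> ((\<lambda>x. f x - s x) \<circ> proj)"
    using assms(1) \<delta>(1) unfolding approximable_def by blast
  have D: "Cdiff k UNIV ((\<lambda>x. f x - s x) \<circ> proj)" "Cdiff k UNIV (g \<circ> proj)"
    using s assms by (auto simp: approximable_def intro!: Ck_diff Ck_iff_Cdiff[THEN iffD1])
  have "Cbound k UNIV (2 ^ k * \<delta> * M) (\<lambda>x. ((\<lambda>x. f x - s x) \<circ> proj) x * (g \<circ> proj) x)"
    by (rule Cbound_mult[OF open_UNIV _ M(1) D s(2) M(2)]) (use \<delta>(1) in simp)
  from Cbound_mono[OF this \<delta>(2)]
  have "Cbound k UNIV \<epsilon> ((\<lambda>x. f x * g x - s x * g x) \<circ> proj)" by (simp add: o_def left_diff_distrib)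
  then show "\<exists>h\<in>{(\<lambda>p. s p * g p) | s. s \<in> S}. Cbound k UNIV \<epsilon> ((\<lambda>x. f x * g x - h x) \<circ> proj)"
    using s(1) by (intro bexI[of _ "\<lambda>p. s p * g p"]) auto
qed

lemma approximable_trans:
  assumes "approximable k S f" "\<And>s. s \<in> S \<Longrightarrow> approximable k T s" "T \<subseteq> Ck k"
  shows "approximable k T f"
  unfolding approximable_def
proof (intro conjI allI impI)
  show "f \<in> Ck k" using assms(1) by (simp add: approximable_def)
  fix \<epsilon> :: real assume "\<epsilon> > 0"
  then have e2: "\<epsilon>/2 > 0" by simp
  obtain s where s: "s \<in> S" "Cbound k UNIV (\<epsilon>/2) ((\<lambda>x. f x - s x) \<circ> proj)"
    using assms(1) e2 unfolding approximable_def by blast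
  obtain t where t: "t \<in> T" "Cbound k UNIV (\<epsilon>/2) ((\<lambda>x. s x - t x) \<circ> proj)"
    using assms(2)[OF s(1)] e2 unfolding approximable_def by blast
  have D: "Cdiff k UNIV ((\<lambda>x. f x - s x) \<circ> proj)" "Cdiff k UNIV ((\<lambda>x. s x - t x) \<circ> proj)"
    using s t assms by (auto simp: approximable_def intro!: Ck_diff Ck_iff_Cdiff[THEN iffD1])
  from Cbound_add[OF open_UNIV D s(2) t(2)]
  have "Cbound k UNIV \<epsilon> ((\<lambda>x. f x - t x) \<circ> proj)" by (simp add: o_def)
  then show "\<exists>h\<in>T. Cbound k UNIV \<epsilon> ((\<lambda>x. f x - h x) \<circ> proj)" using t(1) by (rule bexI[of _ t])
qed

lemma approximable_superset: "approximable k S f \<Longrightarrow> S \<subseteq> T \<Longrightarrow> approximable k T f"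
  unfolding approximable_def by (meson subsetD)

text \<open>The \<open>C\<^sup>k\<close> closure of the algebra is again closed under products: first one factor is replaced by an
  approximation while the other stays fixed, then the other.\<close>

lemma approximable_polys_mult:
  assumes "smooth_components \<gamma>" "approximable k (polys \<gamma>) f" "approximable k (polys \<gamma>) g"
  shows "approximable k (polys \<gamma>) (\<lambda>p. f p * g p)"
proof -
  have P: "polys \<gamma> \<subseteq> Ck k" using polys_Cinf[OF assms(1)] CinfD by blast
  have "g \<in> Ck k" using assms(3) by (simp add: approximable_def)
  from approximable_mult_fixed[OF assms(2) this P] show ?thesis
  proof (rule approximable_trans)
    fix s assume "s \<in> {(\<lambda>p. s p * g p) | s. s \<in> polys \<gamma>}"
    then obtain q where q: "s = (\<lambda>p. q p * g p)" "q \<in> polys \<gamma>" by blast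
    have "approximable k {(\<lambda>p. s p * q p) | s. s \<in> polys \<gamma>} (\<lambda>p. g p * q p)"
      using approximable_mult_fixed[OF assms(3) _ P] q(2) P by blast
    moreover have "{(\<lambda>p. s p * q p) | s. s \<in> polys \<gamma>} \<subseteq> polys \<gamma>" using polys_mult[OF _ q(2)] by blast
    ultimately have "approximable k (polys \<gamma>) (\<lambda>p. g p * q p)" by (rule approximable_superset)
    moreover have "s = (\<lambda>p. g p * q p)" by (simp add: q(1) mult.commute)
    ultimately show "approximable k (polys \<gamma>) s" by simp
  qed (rule P)
qed

text \<open>The \<open>C\<^sup>k\<close> closure of the algebra is stable under composition with \<open>C\<^sup>k\<close> functions of finitely many of
  its elements: approximate the outer function by polynomials on a ball that contains the compact
  range of the inner map.\<close>

lemma approximable_compose: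
  fixes G :: "torus3 \<Rightarrow> real^'n::finite"
  assumes "smooth_components \<gamma>" and G: "\<And>i. (\<lambda>p. G p $ i) \<in> polys \<gamma>"
    and F: "Cdiff k UNIV F" "\<And>x. norm x > R \<Longrightarrow> F x = 0"
  shows "approximable k (polys \<gamma>) (\<lambda>p. F (G p))"
  unfolding approximable_def
proof (intro conjI allI impI)
  have GC: "(\<lambda>p. G p $ i) \<in> Ck k" for i using polys_Cinf[OF assms(1) G] CinfD by blast
  have GD: "Cdiff k UNIV (\<lambda>x. G (proj x) $ i)" for i using GC[of i] by (simp add: Ck_iff_Cdiff o_def)
  show "(\<lambda>p. F (G p)) \<in> Ck k"
    using Cdiff_compose[OF open_UNIV _ F(1) GD] by (simp add: Ck_iff_Cdiff o_def)
  have "\<forall>i. \<exists>M\<ge>0. Cbound k UNIV M (\<lambda>x. G (proj x) $ i)"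
    using Ck_Cbound[OF GC] by (simp add: o_def)
  from choice[OF this] obtain N where N: "\<And>i. N i \<ge> 0" "\<And>i. Cbound k UNIV (N i) (\<lambda>x. G (proj x) $ i)"
    by blast
  define M where "M = (\<Sum>i\<in>UNIV. N i)"
  have M: "M \<ge> 0" "Cbound k UNIV M (\<lambda>x. G (proj x) $ i)" for i
    using N(1) member_le_sum[of i UNIV N] by (auto simp: M_def intro!: sum_nonneg Cbound_mono[OF N(2)])
  define \<rho> where "\<rho> = M * real CARD('n) + 1"
  have ran: "(\<lambda>x. G (proj x)) ` UNIV \<subseteq> ball 0 \<rho>"
  proof clarify
    fix x
    have "norm (G (proj x)) \<le> (\<Sum>i\<in>UNIV. \<bar>G (proj x) $ i\<bar>)" by (rule norm_le_l1_cart)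
    also have "\<dots> \<le> (\<Sum>i\<in>(UNIV::'n set). M)"
      using Cbound_pointwise[OF M(2)] by (intro sum_mono) auto
    finally show "G (proj x) \<in> ball 0 \<rho>" by (simp add: \<rho>_def mult.commute)
  qed
  obtain C where C: "C \<ge> 0" "\<And>\<delta> f. \<delta> \<ge> 0 \<Longrightarrow> Cdiff k (ball 0 \<rho>) f \<Longrightarrow> Cbound k (ball 0 \<rho>) \<delta> f \<Longrightarrow>
      Cbound k UNIV (C * \<delta>) (\<lambda>x. f (G (proj x)))"
    using Cbound_compose[OF open_UNIV ran M(1) GD M(2)] by blast
  fix \<epsilon> :: real assume "\<epsilon> > 0"
  define \<delta> where "\<delta> = \<epsilon> / (C + 1)"
  have \<delta>: "\<delta> > 0" "C * \<delta> \<le> \<epsilon>" using C(1) \<open>\<epsilon> > 0\<close> by (auto simp: \<delta>_def field_simps)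
  obtain p' where p: "real_polynomial_function p'" "Cbound k (ball 0 \<rho>) \<delta> (\<lambda>x. F x - p' x)"
    by (rule Ck_polynomial_approximation[OF F(1) F(2) \<delta>(1)])
  have "Cdiff k (ball 0 \<rho>) (\<lambda>x. F x - p' x)"
    using p(1) by (intro Cdiff_diff Cdiff_subset[OF F(1)] Cdiff_real_polynomial_function) auto
  from Cbound_mono[OF C(2)[OF less_imp_le[OF \<delta>(1)] this p(2)] \<delta>(2)]
  have B: "Cbound k UNIV \<epsilon> ((\<lambda>x. F (G x) - p' (G x)) \<circ> proj)" by (simp add: o_def)
  have "\<forall>i. \<exists>q. real_polynomial_function q \<and> (\<lambda>p. G p $ i) = (\<lambda>p. q (\<gamma> p))"
    using G by (auto simp: polys_def)
  from choice[OF this] obtain q where q: "\<And>i. real_polynomial_function (q i)" "\<And>i p. G p $ i = q i (\<gamma> p)"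
    by metis
  have "polynomial_function (\<lambda>y. \<chi> i. q i y)"
    unfolding polynomial_function_iff_Basis_inner using q(1) by (auto simp: Basis_vec_def inner_axis)
  from real_polynomial_function_compose[OF this p(1)]
  have "real_polynomial_function (\<lambda>y. p' (\<chi> i. q i y))" by (simp add: o_def)
  moreover have "G x = (\<chi> i. q i (\<gamma> x))" for x by (simp add: vec_eq_iff q(2))
  ultimately have "(\<lambda>x. p' (G x)) \<in> polys \<gamma>" unfolding polys_def by auto
  then show "\<exists>h\<in>polys \<gamma>. Cbound k UNIV \<epsilon> ((\<lambda>x. F (G x) - h x) \<circ> proj)"
    using B by (intro bexI[of _ "\<lambda>p. p' (G p)"])
qed

section \<open>Density of the polynomials in an injective immersion\<close>

lemma open_proj_image:
  assumes "open W"
  shows "open (proj ` W)"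
  unfolding open_torus3_def open_contains_ball
proof
  fix x assume "x \<in> proj -` proj ` W"
  then obtain y where y: "y \<in> W" "proj x = proj y" by auto
  obtain e where e: "e > 0" "ball y e \<subseteq> W" using assms y(1) open_contains_ball by blast
  have rel: "torus_rel x y" using y(2) by (simp add: proj_eq_iff)
  have "ball x e \<subseteq> proj -` proj ` W"
  proof
    fix z assume "z \<in> ball x e"
    then have "z + (y - x) \<in> ball y e" by (simp add: dist_norm algebra_simps)
    then have "z + (y - x) \<in> W" using e(2) by blast
    moreover have "proj z = proj (z + (y - x))"
      using rel by (simp add: proj_eq_iff torus_rel_def)
    ultimately show "z \<in> proj -` proj ` W" by auto
  qed
  then show "\<exists>e>0. ball x e \<subseteq> proj -` proj ` W" using e(1) by blast
qed

lemma proj_inj_on_ball: "inj_on proj (ball x0 1)"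
proof (rule inj_onI)
  fix x y assume xy: "x \<in> ball x0 1" "y \<in> ball x0 1" "proj x = proj y"
  have "x $ i = y $ i" for i
  proof -
    obtain n :: int where n: "x $ i - y $ i = 2 * pi * of_int n"
      using xy(3) unfolding proj_eq_iff torus_rel_def by blast
    have "\<bar>x $ i - y $ i\<bar> \<le> norm (x - y)" using component_le_norm_cart[of "x - y" i] by simp
    also have "norm (x - y) \<le> dist x0 x + dist x0 y"
      using dist_triangle[of x y x0] by (simp add: dist_norm norm_minus_commute)
    also have "\<dots> < 2" using xy by simp
    finally have "2 * pi * \<bar>real_of_int n\<bar> < 2" unfolding n by (simp add: abs_mult)
    moreover have "2 * pi > 2" using pi_gt3 by simp
    ultimately have "\<bar>real_of_int n\<bar> < 1"
      using mult_right_mono[of 1 "\<bar>real_of_int n\<bar>" "2 * pi"] by (smt (verit) mult.commute)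
    then have "n = 0" by linarith
    then show ?thesis using n by simp
  qed
  then show "x = y" by (simp add: vec_eq_iff)
qed

lemma smooth_components_continuous:
  assumes "smooth_components \<gamma>"
  shows "continuous_on UNIV \<gamma>"
proof -
  have "continuous_on UNIV (\<lambda>p. \<Sum>B\<in>Basis. (\<gamma> p \<bullet> B) *\<^sub>R B)"
    using assms Ck_continuous[OF CinfD[of _ 0]] unfolding smooth_components_def
    by (intro continuous_on_sum continuous_on_scaleR continuous_on_const) blast
  then show ?thesis by (simp add: euclidean_representation)
qed

lemma smooth_components_differentiable:
  assumes "smooth_components \<gamma>"
  shows "(\<gamma> \<circ> proj) differentiable (at x)"
proof -
  have "(\<lambda>x. (\<gamma> \<circ> proj) x \<bullet> B) differentiable (at x)" if "B \<in> Basis" for B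
  proof -
    have "(\<lambda>p. \<gamma> p \<bullet> B) \<in> Ck (Suc 0)" using assms that by (intro CinfD) (simp add: smooth_components_def)
    then have "Cdiff (Suc 0) UNIV ((\<lambda>p. \<gamma> p \<bullet> B) \<circ> proj)" by (simp only: Ck_iff_Cdiff)
    then show ?thesis by (simp add: o_def)
  qed
  then show ?thesis unfolding differentiable_componentwise_within[of "\<gamma> \<circ> proj"] by blast
qed

lemma dist_power2_polys: "(\<lambda>p. (norm (\<gamma> p - c))\<^sup>2) \<in> polys (\<gamma> :: torus3 \<Rightarrow> 'e::euclidean_space)"
proof -
  have "real_polynomial_function (\<lambda>y::'e. \<Sum>B\<in>Basis. (y \<bullet> B - c \<bullet> B)\<^sup>2)"
  proof (intro real_polynomial_function_sum real_polynomial_function_power real_polynomial_function_diff)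
    fix B :: 'e
    show "real_polynomial_function (\<lambda>y. y \<bullet> B)"
      by (intro real_polynomial_function.intros bounded_linear_inner_left)
  qed auto
  moreover have "(norm (y - c))\<^sup>2 = (\<Sum>B\<in>Basis. (y \<bullet> B - c \<bullet> B)\<^sup>2)" for y :: 'e
    unfolding power2_norm_eq_inner
    by (subst euclidean_inner) (simp add: inner_diff_left power2_eq_square)
  ultimately show ?thesis unfolding polys_def by auto
qed

text \<open>A left inverse \<open>L\<close> of the derivative of \<open>\<gamma>\<close> at \<open>x0\<close> turns \<open>\<gamma>\<close> into a map \<open>G = L \<circ> \<gamma>\<close> to \<open>\<real>\<^sup>3\<close> with
  derivative the identity at \<open>x0\<close>. So \<open>G\<close> is a local chart whose coordinates are linear in \<open>\<gamma>\<close>.\<close>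

lemma exists_local_chart:
  fixes \<gamma> :: "torus3 \<Rightarrow> 'e::euclidean_space"
  assumes \<gamma>: "smooth_components \<gamma>" and inj: "inj (frechet_derivative (\<gamma> \<circ> proj) (at x0))" and "1 \<le> k"
  obtains G U V g where "\<And>i :: 3. (\<lambda>p. G p $ i) \<in> polys \<gamma>" "open U" "x0 \<in> U" "U \<subseteq> ball x0 1" "open V"
    "homeomorphism U V (G \<circ> proj) g" "\<And>j :: 3. Cdiff k V (\<lambda>y. g y $ j)"
proof -
  let ?d = "frechet_derivative (\<gamma> \<circ> proj) (at x0)"
  have d: "(\<gamma> \<circ> proj has_derivative ?d) (at x0)"
    using smooth_components_differentiable[OF \<gamma>] by (simp add: frechet_derivative_works)
  have lin: "linear ?d" using d by (rule has_derivative_linear)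
  obtain L where L: "linear L" "L \<circ> ?d = id"
    using linear_injective_left_inverse[OF lin inj] by blast
  define G where "G p = L (\<gamma> p)" for p
  have bl: "bounded_linear L" using L(1) by (simp add: linear_conv_bounded_linear)
  have G: "(\<lambda>p. G p $ i) \<in> polys \<gamma>" for i
  proof -
    have "real_polynomial_function (\<lambda>y. L y $ i)"
      by (rule real_polynomial_function.intros(1)[OF bounded_linear_compose[OF bounded_linear_vec_nth bl]])
    then show ?thesis unfolding polys_def G_def mem_Collect_eq by (intro exI[of _ "\<lambda>y. L y $ i"] conjI refl)
  qed
  have GD: "Cdiff l UNIV (\<lambda>x. (G \<circ> proj) x $ i)" for i l
  proof -
    have "(\<lambda>p. G p $ i) \<in> Ck l" by (rule CinfD[OF polys_Cinf[OF \<gamma> G]])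
    then show ?thesis by (simp add: Ck_iff_Cdiff o_def)
  qed
  have "(G \<circ> proj has_derivative L \<circ> ?d) (at x0)"
    using bounded_linear.has_derivative[OF bl d] by (simp add: G_def[abs_def] o_def)
  then have dG: "(G \<circ> proj has_derivative id) (at x0)" unfolding L(2) .
  have "((\<lambda>x. (G \<circ> proj) x $ a) has_derivative (\<lambda>h. id h $ a)) (at x0)" for a
    by (rule bounded_linear.has_derivative[OF bounded_linear_vec_nth dG])
  from pd_eqI[OF this] have "jac (G \<circ> proj) x0 = mat 1"
    by (simp add: jac_def mat_def vec_eq_iff axis_def)
  then have det: "det (jac (G \<circ> proj) x0) \<noteq> 0" by simp
  have "x0 \<in> ball x0 1" by simp
  from Ck_inverse_function[OF open_ball this Cdiff_subset[OF GD subset_UNIV] assms(3) det]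
  obtain U V g where "open U" "U \<subseteq> ball x0 1" "x0 \<in> U" "open V" "homeomorphism U V (G \<circ> proj) g"
    "\<forall>j. Cdiff k V (\<lambda>y. g y $ j)" by blast
  then show ?thesis using that[of G U V g] G by blast
qed

text \<open>Compactness and injectivity: away from a neighbourhood of \<open>p0\<close> the distance to \<open>\<gamma> p0\<close> is bounded
  below. This allows cut-off functions that depend on \<open>\<gamma>\<close> only.\<close>

lemma exists_separation_radius:
  fixes \<gamma> :: "torus3 \<Rightarrow> 'e::euclidean_space"
  assumes "continuous_on UNIV \<gamma>" "inj \<gamma>" "open W" "p0 \<in> W"
  shows "\<exists>\<delta>>0. \<forall>p. p \<notin> W \<longrightarrow> \<delta> \<le> (norm (\<gamma> p - \<gamma> p0))\<^sup>2"
proof (cases "W = UNIV")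
  case True
  then show ?thesis by (intro exI[of _ 1]) auto
next
  case False
  have "compact (- W)"
    using compact_Int_closed[OF compact_UNIV_torus, of "- W"] assms(3) by (simp add: closed_Compl)
  moreover have "continuous_on (- W) (\<lambda>p. (norm (\<gamma> p - \<gamma> p0))\<^sup>2)"
    by (intro continuous_intros continuous_on_subset[OF assms(1)]) auto
  ultimately obtain q where q: "q \<in> - W" "\<forall>p\<in>- W. (norm (\<gamma> q - \<gamma> p0))\<^sup>2 \<le> (norm (\<gamma> p - \<gamma> p0))\<^sup>2"
    using continuous_attains_inf[of "- W"] False by blast
  have "\<gamma> q \<noteq> \<gamma> p0" using q(1) assms(2,4) by (auto simp: inj_def)
  then have "(norm (\<gamma> q - \<gamma> p0))\<^sup>2 > 0" by simp
  then show ?thesis using q(2) by blast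
qed

text \<open>The argument will be a squared distance, hence nonnegative, so that only its values on one half-line
  matter. The even extension gives it compact support, as \<open>approximable_compose\<close> demands.\<close>

definition cutoff :: "nat \<Rightarrow> real \<Rightarrow> real^1 \<Rightarrow> real" where
  "cutoff k \<delta> z = max 0 (\<delta>\<^sup>2 - (z $ 1)\<^sup>2) ^ (k + 1)"

lemma Cdiff_cutoff: "Cdiff k UNIV (cutoff k \<delta>)"
  unfolding cutoff_def[abs_def]
proof (rule Cdiff_max_power[OF open_UNIV])
  have "Cdiff k UNIV (\<lambda>z::real^1. \<delta>\<^sup>2 - z $ 1 * z $ 1)"
    by (intro Cdiff_diff Cdiff_mult Cdiff_const Cdiff_component open_UNIV)
  then show "Cdiff k UNIV (\<lambda>z::real^1. \<delta>\<^sup>2 - (z $ 1)\<^sup>2)" by (simp add: power2_eq_square)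
qed

lemma cutoff_eq_0: "0 \<le> \<delta> \<Longrightarrow> \<delta> \<le> \<bar>z $ 1\<bar> \<Longrightarrow> cutoff k \<delta> z = 0"
  using power_mono[of \<delta> "\<bar>z $ 1\<bar>" 2] by (simp add: cutoff_def)

text \<open>Near \<open>x0\<close> the functions \<open>G\<close> of \<open>exists_local_chart\<close> are coordinates, so a function \<open>w = f \<omega>\<close>
  supported there has the form \<open>F \<circ> G\<close> with \<open>F\<close> of class \<open>C\<^sup>k\<close> and of compact support. Elsewhere \<open>F \<circ> G\<close>
  may take other values, but another factor \<open>\<omega>\<close>, itself a function of \<open>\<gamma>\<close> and thus approximable,
  removes them: \<open>\<omega> \<cdot> (F \<circ> G) = f \<omega>\<^sup>2\<close> on the whole torus.\<close>

lemma local_approximation: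
  fixes \<gamma> :: "torus3 \<Rightarrow> 'e::euclidean_space"
  assumes \<gamma>: "smooth_components \<gamma>" "inj \<gamma>" and inj: "inj (frechet_derivative (\<gamma> \<circ> proj) (at x0))" and "1 \<le> k"
  shows "\<exists>\<omega>\<in>Ck k. \<omega> (proj x0) \<noteq> 0 \<and>
    (\<forall>f\<in>Ck k. approximable k (polys \<gamma>) (\<lambda>p. f p * (\<omega> p * \<omega> p)))"
proof -
  obtain G U V g where G: "\<And>i :: 3. (\<lambda>p. G p $ i) \<in> polys \<gamma>" and U: "open U" "x0 \<in> U" "U \<subseteq> ball x0 1"
    and V: "open V" and hom: "homeomorphism U V (G \<circ> proj) g" and g: "\<And>j :: 3. Cdiff k V (\<lambda>y. g y $ j)"
    using exists_local_chart[OF \<gamma>(1) inj \<open>1 \<le> k\<close>] by blast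
  obtain r where r: "r > 0" "cball x0 r \<subseteq> U" using U open_contains_cball by blast
  let ?W = "proj ` ball x0 r"
  have "open ?W" "proj x0 \<in> ?W" using r(1) by (auto intro: open_proj_image)
  from exists_separation_radius[OF smooth_components_continuous[OF \<gamma>(1)] \<gamma>(2) this]
  obtain \<delta> where \<delta>: "\<delta> > 0" "\<And>p. p \<notin> ?W \<Longrightarrow> \<delta> \<le> (norm (\<gamma> p - \<gamma> (proj x0)))\<^sup>2" by blast
  define h where "h p = (\<chi> i. (norm (\<gamma> p - \<gamma> (proj x0)))\<^sup>2 :: real^1)" for p
  define \<omega> where "\<omega> p = cutoff k \<delta> (h p)" for p
  have \<omega>0: "\<omega> p = 0" if "p \<notin> ?W" for p
    unfolding \<omega>_def by (rule cutoff_eq_0) (use \<delta> that in \<open>auto simp: h_def\<close>)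
  have "(\<lambda>p. h p $ i) \<in> polys \<gamma>" for i unfolding h_def by (simp add: dist_power2_polys)
  then have \<omega>a: "approximable k (polys \<gamma>) \<omega>"
    unfolding \<omega>_def
  proof (rule approximable_compose[OF \<gamma>(1) _ Cdiff_cutoff])
    fix z :: "real^1" assume "norm z > \<delta>"
    then show "cutoff k \<delta> z = 0" using \<delta>(1) by (intro cutoff_eq_0) (auto simp: norm_real)
  qed
  then have \<omega>C: "\<omega> \<in> Ck k" by (simp add: approximable_def)
  have "approximable k (polys \<gamma>) (\<lambda>p. f p * (\<omega> p * \<omega> p))" if f: "f \<in> Ck k" for f
  proof -
    define w where "w p = f p * \<omega> p" for p
    have w: "Cdiff k UNIV (w \<circ> proj)"
      using Ck_mult[OF f \<omega>C] by (simp add: w_def[abs_def] Ck_iff_Cdiff)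
    \<comment> \<open>In the chart \<open>w\<close> lives on the compact set \<open>?K\<close>, which makes the extension by zero smooth.\<close>
    define F where "F y = (if y \<in> V then w (proj (g y)) else 0)" for y
    let ?K = "(G \<circ> proj) ` cball x0 r"
    have K: "compact ?K"
      using hom continuous_on_subset[OF _ r(2)]
      by (intro compact_continuous_image compact_cball) (auto simp: homeomorphism_def)
    have KV: "?K \<subseteq> V" using hom r(2) by (auto simp: homeomorphism_def)
    have F0: "F y = 0" if "y \<notin> ?K" for y
    proof (cases "y \<in> V")
      case True
      then have gy: "g y \<in> U" "(G \<circ> proj) (g y) = y" using hom by (auto simp: homeomorphism_def)
      have "g y \<notin> cball x0 r" using gy(2) that by (metis image_eqI)
      have "proj (g y) \<notin> ?W"
      proof
        assume "proj (g y) \<in> ?W"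
        then obtain x where x: "x \<in> ball x0 r" "proj (g y) = proj x" by auto
        have "ball x0 r \<subseteq> ball x0 1" using r(2) U(3) ball_subset_cball by blast
        then have "x \<in> ball x0 1" "g y \<in> ball x0 1" using x(1) U(3) gy(1) by blast+
        with x(2) have "g y = x" by (intro inj_onD[OF proj_inj_on_ball])
        then show False using x(1) \<open>g y \<notin> cball x0 r\<close> by auto
      qed
      then show ?thesis by (simp add: F_def w_def \<omega>0)
    qed (simp add: F_def)
    have "Cdiff k V (\<lambda>y. (w \<circ> proj) (g y))"
      by (rule Cdiff_compose[OF V subset_UNIV w g])
    then have "Cdiff k V F"
      using Cdiff_cong[OF V, of F "\<lambda>y. (w \<circ> proj) (g y)"] by (simp add: F_def)
    moreover have oK: "open (- ?K)" using K compact_imp_closed by blast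
    have "Cdiff k (- ?K) F"
      using Cdiff_cong[OF oK, of F "\<lambda>y. 0"] F0 by simp
    ultimately have "Cdiff k (V \<union> - ?K) F" by (intro Cdiff_Un V oK)
    moreover have "V \<union> - ?K = UNIV" using KV by blast
    ultimately have F: "Cdiff k UNIV F" by simp
    obtain R where R: "\<And>y. y \<in> ?K \<Longrightarrow> norm y \<le> R"
      using compact_imp_bounded[OF K] unfolding bounded_iff by blast
    have "F y = 0" if "norm y > R" for y
    proof (rule F0)
      show "y \<notin> ?K" using R[of y] that by linarith
    qed
    from approximable_compose[OF \<gamma>(1) G F this]
    have "approximable k (polys \<gamma>) (\<lambda>p. F (G p))" .
    from approximable_polys_mult[OF \<gamma>(1) \<omega>a this]
    have "approximable k (polys \<gamma>) (\<lambda>p. \<omega> p * F (G p))" .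
    moreover have "\<omega> p * F (G p) = f p * (\<omega> p * \<omega> p)" for p
    proof (cases "p \<in> ?W")
      case True
      moreover have "ball x0 r \<subseteq> U" using r(2) ball_subset_cball by blast
      ultimately obtain x where x: "p = proj x" "x \<in> U" by blast
      then have "G p \<in> V" "g (G p) = x" using hom by (auto simp: homeomorphism_def)
      then show ?thesis using x by (simp add: F_def w_def)
    qed (simp add: \<omega>0)
    ultimately show ?thesis by simp
  qed
  moreover have "\<omega> (proj x0) \<noteq> 0" using \<delta>(1) by (simp add: \<omega>_def cutoff_def h_def)
  ultimately show ?thesis using \<omega>C by blast
qed

text \<open>A partition of unity argument: finitely many of the functions \<open>\<omega>\<close> of \<open>local_approximation\<close> have no
  common zero, so \<open>u = \<Sum> \<omega>\<^sup>2\<close> is invertible and \<open>f = \<Sum> (f / u) \<omega>\<^sup>2\<close>.\<close>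

theorem polys_dense_Ck:
  fixes \<gamma> :: "torus3 \<Rightarrow> 'e::euclidean_space"
  assumes \<gamma>: "smooth_components \<gamma>" "inj \<gamma>" and inj: "\<And>x. inj (frechet_derivative (\<gamma> \<circ> proj) (at x))"
    and k: "1 \<le> k" and f: "f \<in> Ck k"
  shows "approximable k (polys \<gamma>) f"
proof -
  have "\<exists>\<omega>\<in>Ck k. \<omega> p \<noteq> 0 \<and> (\<forall>f\<in>Ck k. approximable k (polys \<gamma>) (\<lambda>p. f p * (\<omega> p * \<omega> p)))" for p
    using local_approximation[OF \<gamma> inj k, of "rep_torus3 p"] unfolding proj_rep .
  then have "\<forall>p. \<exists>\<omega>. \<omega> \<in> Ck k \<and> \<omega> p \<noteq> 0 \<and> (\<forall>f\<in>Ck k. approximable k (polys \<gamma>) (\<lambda>p. f p * (\<omega> p * \<omega> p)))"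
    by blast
  from choice[OF this] obtain \<omega> where \<omega>: "\<And>p. \<omega> p \<in> Ck k" "\<And>p. \<omega> p p \<noteq> 0"
    "\<And>p f. f \<in> Ck k \<Longrightarrow> approximable k (polys \<gamma>) (\<lambda>q. f q * (\<omega> p q * \<omega> p q))" by blast
  have op: "open {q. \<omega> p q \<noteq> 0}" for p
    by (intro open_Collect_neq Ck_continuous[OF \<omega>(1)] continuous_on_const)
  have cover: "UNIV \<subseteq> (\<Union>p\<in>UNIV. {q. \<omega> p q \<noteq> 0})" using \<omega>(2) by auto
  obtain A where A: "finite A" "UNIV \<subseteq> (\<Union>p\<in>A. {q. \<omega> p q \<noteq> 0})"
    by (rule compactE_image[OF compact_UNIV_torus op cover])
  define u where "u q = (\<Sum>p\<in>A. \<omega> p q * \<omega> p q)" for q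
  have u: "u \<in> Ck k" unfolding u_def[abs_def] by (intro Ck_sum Ck_mult \<omega>(1))
  have u0: "u q \<noteq> 0" for q
  proof -
    obtain p where p: "p \<in> A" "\<omega> p q \<noteq> 0" using A(2) by blast
    have "0 < \<omega> p q * \<omega> p q" using p(2) by (simp add: less_le)
    also have "\<dots> \<le> u q" unfolding u_def by (rule member_le_sum[OF p(1) _ A(1)]) simp
    finally show ?thesis by simp
  qed
  have P: "polys \<gamma> \<subseteq> Ck k" using polys_Cinf[OF \<gamma>(1)] CinfD by blast
  have fu: "(\<lambda>q. f q * inverse (u q)) \<in> Ck k" by (intro Ck_mult f Ck_inverse u u0)
  have "approximable k (polys \<gamma>) (\<lambda>q. \<Sum>p\<in>A. f q * inverse (u q) * (\<omega> p q * \<omega> p q))"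
    by (rule approximable_sum[OF polys_add P polys_const A(1) \<omega>(3)[OF fu]])
  moreover have "(\<Sum>p\<in>A. f q * inverse (u q) * (\<omega> p q * \<omega> p q)) = f q" for q
  proof -
    have "(\<Sum>p\<in>A. f q * inverse (u q) * (\<omega> p q * \<omega> p q)) = f q * inverse (u q) * u q"
      unfolding u_def[of q] by (simp only: sum_distrib_left)
    then show ?thesis using u0[of q] by simp
  qed
  ultimately show ?thesis by simp
qed

section \<open>The saturation closure and the matrix \<open>b b\<^sup>T\<close>\<close>

lemma fun_span_add:
  assumes "f \<in> fun_span S" "g \<in> fun_span S"
  shows "(\<lambda>x. f x + g x) \<in> fun_span S"
proof -
  obtain A c where f: "f = (\<lambda>x. \<Sum>\<phi>\<in>A. c \<phi> * \<phi> x)" and A: "finite A" "A \<subseteq> S"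
    using assms(1) by (auto simp: fun_span_def)
  obtain B d where g: "g = (\<lambda>x. \<Sum>\<phi>\<in>B. d \<phi> * \<phi> x)" and B: "finite B" "B \<subseteq> S"
    using assms(2) by (auto simp: fun_span_def)
  define e where "e \<phi> = (if \<phi> \<in> A then c \<phi> else 0) + (if \<phi> \<in> B then d \<phi> else 0)" for \<phi>
  have "(\<Sum>\<phi>\<in>A \<union> B. e \<phi> * \<phi> x) = f x + g x" for x
  proof -
    have "(\<Sum>\<phi>\<in>A \<union> B. e \<phi> * \<phi> x) = (\<Sum>\<phi>\<in>A \<union> B. (if \<phi> \<in> A then c \<phi> * \<phi> x else 0)) + (\<Sum>\<phi>\<in>A \<union> B. (if \<phi> \<in> B then d \<phi> * \<phi> x else 0))"
      unfolding sum.distrib[symmetric] by (rule sum.cong) (auto simp: e_def algebra_simps)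
    also have "(\<Sum>\<phi>\<in>A \<union> B. (if \<phi> \<in> A then c \<phi> * \<phi> x else 0)) = f x"
      unfolding f using A B by (intro sum.mono_neutral_cong_right) auto
    also have "(\<Sum>\<phi>\<in>A \<union> B. (if \<phi> \<in> B then d \<phi> * \<phi> x else 0)) = g x"
      unfolding g using A B by (intro sum.mono_neutral_cong_right) auto
    finally show ?thesis .
  qed
  then have "(\<lambda>x. f x + g x) = (\<lambda>x. \<Sum>\<phi>\<in>A \<union> B. e \<phi> * \<phi> x)" by simp
  moreover have "finite (A \<union> B)" "A \<union> B \<subseteq> S" using A B by auto
  ultimately show ?thesis unfolding fun_span_def by blast
qed

lemma fun_span_cmult:
  assumes "f \<in> fun_span S"
  shows "(\<lambda>x. c * f x) \<in> fun_span S"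
proof -
  obtain A d where f: "f = (\<lambda>x. \<Sum>\<phi>\<in>A. d \<phi> * \<phi> x)" and A: "finite A" "A \<subseteq> S"
    using assms(1) by (auto simp: fun_span_def)
  have "(\<lambda>x. c * f x) = (\<lambda>x. \<Sum>\<phi>\<in>A. (c * d \<phi>) * \<phi> x)"
    by (simp add: f sum_distrib_left mult.assoc)
  then show ?thesis unfolding fun_span_def mem_Collect_eq
    using A by (intro exI[of _ A] exI[of _ "\<lambda>\<phi>. c * d \<phi>"] conjI)
qed

lemma fun_span_zero: "(\<lambda>x. 0) \<in> fun_span S"
  unfolding fun_span_def mem_Collect_eq by (intro exI[of _ "{}"]) auto

lemma fun_span_base: "f \<in> S \<Longrightarrow> f \<in> fun_span S"
  unfolding fun_span_def mem_Collect_eq by (intro exI[of _ "{f}"] exI[of _ "\<lambda>_. 1"]) auto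

lemma fun_span_sum:
  "(\<And>i. i \<in> A \<Longrightarrow> f i \<in> fun_span S) \<Longrightarrow> (\<lambda>x. \<Sum>i\<in>A. f i x) \<in> fun_span S"
  by (induction A rule: infinite_finite_induct) (auto intro: fun_span_zero fun_span_add)

lemma fun_span_induct [consumes 1, case_names zero add]:
  assumes "f \<in> fun_span S" "P (\<lambda>x. 0)"
    and step: "\<And>c \<phi> g. \<phi> \<in> S \<Longrightarrow> P g \<Longrightarrow> P (\<lambda>x. c * \<phi> x + g x)"
  shows "P f"
proof -
  obtain A c where f: "f = (\<lambda>x. \<Sum>\<phi>\<in>A. c \<phi> * \<phi> x)" and A: "finite A" "A \<subseteq> S"
    using assms(1) by (auto simp: fun_span_def)
  from A show ?thesis unfolding f
  proof (induction A rule: finite_induct)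
    case empty
    then show ?case using assms(2) by simp
  next
    case (insert \<phi> A)
    have "P (\<lambda>x. c \<phi> * \<phi> x + (\<Sum>\<phi>\<in>A. c \<phi> * \<phi> x))"
      by (rule step) (use insert in auto)
    then show ?case using insert by simp
  qed
qed

lemma sat_step: "\<phi> \<in> (\<Union>n. sat b n) \<Longrightarrow> (\<lambda>x. \<phi> x * b x $ j * b x $ k) \<in> (\<Union>n. sat b n)"
proof -
  assume "\<phi> \<in> (\<Union>n. sat b n)"
  then obtain n where "\<phi> \<in> sat b n" by blast
  then have "(\<lambda>x. \<phi> x * b x $ j * b x $ k) \<in> sat b (Suc n)" by auto
  then show ?thesis by blast
qed

lemma sat_union_induct [consumes 1, case_names base step]:
  assumes "\<phi> \<in> (\<Union>n. sat b n)" "\<And>j. P (\<lambda>x. b x $ j)"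
    and "\<And>\<phi> j k. P \<phi> \<Longrightarrow> P (\<lambda>x. \<phi> x * b x $ j * b x $ k)"
  shows "P \<phi>"
proof -
  obtain n where "\<phi> \<in> sat b n" using assms(1) by blast
  then show ?thesis
    by (induction n arbitrary: \<phi>) (use assms(2,3) in auto)
qed

lemma sat_inf_gen: "(\<lambda>x. b x $ j) \<in> sat_inf b"
  unfolding sat_inf_def by (rule fun_span_base, rule UN_I[of 0]) auto

lemma sat_inf_mult_pair:
  assumes "f \<in> sat_inf b"
  shows "(\<lambda>x. f x * b x $ j * b x $ k) \<in> sat_inf b"
  using assms unfolding sat_inf_def
proof (induction rule: fun_span_induct)
  case zero
  then show ?case by (simp add: fun_span_zero)
next
  case (add c \<phi> g)
  have "(\<lambda>x. c * (\<phi> x * b x $ j * b x $ k) + g x * b x $ j * b x $ k) \<in> fun_span (\<Union>n. sat b n)"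
    by (intro fun_span_add fun_span_cmult fun_span_base sat_step add)
  then show ?case by (simp add: algebra_simps)
qed

lemma sat_inf_induct [consumes 1, case_names zero base step add]:
  assumes "f \<in> sat_inf b" "P (\<lambda>x. 0)" "\<And>j. P (\<lambda>x. b x $ j)"
    and "\<And>\<phi> j k. P \<phi> \<Longrightarrow> P (\<lambda>x. \<phi> x * b x $ j * b x $ k)"
    and "\<And>c f g. P f \<Longrightarrow> P g \<Longrightarrow> P (\<lambda>x. c * f x + g x)"
  shows "P f"
  using assms(1) unfolding sat_inf_def
proof (induction rule: fun_span_induct)
  case (add c \<phi> g)
  have "P \<phi>" using add(1) assms(3,4) by (rule sat_union_induct)
  then show ?case using add(2) by (rule assms(5))
qed (rule assms(2))

lemma Gamma_mat_nth: "Gamma_mat b x $ i $ j = b x $ i * b x $ j"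
  by (simp add: Gamma_mat_def)

lemma matrix_linear_expansion:
  fixes l :: "real^'m::finite^'m \<Rightarrow> real"
  assumes "linear l"
  shows "l A = (\<Sum>i\<in>UNIV. \<Sum>j\<in>UNIV. A $ i $ j * l (axis i (axis j 1)))"
proof -
  have "A = (\<Sum>i\<in>UNIV. \<Sum>j\<in>UNIV. A $ i $ j *\<^sub>R axis i (axis j 1))"
  proof -
    have "(\<Sum>i\<in>UNIV. \<Sum>j\<in>UNIV. A $ i $ j *\<^sub>R axis i (axis j 1)) $ r $ c = A $ r $ c" for r c
    proof -
      have "(\<Sum>i\<in>UNIV. \<Sum>j\<in>UNIV. A $ i $ j *\<^sub>R axis i (axis j 1)) $ r $ c
          = (\<Sum>i\<in>UNIV. \<Sum>j\<in>UNIV. if i = r then (if j = c then A $ i $ j else 0) else 0)"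
        by (simp add: axis_def) (intro sum.cong refl, auto)
      also have "\<dots> = (\<Sum>i\<in>UNIV. if i = r then A $ i $ c else 0)"
        by (intro sum.cong refl) simp
      finally show ?thesis by simp
    qed
    then show ?thesis by (simp only: vec_eq_iff) simp
  qed
  then have "l A = l (\<Sum>i\<in>UNIV. \<Sum>j\<in>UNIV. A $ i $ j *\<^sub>R axis i (axis j 1))" by simp
  then show ?thesis by (simp add: linear_sum[OF assms] linear_cmul[OF assms])
qed

text \<open>Entries of \<open>\<Gamma>\<close> are products of two of the profiles, and such products act on the saturation closure.\<close>

lemma sat_inf_mult_poly:
  fixes b :: "torus3 \<Rightarrow> real^'m::finite"
  assumes "real_polynomial_function q"
  shows "f \<in> sat_inf b \<Longrightarrow> (\<lambda>x. q (Gamma_mat b x) * f x) \<in> sat_inf b"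
  using assms
proof (induction arbitrary: f)
  case (linear l)
  have "(\<lambda>x. \<Sum>i\<in>UNIV. \<Sum>j\<in>UNIV. l (axis i (axis j 1)) * (f x * b x $ i * b x $ j)) \<in> sat_inf b"
    using sat_inf_mult_pair[OF linear(2)] unfolding sat_inf_def by (intro fun_span_sum fun_span_cmult)
  moreover have "l (Gamma_mat b x) * f x = (\<Sum>i\<in>UNIV. \<Sum>j\<in>UNIV. l (axis i (axis j 1)) * (f x * b x $ i * b x $ j))" for x
    using matrix_linear_expansion[OF bounded_linear.linear[OF linear(1)], of "Gamma_mat b x"]
    by (simp add: Gamma_mat_nth sum_distrib_left mult_ac)
  ultimately show ?case by simp
next
  case (const c)
  then show ?case unfolding sat_inf_def by (rule fun_span_cmult)
next
  case (add p q)
  have "(\<lambda>x. p (Gamma_mat b x) * f x + q (Gamma_mat b x) * f x) \<in> sat_inf b"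
    using add.IH[OF add.prems] unfolding sat_inf_def by (rule fun_span_add)
  then show ?case by (simp add: distrib_right)
next
  case (mult p q)
  have "(\<lambda>x. p (Gamma_mat b x) * (q (Gamma_mat b x) * f x)) \<in> sat_inf b"
    by (intro mult.IH mult.prems)
  then show ?case by (simp add: mult.assoc)
qed

lemma sat_inf_Cinf:
  assumes b: "\<forall>j. (\<lambda>x. b x $ j) \<in> Cinf" and "f \<in> sat_inf b"
  shows "f \<in> Cinf"
  using assms(2)
proof (induction rule: sat_inf_induct)
  case (step \<phi> j k)
  then show ?case using b by (intro Cinf_mult) auto
next
  case (add c f g)
  then show ?case by (intro Cinf_mult Cinf_add Cinf_const)
qed (use b Cinf_const in auto)

lemma smooth_components_Gamma_mat:
  fixes b :: "torus3 \<Rightarrow> real^'m::finite"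
  assumes "\<forall>j. (\<lambda>x. b x $ j) \<in> Cinf"
  shows "smooth_components (Gamma_mat b)"
  unfolding smooth_components_def
proof
  fix B :: "real^'m^'m" assume "B \<in> Basis"
  then obtain i j where "B = axis i (axis j 1)" by (auto simp: Basis_vec_def)
  then have "(\<lambda>p. Gamma_mat b p \<bullet> B) = (\<lambda>p. b p $ i * b p $ j)" by (simp add: inner_axis Gamma_mat_nth)
  then show "(\<lambda>p. Gamma_mat b p \<bullet> B) \<in> Cinf" using assms by (simp add: Cinf_mult)
qed

text \<open>The identity \<open>f = \<Sum>\<^sub>j (f b\<^sub>j / |b|\<^sup>2) b\<^sub>j\<close> reduces density of the saturation closure to density of the
  polynomials in \<open>\<Gamma>\<close>, which multiply \<open>b\<^sub>j\<close> into the closure.\<close>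

lemma approximable_sat_inf:
  fixes b :: "torus3 \<Rightarrow> real^'m::finite"
  assumes b: "\<forall>j. (\<lambda>x. b x $ j) \<in> Cinf" and nz: "\<forall>x. b x \<noteq> 0"
    and dense: "\<And>f. f \<in> Ck k \<Longrightarrow> approximable k (polys (Gamma_mat b)) f" and f: "f \<in> Ck k"
  shows "approximable k (sat_inf b) f"
proof -
  define u where "u x = (\<Sum>j\<in>UNIV. b x $ j * b x $ j)" for x
  have bC: "(\<lambda>x. b x $ j) \<in> Ck k" for j using b CinfD by blast
  have u: "u \<in> Ck k" unfolding u_def[abs_def] by (intro Ck_sum Ck_mult bC)
  have u0: "u x \<noteq> 0" for x
  proof -
    obtain i where "b x $ i \<noteq> 0" using nz by (auto simp: vec_eq_iff)
    then have "0 < b x $ i * b x $ i" by (simp add: less_le)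
    also have "\<dots> \<le> u x" unfolding u_def by (rule member_le_sum) auto
    finally show ?thesis by simp
  qed
  have P: "polys (Gamma_mat b) \<subseteq> Ck k" using polys_Cinf[OF smooth_components_Gamma_mat[OF b]] CinfD by blast
  have S: "sat_inf b \<subseteq> Ck k" using sat_inf_Cinf[OF b] CinfD by blast
  have "approximable k (sat_inf b) (\<lambda>x. f x * b x $ j * inverse (u x) * b x $ j)" for j
  proof (rule approximable_superset)
    have "(\<lambda>x. f x * b x $ j * inverse (u x)) \<in> Ck k" by (intro Ck_mult f bC Ck_inverse u u0)
    from approximable_mult_fixed[OF dense[OF this] bC P]
    show "approximable k {\<lambda>p. s p * b p $ j |s. s \<in> polys (Gamma_mat b)} (\<lambda>x. f x * b x $ j * inverse (u x) * b x $ j)" .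
    show "{\<lambda>p. s p * b p $ j |s. s \<in> polys (Gamma_mat b)} \<subseteq> sat_inf b"
      using sat_inf_mult_poly[OF _ sat_inf_gen[of b j]] by (auto simp: polys_def)
  qed
  then have "approximable k (sat_inf b) (\<lambda>x. \<Sum>j\<in>UNIV. f x * b x $ j * inverse (u x) * b x $ j)"
    using S by (intro approximable_sum) (auto simp: sat_inf_def intro: fun_span_add fun_span_zero)
  moreover have "(\<Sum>j\<in>UNIV. f x * b x $ j * inverse (u x) * b x $ j) = f x" for x
  proof -
    have "(\<Sum>j\<in>UNIV. f x * b x $ j * inverse (u x) * b x $ j) = f x * inverse (u x) * u x"
      unfolding u_def[of x] sum_distrib_left by (rule sum.cong) (auto simp: mult_ac)
    then show ?thesis using u0[of x] by simp
  qed
  ultimately show ?thesis by simp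
qed

text \<open>Stone--Weierstrass; injectivity of \<open>\<gamma>\<close> is separation of points.\<close>

lemma polys_dense_C0:
  assumes "smooth_components \<gamma>" "inj \<gamma>" "f \<in> Ck 0"
  shows "approximable 0 (polys \<gamma>) f"
  unfolding approximable_def
proof (intro conjI allI impI)
  fix \<epsilon> :: real assume "\<epsilon> > 0"
  have "\<exists>g. g \<in> polys \<gamma> \<and> (\<forall>x\<in>UNIV. \<bar>f x - g x\<bar> < \<epsilon>)"
  proof (rule Stone_Weierstrass_HOL[where P = "\<lambda>g. g \<in> polys \<gamma>", OF compact_UNIV_torus])
    show "(\<lambda>x. c) \<in> polys \<gamma>" for c by (rule polys_const)
    show "continuous_on UNIV f" if "f \<in> polys \<gamma>" for f
      by (rule Ck_continuous[OF CinfD[OF polys_Cinf[OF assms(1) that], of 0]])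
    show "(\<lambda>x. f x + g x) \<in> polys \<gamma>" if "f \<in> polys \<gamma> \<and> g \<in> polys \<gamma>" for f g
      using that polys_add by blast
    show "(\<lambda>x. f x * g x) \<in> polys \<gamma>" if "f \<in> polys \<gamma> \<and> g \<in> polys \<gamma>" for f g
      using that polys_mult by blast
    show "\<exists>f. f \<in> polys \<gamma> \<and> f x \<noteq> f y" if "x \<in> UNIV \<and> y \<in> UNIV \<and> x \<noteq> y" for x y
    proof (intro exI conjI)
      show "(\<lambda>p. (norm (\<gamma> p - \<gamma> x))\<^sup>2) \<in> polys \<gamma>" by (rule dist_power2_polys)
      show "(norm (\<gamma> x - \<gamma> x))\<^sup>2 \<noteq> (norm (\<gamma> y - \<gamma> x))\<^sup>2"
        using that assms(2) by (auto simp: inj_def)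
    qed
    show "continuous_on UNIV f" using assms(3) by (rule Ck_continuous)
  qed (rule \<open>\<epsilon> > 0\<close>)
  then show "\<exists>g\<in>polys \<gamma>. Cbound 0 UNIV \<epsilon> ((\<lambda>x. f x - g x) \<circ> proj)"
    by (auto intro: less_imp_le)
qed (rule assms(3))

lemma sat_inf_sign:
  assumes "f \<in> sat_inf b" "s * s = 1" "\<And>j. b q $ j = s * b p $ j"
  shows "f q = s * f p"
  using assms(1)
proof (induction rule: sat_inf_induct)
  case (step \<phi> j k)
  have "\<phi> q * b q $ j * b q $ k = (s * s) * (s * (\<phi> p * b p $ j * b p $ k))"
    by (simp add: step assms(3) mult_ac)
  then show ?case by (simp add: assms(2))
next
  case (add c f g)
  then show ?case by (simp add: algebra_simps)
qed (simp_all add: assms(3))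

text \<open>The rank-one matrix \<open>b b\<^sup>T\<close> determines \<open>b\<close> up to sign.\<close>

lemma Gamma_mat_eq_imp_sign:
  assumes "Gamma_mat b p = Gamma_mat b q" "b p \<noteq> 0"
  obtains s where "s * s = 1" "\<And>j. b q $ j = s * b p $ j"
proof -
  have eq: "b p $ i * b p $ j = b q $ i * b q $ j" for i j
    using assms(1) by (metis Gamma_mat_nth)
  obtain i where i: "b p $ i \<noteq> 0" using assms(2) by (auto simp: vec_eq_iff)
  define s where "s = b q $ i / b p $ i"
  have i': "b q $ i \<noteq> 0" using eq[of i i] i by auto
  have ss: "s * s = 1" using eq[of i i] i i' by (simp add: s_def)
  have "b q $ j = s * b p $ j" for j
  proof -
    have "s * b p $ j = (b p $ i * b p $ j) * b q $ i / (b p $ i * b p $ i)"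
      using i by (simp add: s_def)
    also have "\<dots> = b q $ j * ((b q $ i * b q $ i) / (b p $ i * b p $ i))"
      unfolding eq[of i j] by simp
    also have "\<dots> = b q $ j" unfolding eq[of i i] using i' by simp
    finally show ?thesis by simp
  qed
  then show ?thesis using that ss by blast
qed

text \<open>Every element of the saturation closure vanishes where \<open>b\<close> does and, being odd in \<open>b\<close>, takes values
  of equal modulus at two points with the same \<open>\<Gamma>\<close>. The constant one and a function vanishing at
  only one of the two points cannot be approximated by such functions.\<close>

lemma dense_imp_nonzero_inj:
  fixes b :: "torus3 \<Rightarrow> real^'m::finite"
  assumes "\<And>f \<epsilon>. f \<in> Cinf \<Longrightarrow> \<epsilon> > 0 \<Longrightarrow> \<exists>g\<in>sat_inf b. \<forall>p. \<bar>f p - g p\<bar> \<le> \<epsilon>"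
  shows "(\<forall>x. b x \<noteq> 0) \<and> inj (Gamma_mat b)"
proof (intro conjI allI)
  show nz: "b p \<noteq> 0" for p
  proof
    assume "b p = 0"
    obtain g where g: "g \<in> sat_inf b" "\<forall>p. \<bar>1 - g p\<bar> \<le> 1/2"
      using assms[of "\<lambda>_. 1" "1/2"] Cinf_const by auto
    have "g p = 0" using g(1) by (induction rule: sat_inf_induct) (simp_all add: \<open>b p = 0\<close>)
    then show False using g(2)[rule_format, of p] by simp
  qed
  show "inj (Gamma_mat b)"
  proof (rule injI, rule ccontr)
    fix p q assume pq: "Gamma_mat b p = Gamma_mat b q" "p \<noteq> q"
    obtain s where s: "s * s = 1" "\<And>j. b q $ j = s * b p $ j"
      using Gamma_mat_eq_imp_sign[OF pq(1) nz] by blast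
    obtain y where q: "q = proj y" using proj_surj by blast
    define e where "e = bump_at y p"
    have "bump_at y p \<noteq> 0" using pq(2) q bump_at_eq_0 by blast
    then have e: "e > 0" using bump_at_nonneg[of y p] by (simp add: e_def less_le)
    then obtain g where g: "g \<in> sat_inf b" "\<And>p. \<bar>bump_at y p - g p\<bar> \<le> e / 3"
      using assms[OF bump_at_Cinf, of "e / 3"] by auto
    have "bump_at y q = 0" using q bump_at_eq_0 by blast
    then have "\<bar>g q\<bar> \<le> e / 3" using g(2)[of q] by simp
    moreover have "\<bar>s\<bar> = 1" using s(1) by (metis abs_mult abs_one abs_square_eq_1 power2_eq_square)
    then have "\<bar>g q\<bar> = \<bar>g p\<bar>" using sat_inf_sign[OF g(1) s] by (simp add: abs_mult)
    ultimately show False using g(2)[of p] e by (simp add: e_def)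
  qed
qed

section \<open>Density and embeddings\<close>

lemma component_has_derivative:
  assumes "(\<lambda>p. f p :: real) \<in> Ck (Suc k)"
  shows "((\<lambda>x. f (proj x)) has_derivative frechet_derivative (\<lambda>x. f (proj x)) (at x)) (at x)"
proof -
  have "f \<circ> proj differentiable (at x)" using assms by simp
  then show ?thesis by (simp add: frechet_derivative_works o_def)
qed

lemma matrix_has_derivative:
  fixes F :: "'a::real_normed_vector \<Rightarrow> real^'r::finite^'s::finite"
  assumes "\<And>i j. ((\<lambda>x. F x $ i $ j) has_derivative (\<lambda>h. D h $ i $ j)) (at x)"
  shows "(F has_derivative D) (at x)"
proof -
  have "((\<lambda>x. F x \<bullet> B) has_derivative (\<lambda>h. D h \<bullet> B)) (at x)" if B: "B \<in> Basis" for B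
  proof -
    obtain i j where "B = axis i (axis j 1)" using B by (auto simp: Basis_vec_def)
    then show ?thesis using assms[of i j] by (simp add: inner_axis)
  qed
  then show ?thesis by (subst has_derivative_componentwise_within) blast
qed

text \<open>Smoothness of the matrix-valued map, as \<open>smooth_embedding\<close> requires it, from that of its entries.\<close>

lemma Ck_matrix:
  fixes F :: "torus3 \<Rightarrow> real^'r::finite^'s::finite"
  shows "(\<And>i j. (\<lambda>p. F p $ i $ j) \<in> Ck k) \<Longrightarrow> F \<in> Ck k"
proof (induction k arbitrary: F)
  case 0
  then have "continuous_on UNIV (\<lambda>p. \<chi> i j. F p $ i $ j)"
    by (intro continuous_on_vec_lambda) simp
  then show ?case by simp
next
  case (Suc k)
  note C = component_has_derivative[OF Suc.prems]
  define D where "D x h = (\<chi> i j. frechet_derivative (\<lambda>x. F (proj x) $ i $ j) (at x) h)" for x h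
  have D: "(F \<circ> proj has_derivative D x) (at x)" for x
    by (rule matrix_has_derivative) (simp add: D_def C)
  have "partial l F p $ i $ j = partial l (\<lambda>p. F p $ i $ j) p" for l p i j
    unfolding partial_def frechet_derivative_at[OF D, symmetric] by (simp add: D_def o_def)
  then have "(\<lambda>p. partial l F p $ i $ j) \<in> Ck k" for l i j
    using Suc.prems[of i j] by simp
  then have "partial l F \<in> Ck k" for l by (rule Suc.IH)
  moreover have "F \<circ> proj differentiable (at x)" for x using D by (rule differentiableI)
  ultimately show ?case by simp
qed

lemma Gamma_mat_Cinf:
  fixes b :: "torus3 \<Rightarrow> real^'m::finite"
  assumes "\<forall>j. (\<lambda>x. b x $ j) \<in> Cinf"
  shows "Gamma_mat b \<in> Cinf"
proof (rule CinfI)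
  have "(\<lambda>p. b p $ i * b p $ j) \<in> Ck k" for i j k using assms by (intro Ck_mult CinfD) auto
  then show "Gamma_mat b \<in> Ck k" for k by (intro Ck_matrix) (simp add: Gamma_mat_nth)
qed

lemma Gamma_mat_derivative:
  fixes b :: "torus3 \<Rightarrow> real^'m::finite"
  assumes "\<forall>j. (\<lambda>x. b x $ j) \<in> Cinf"
  shows "frechet_derivative (Gamma_mat b \<circ> proj) (at x) v $ i $ j =
    b (proj x) $ i * frechet_derivative (\<lambda>x. b (proj x) $ j) (at x) v +
    frechet_derivative (\<lambda>x. b (proj x) $ i) (at x) v * b (proj x) $ j"
proof -
  define D where "D v = (\<chi> i j. b (proj x) $ i * frechet_derivative (\<lambda>x. b (proj x) $ j) (at x) v +
    frechet_derivative (\<lambda>x. b (proj x) $ i) (at x) v * b (proj x) $ j)" for v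
  have d: "((\<lambda>x. b (proj x) $ j) has_derivative frechet_derivative (\<lambda>x. b (proj x) $ j) (at x)) (at x)" for j
    by (rule component_has_derivative[of _ 0]) (use assms CinfD in blast)
  have "(Gamma_mat b \<circ> proj has_derivative D) (at x)"
    by (rule matrix_has_derivative) (simp add: D_def Gamma_mat_nth has_derivative_mult[OF d d])
  from frechet_derivative_at[OF this] have "D = frechet_derivative (Gamma_mat b \<circ> proj) (at x)" .
  then show ?thesis by (simp add: D_def[abs_def] flip: \<open>D = _\<close>)
qed

text \<open>The map \<open>\<Gamma>\<close> is quadratic in \<open>b\<close>, so its derivative vanishes at every zero of \<open>b\<close>.\<close>

lemma immersion_imp_nonzero:
  fixes b :: "torus3 \<Rightarrow> real^'m::finite"
  assumes "\<forall>j. (\<lambda>x. b x $ j) \<in> Cinf" and "\<And>x. inj (frechet_derivative (Gamma_mat b \<circ> proj) (at x))"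
  shows "b p \<noteq> 0"
proof
  assume "b p = 0"
  obtain x where p: "p = proj x" using proj_surj by blast
  have "frechet_derivative (Gamma_mat b \<circ> proj) (at x) v = 0" for v
    using \<open>b p = 0\<close> by (simp add: vec_eq_iff Gamma_mat_derivative[OF assms(1)] p)
  then have "(axis 1 1 :: real^3) = 0" using assms(2)[of x] by (metis injD)
  then show False by (simp add: axis_eq_0_iff)
qed

text \<open>Where \<open>b\<close> does not vanish, a direction killed by the derivative of \<open>b b\<^sup>T\<close> is also killed by that of
  \<open>b\<close>, and then by the derivative of every element of the saturation closure. A sine with nonzero
  derivative in this direction is therefore not a \<open>C\<^sup>1\<close> limit of such elements.\<close>

lemma dense_C1_imp_immersion:
  fixes b :: "torus3 \<Rightarrow> real^'m::finite"
  assumes b: "\<forall>j. (\<lambda>x. b x $ j) \<in> Cinf" and nz: "\<And>p. b p \<noteq> 0"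
    and dense: "\<And>f. f \<in> Cinf \<Longrightarrow> approximable (Suc 0) (sat_inf b) f"
  shows "inj (frechet_derivative (Gamma_mat b \<circ> proj) (at x))"
proof -
  let ?D = "frechet_derivative (Gamma_mat b \<circ> proj) (at x)"
  let ?d = "\<lambda>j. frechet_derivative (\<lambda>x. b (proj x) $ j) (at x)"
  have d: "((\<lambda>x. b (proj x) $ j) has_derivative ?d j) (at x)" for j
    by (rule component_has_derivative[of _ 0]) (use b CinfD in blast)
  have "Gamma_mat b \<in> Ck (Suc 0)" using Gamma_mat_Cinf[OF b] by (rule CinfD)
  then have "(Gamma_mat b \<circ> proj) differentiable (at x)" by simp
  then have lin: "linear ?D" by (rule linear_frechet_derivative)
  have "v = 0" if Dv: "?D v = 0" for v
  proof (rule ccontr)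
    assume "v \<noteq> 0"
    then obtain i where i: "v $ i \<noteq> 0" by (auto simp: vec_eq_iff)
    have sym: "b (proj x) $ i * ?d j v + ?d i v * b (proj x) $ j = 0" for i j
      using Gamma_mat_derivative[OF b, of x v i j] Dv by simp
    obtain r where r: "b (proj x) $ r \<noteq> 0" using nz[of "proj x"] by (auto simp: vec_eq_iff)
    have "?d r v = 0" using sym[of r r] r by simp
    then have db: "?d j v = 0" for j using sym[of r j] r by simp
    have dg: "\<exists>g'. ((\<lambda>x. g (proj x)) has_derivative g') (at x) \<and> g' v = 0" if "g \<in> sat_inf b" for g
      using that
    proof (induction rule: sat_inf_induct)
      case zero
      show ?case by (intro exI[of _ "\<lambda>h. 0"]) auto
    next
      case (base j)
      show ?case by (intro exI[of _ "?d j"] conjI d db)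
    next
      case (step \<phi> j k)
      then obtain g' where g': "((\<lambda>x. \<phi> (proj x)) has_derivative g') (at x)" "g' v = 0" by blast
      note * = has_derivative_mult[OF has_derivative_mult[OF g'(1) d] d, of j k]
      show ?case by (rule exI, rule conjI, rule *) (simp add: g'(2) db)
    next
      case (add c f g)
      then obtain f' g' where g': "((\<lambda>x. f (proj x)) has_derivative f') (at x)" "f' v = 0"
        "((\<lambda>x. g (proj x)) has_derivative g') (at x)" "g' v = 0" by blast
      note * = has_derivative_add[OF has_derivative_mult_right[OF g'(1), of c] g'(3)]
      show ?case by (rule exI, rule conjI, rule *) (simp add: g')
    qed
    define e where "e = (\<lambda>k. if k = i then 1 else (0::int))"
    have freq_dot_e: "freq_dot e h = h $ i" for h
      by (simp add: freq_dot_def e_def if_distrib[of of_int] if_distrib[of "\<lambda>c. c * _"] cong: if_cong)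
    \<comment> \<open>This is the sine of the displacement from \<open>x\<close> in the \<open>i\<close>-th coordinate.\<close>
    define f where "f = trig e (- (x $ i) - pi / 2)"
    have fC: "f \<in> Cinf" by (simp add: f_def trig_Cinf)
    have df: "((\<lambda>x. f (proj x)) has_derivative (\<lambda>h. h $ i)) (at x)"
      using has_derivative_sin_cos_linear(2)[OF bounded_linear_freq_dot, of e "- (x $ i) - pi / 2" x]
      by (simp add: f_def trig_proj freq_dot_e)
    define s where "s = (\<Sum>j\<in>UNIV. \<bar>v $ j\<bar>)"
    have "\<bar>v $ i\<bar> \<le> s" unfolding s_def by (rule member_le_sum) auto
    then have s: "s > 0" using i by linarith
    \<comment> \<open>An error of \<open>\<epsilon>\<close> in each partial derivative changes the derivative along \<open>v\<close> by at most half of its value.\<close>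
    define \<epsilon> where "\<epsilon> = \<bar>v $ i\<bar> / (2 * s)"
    have \<epsilon>: "\<epsilon> > 0" using i s by (simp add: \<epsilon>_def)
    obtain g where g: "g \<in> sat_inf b" "Cbound (Suc 0) UNIV \<epsilon> ((\<lambda>x. f x - g x) \<circ> proj)"
      using dense[OF fC] \<epsilon> unfolding approximable_def by blast
    obtain g' where g': "((\<lambda>x. g (proj x)) has_derivative g') (at x)" "g' v = 0" using dg[OF g(1)] by blast
    have h: "((\<lambda>x. f x - g x) \<circ> proj has_derivative (\<lambda>h. h $ i - g' h)) (at x)"
      unfolding o_def by (rule has_derivative_diff[OF df g'(1)])
    from has_derivative_unique[OF h has_derivative_pd[OF differentiableI[OF h]]]
    have "v $ i - g' v = (\<Sum>j\<in>UNIV. v $ j * pd j ((\<lambda>x. f x - g x) \<circ> proj) x)" by metis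
    then have "\<bar>v $ i\<bar> = \<bar>\<Sum>j\<in>UNIV. v $ j * pd j ((\<lambda>x. f x - g x) \<circ> proj) x\<bar>" using g'(2) by simp
    also have "\<dots> \<le> (\<Sum>j\<in>UNIV. \<bar>v $ j * pd j ((\<lambda>x. f x - g x) \<circ> proj) x\<bar>)" by (rule sum_abs)
    also have "\<dots> \<le> (\<Sum>j\<in>UNIV. \<bar>v $ j\<bar> * \<epsilon>)"
      unfolding abs_mult using g(2) by (intro sum_mono mult_left_mono) auto
    also have "\<dots> = s * \<epsilon>" by (simp add: s_def sum_distrib_right)
    also have "\<dots> = \<bar>v $ i\<bar> / 2" using s by (simp add: \<epsilon>_def)
    finally show False using i by simp
  qed
  then show ?thesis using linear_injective_0[OF lin] by blast
qed

text \<open>The topological part of being an embedding comes for free: a continuous injection of a compact space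
  into a Hausdorff space is closed.\<close>

lemma smooth_embedding_Gamma_mat_iff:
  fixes b :: "torus3 \<Rightarrow> real^'m::finite"
  assumes b: "\<forall>j. (\<lambda>x. b x $ j) \<in> Cinf"
  shows "smooth_embedding Sym (Gamma_mat b) \<longleftrightarrow>
    inj (Gamma_mat b) \<and> (\<forall>x. inj (frechet_derivative (Gamma_mat b \<circ> proj) (at x)))"
proof
  assume L: "smooth_embedding Sym (Gamma_mat b)"
  then have "inj_on (Gamma_mat b) (topspace euclidean)"
    unfolding smooth_embedding_def embedding_map_def using homeomorphic_imp_injective_map by blast
  then show "inj (Gamma_mat b) \<and> (\<forall>x. inj (frechet_derivative (Gamma_mat b \<circ> proj) (at x)))"
    using L by (simp add: smooth_embedding_def)
next
  assume R: "inj (Gamma_mat b) \<and> (\<forall>x. inj (frechet_derivative (Gamma_mat b \<circ> proj) (at x)))"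
  have ran: "range (Gamma_mat b) \<subseteq> Sym"
    by (auto simp: Sym_def transpose_def Gamma_mat_def mult.commute)
  have cont: "continuous_on UNIV (Gamma_mat b)"
    by (rule smooth_components_continuous[OF smooth_components_Gamma_mat[OF b]])
  then have cm: "continuous_map euclidean (top_of_set Sym) (Gamma_mat b)"
    using ran by (auto simp: continuous_map_in_subtopology)
  have "closed_map euclidean (top_of_set Sym) (Gamma_mat b)"
    by (rule continuous_imp_closed_map[OF cm])
      (simp_all add: compact_space_def compact_UNIV_torus Hausdorff_space_subtopology)
  then have "embedding_map euclidean (top_of_set Sym) (Gamma_mat b)"
    using R cm by (intro injective_closed_imp_embedding_map) simp_all
  then show "smooth_embedding Sym (Gamma_mat b)"
    using R ran Gamma_mat_Cinf[OF b] by (simp add: smooth_embedding_def)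
qed

theorem closure_C0_iff:
  fixes b :: "torus3 \<Rightarrow> real^'m::finite"
  assumes b: "\<forall>j. (\<lambda>x. b x $ j) \<in> Cinf"
  shows "closure_in (Ck 0) (Ck_norm 0) (sat_inf b) = Ck 0 \<longleftrightarrow> (\<forall>x. b x \<noteq> 0) \<and> inj (Gamma_mat b)"
proof -
  have S: "sat_inf b \<subseteq> Ck k" for k using sat_inf_Cinf[OF b] CinfD by blast
  show ?thesis unfolding closure_in_Ck[OF S]
  proof
    assume L: "{f. approximable 0 (sat_inf b) f} = Ck 0"
    show "(\<forall>x. b x \<noteq> 0) \<and> inj (Gamma_mat b)"
    proof (rule dense_imp_nonzero_inj)
      fix f :: "torus3 \<Rightarrow> real" and \<epsilon> :: real assume "f \<in> Cinf" "\<epsilon> > 0"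
      then have "f \<in> Ck 0" by (intro CinfD)
      then have "approximable 0 (sat_inf b) f" using L by blast
      then show "\<exists>g\<in>sat_inf b. \<forall>p. \<bar>f p - g p\<bar> \<le> \<epsilon>"
        using \<open>\<epsilon> > 0\<close> unfolding approximable_def all_torus_iff[of "\<lambda>p. \<bar>f p - _ p\<bar> \<le> \<epsilon>"] by simp
    qed
  next
    assume R: "(\<forall>x. b x \<noteq> 0) \<and> inj (Gamma_mat b)"
    have "approximable 0 (sat_inf b) f" if "f \<in> Ck 0" for f :: "torus3 \<Rightarrow> real"
      using R that by (intro approximable_sat_inf[OF b] polys_dense_C0 smooth_components_Gamma_mat[OF b]) auto
    then show "{f. approximable 0 (sat_inf b) f} = Ck 0" by (auto simp: approximable_def)
  qed
qed

theorem smooth_embedding_imp_approximable: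
  fixes b :: "torus3 \<Rightarrow> real^'m::finite"
  assumes b: "\<forall>j. (\<lambda>x. b x $ j) \<in> Cinf" and emb: "smooth_embedding Sym (Gamma_mat b)"
    and k: "1 \<le> k" and f: "f \<in> Ck k"
  shows "approximable k (sat_inf b) f"
proof -
  have inj: "inj (Gamma_mat b)" "\<And>x. inj (frechet_derivative (Gamma_mat b \<circ> proj) (at x))"
    using emb unfolding smooth_embedding_Gamma_mat_iff[OF b] by blast+
  have nz: "\<forall>x. b x \<noteq> 0" using immersion_imp_nonzero[OF b inj(2)] by blast
  show ?thesis
    by (rule approximable_sat_inf[OF b nz polys_dense_Ck[OF smooth_components_Gamma_mat[OF b] inj k] f])
qed

theorem closure_Ck_iff:
  fixes b :: "torus3 \<Rightarrow> real^'m::finite"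
  assumes b: "\<forall>j. (\<lambda>x. b x $ j) \<in> Cinf" and k: "1 \<le> k"
  shows "closure_in (Ck k) (Ck_norm k) (sat_inf b) = Ck k \<longleftrightarrow> smooth_embedding Sym (Gamma_mat b)"
proof -
  have S: "sat_inf b \<subseteq> Ck k" for k using sat_inf_Cinf[OF b] CinfD by blast
  obtain k' where k': "k = Suc k'" using k by (cases k) auto
  show ?thesis unfolding closure_in_Ck[OF S]
  proof
    assume L: "{f. approximable k (sat_inf b) f} = Ck k"
    have app: "approximable k (sat_inf b) f" if "f \<in> Cinf" for f :: "torus3 \<Rightarrow> real" using L CinfD[OF that, of k] by blast
    have "(\<forall>x. b x \<noteq> 0) \<and> inj (Gamma_mat b)"
    proof (rule dense_imp_nonzero_inj)
      fix f :: "torus3 \<Rightarrow> real" and \<epsilon> :: real assume f: "f \<in> Cinf" "\<epsilon> > 0"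
      then obtain g where g: "g \<in> sat_inf b" "Cbound k UNIV \<epsilon> ((\<lambda>x. f x - g x) \<circ> proj)"
        using app[OF f(1)] unfolding approximable_def by blast
      have "\<bar>f p - g p\<bar> \<le> \<epsilon>" for p
        using Cbound_pointwise[OF g(2), of "rep_torus3 p"] by (simp add: proj_rep)
      then show "\<exists>g\<in>sat_inf b. \<forall>p. \<bar>f p - g p\<bar> \<le> \<epsilon>" using g(1) by blast
    qed
    moreover have "approximable (Suc 0) (sat_inf b) f" if f: "f \<in> Cinf" for f
    proof -
      have "Cbound (Suc 0) UNIV \<epsilon> h" if "Cbound k UNIV \<epsilon> h" for \<epsilon> and h :: "real^3 \<Rightarrow> real"
        using that unfolding k' by (auto intro: Cbound_pointwise)
      then show ?thesis using app[OF f] CinfD[OF f, of "Suc 0"] unfolding approximable_def by blast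
    qed
    ultimately show "smooth_embedding Sym (Gamma_mat b)"
      unfolding smooth_embedding_Gamma_mat_iff[OF b] using dense_C1_imp_immersion[OF b] by blast
  next
    assume "smooth_embedding Sym (Gamma_mat b)"
    then show "{f. approximable k (sat_inf b) f} = Ck k"
      using smooth_embedding_imp_approximable[OF b _ k] by (auto simp: approximable_def)
  qed
qed

section \<open>Odd polynomials\<close>

definition monomial_eval :: "('m::finite \<Rightarrow>\<^sub>0 nat) \<Rightarrow> real^'m \<Rightarrow> real" where
  "monomial_eval \<alpha> z = (\<Prod>i\<in>UNIV. (z $ i) ^ Poly_Mapping.lookup \<alpha> i)"

lemma poly_eval_superset:
  assumes "finite K" "Poly_Mapping.keys P \<subseteq> K"
  shows "poly_eval P z = (\<Sum>\<alpha>\<in>K. Poly_Mapping.lookup P \<alpha> * monomial_eval \<alpha> z)"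
  unfolding poly_eval_def monomial_eval_def
  by (rule sum.mono_neutral_left) (use assms in \<open>auto simp: in_keys_iff\<close>)

lemma poly_eval_add: "poly_eval (P + Q) z = poly_eval P z + poly_eval Q z"
proof -
  let ?K = "Poly_Mapping.keys P \<union> Poly_Mapping.keys Q"
  have "poly_eval (P + Q) z = (\<Sum>\<alpha>\<in>?K. Poly_Mapping.lookup (P + Q) \<alpha> * monomial_eval \<alpha> z)"
    by (rule poly_eval_superset) (use Poly_Mapping.keys_add[of P Q] in auto)
  also have "\<dots> = (\<Sum>\<alpha>\<in>?K. Poly_Mapping.lookup P \<alpha> * monomial_eval \<alpha> z)
      + (\<Sum>\<alpha>\<in>?K. Poly_Mapping.lookup Q \<alpha> * monomial_eval \<alpha> z)"
    by (simp add: lookup_add distrib_right sum.distrib)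
  also have "\<dots> = poly_eval P z + poly_eval Q z"
    by (subst (1 2) poly_eval_superset[of ?K]) auto
  finally show ?thesis .
qed

lemma poly_eval_single: "poly_eval (Poly_Mapping.single \<alpha> c) z = c * monomial_eval \<alpha> z"
  by (subst poly_eval_superset[of "{\<alpha>}"]) auto

lemma monomial_eval_plus: "monomial_eval (\<alpha> + \<beta>) z = monomial_eval \<alpha> z * monomial_eval \<beta> z"
  by (simp add: monomial_eval_def lookup_add power_add prod.distrib)

lemma monomial_eval_single: "monomial_eval (Poly_Mapping.single i 1) z = z $ i"
proof -
  have "(z $ k) ^ Poly_Mapping.lookup (Poly_Mapping.single i 1) k = (if k = i then z $ k else 1)" for k
    by (auto simp: lookup_single when_def)
  then show ?thesis unfolding monomial_eval_def by simp
qed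

text \<open>A monomial written as a word of variables; reading off two letters at a time is one step of the
  saturation.\<close>

definition word_eval :: "'m list \<Rightarrow> real^'m::finite \<Rightarrow> real" where
  "word_eval l z = prod_list (map (\<lambda>i. z $ i) l)"

lemma word_eval_monomial: "\<exists>\<alpha>. \<forall>z. word_eval l z = monomial_eval \<alpha> z"
proof (induction l)
  case Nil
  show ?case by (rule exI[of _ 0]) (simp add: word_eval_def monomial_eval_def)
next
  case (Cons i l)
  then obtain \<alpha> where "\<forall>z. word_eval l z = monomial_eval \<alpha> z" by blast
  then show ?case
    by (intro exI[of _ "Poly_Mapping.single i 1 + \<alpha>"])
      (simp add: word_eval_def monomial_eval_plus monomial_eval_single del: One_nat_def)
qed

lemma monomial_eval_word:
  "\<exists>l. length l = (\<Sum>i\<in>UNIV. Poly_Mapping.lookup \<alpha> i) \<and> (\<forall>z. monomial_eval \<alpha> z = word_eval l z)"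
proof -
  have "\<exists>l. length l = (\<Sum>i\<in>A. Poly_Mapping.lookup \<alpha> i) \<and>
      (\<forall>z. (\<Prod>i\<in>A. (z $ i) ^ Poly_Mapping.lookup \<alpha> i) = word_eval l z)" if "finite A" for A
    using that
  proof (induction A rule: finite_induct)
    case empty
    show ?case by (rule exI[of _ "[]"]) (simp add: word_eval_def)
  next
    case (insert i A)
    then obtain l where l: "length l = (\<Sum>i\<in>A. Poly_Mapping.lookup \<alpha> i)"
      "\<forall>z. (\<Prod>i\<in>A. (z $ i) ^ Poly_Mapping.lookup \<alpha> i) = word_eval l z" by blast
    show ?case
      by (rule exI[of _ "replicate (Poly_Mapping.lookup \<alpha> i) i @ l"])
        (use insert l in \<open>simp add: word_eval_def prod_list_replicate\<close>)
  qed
  from this[of UNIV] show ?thesis by (simp add: monomial_eval_def)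
qed

lemma word_eval_minus: "word_eval l (- z) = (-1) ^ length l * word_eval l z"
  by (induction l) (auto simp: word_eval_def)

lemma word_eval_sat: "odd (length l) \<Longrightarrow> (\<lambda>x. word_eval l (b x)) \<in> (\<Union>n. sat b n)"
proof (induction l rule: induct_list012)
  case (2 i)
  show ?case by (rule UN_I[of 0]) (auto simp: word_eval_def)
next
  case (3 i j l)
  then have "(\<lambda>x. word_eval l (b x) * b x $ i * b x $ j) \<in> (\<Union>n. sat b n)" by (intro sat_step) simp
  then show ?case by (simp add: word_eval_def mult_ac)
qed simp

lemma sat_word_eval: "\<phi> \<in> (\<Union>n. sat b n) \<Longrightarrow> \<exists>l. odd (length l) \<and> \<phi> = (\<lambda>x. word_eval l (b x))"
proof (induction rule: sat_union_induct)
  case (base j)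
  show ?case by (rule exI[of _ "[j]"]) (simp add: word_eval_def)
next
  case (step \<phi> j k)
  then obtain l where "odd (length l)" "\<phi> = (\<lambda>x. word_eval l (b x))" by blast
  then show ?case by (intro exI[of _ "j # k # l"]) (simp add: word_eval_def mult_ac)
qed

text \<open>Elements of the saturation are exactly the words of odd length. Conversely an odd polynomial
  function equals its odd part \<open>(P(z) - P(-z)) / 2\<close>, in which the monomials of even degree cancel.\<close>

theorem sat_inf_eq_odd_polys:
  fixes b :: "torus3 \<Rightarrow> real^'m::finite"
  shows "sat_inf b = {(\<lambda>x. poly_eval P (b x)) | P. P \<in> odd_polys}"
proof (intro equalityI subsetI)
  fix f assume "f \<in> sat_inf b"
  then have "\<exists>P. P \<in> odd_polys \<and> f = (\<lambda>x. poly_eval P (b x))"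
    unfolding sat_inf_def
  proof (induction rule: fun_span_induct)
    case zero
    show ?case by (rule exI[of _ 0]) (simp add: odd_polys_def poly_eval_def)
  next
    case (add c \<phi> g)
    then obtain Q where Q: "Q \<in> odd_polys" "g = (\<lambda>x. poly_eval Q (b x))" by blast
    obtain l where l: "odd (length l)" "\<phi> = (\<lambda>x. word_eval l (b x))" using sat_word_eval[OF add(1)] by blast
    obtain \<alpha> where \<alpha>: "\<forall>z. word_eval l z = monomial_eval \<alpha> z" using word_eval_monomial by blast
    have "monomial_eval \<alpha> (- z) = - monomial_eval \<alpha> z" for z
      using word_eval_minus[of l z] l(1) \<alpha> by simp
    then have "Poly_Mapping.single \<alpha> c + Q \<in> odd_polys"
      using Q(1) by (simp add: odd_polys_def poly_eval_add poly_eval_single)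
    then show ?case
      by (intro exI[of _ "Poly_Mapping.single \<alpha> c + Q"]) (simp add: poly_eval_add poly_eval_single l(2) Q(2) \<alpha>)
  qed
  then show "f \<in> {(\<lambda>x. poly_eval P (b x)) | P. P \<in> odd_polys}" by blast
next
  fix f assume "f \<in> {(\<lambda>x. poly_eval P (b x)) | P. P \<in> odd_polys}"
  then obtain P where P: "P \<in> odd_polys" "f = (\<lambda>x. poly_eval P (b x))" by blast
  let ?K = "Poly_Mapping.keys P"
  have "\<forall>\<alpha>. \<exists>l. \<forall>z. monomial_eval \<alpha> z = word_eval l (z :: real^'m)"
    using monomial_eval_word by blast
  from choice[OF this] obtain l where l: "\<And>\<alpha> z. monomial_eval \<alpha> (z :: real^'m) = word_eval (l \<alpha>) z" by blast
  have "poly_eval P z = (\<Sum>\<alpha>\<in>?K. if odd (length (l \<alpha>)) then Poly_Mapping.lookup P \<alpha> * word_eval (l \<alpha>) z else 0)" for z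
  proof -
    have e: "poly_eval P y = (\<Sum>\<alpha>\<in>?K. Poly_Mapping.lookup P \<alpha> * word_eval (l \<alpha>) y)" for y
      using poly_eval_superset[of ?K P y] by (simp add: l)
    have "poly_eval P z = (poly_eval P z - poly_eval P (- z)) / 2"
      using P(1) by (simp add: odd_polys_def)
    also have "\<dots> = (\<Sum>\<alpha>\<in>?K. (Poly_Mapping.lookup P \<alpha> * word_eval (l \<alpha>) z -
        Poly_Mapping.lookup P \<alpha> * word_eval (l \<alpha>) (- z)) / 2)"
      by (simp add: e sum_subtractf sum_divide_distrib diff_divide_distrib)
    also have "\<dots> = (\<Sum>\<alpha>\<in>?K. if odd (length (l \<alpha>)) then Poly_Mapping.lookup P \<alpha> * word_eval (l \<alpha>) z else 0)"
      by (rule sum.cong) (auto simp: word_eval_minus)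
    finally show ?thesis .
  qed
  then have "f = (\<lambda>x. \<Sum>\<alpha>\<in>?K. if odd (length (l \<alpha>)) then Poly_Mapping.lookup P \<alpha> * word_eval (l \<alpha>) (b x) else 0)"
    by (simp add: P(2))
  also have "\<dots> \<in> sat_inf b"
    unfolding sat_inf_def
  proof (rule fun_span_sum)
    fix \<alpha>
    show "(\<lambda>x. if odd (length (l \<alpha>)) then Poly_Mapping.lookup P \<alpha> * word_eval (l \<alpha>) (b x) else 0) \<in> fun_span (\<Union>n. sat b n)"
    proof (cases "odd (length (l \<alpha>))")
      case True
      from fun_span_cmult[OF fun_span_base[OF word_eval_sat[OF this]]] True show ?thesis by simp
    qed (simp add: fun_span_zero)
  qed
  finally show "f \<in> sat_inf b" .
qed

section \<open>Integration on the torus\<close>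

definition period_box :: "(real^3) set" where
  "period_box = {x. \<forall>i. 0 \<le> x $ i \<and> x $ i < 2 * pi}"

lemma period_box_sets [measurable]: "period_box \<in> sets borel"
proof -
  have "period_box = (\<Inter>i. {x. 0 \<le> x $ i} \<inter> {x. x $ i < 2 * pi})"
    by (auto simp: period_box_def)
  also have "\<dots> \<in> sets borel"
    by (intro sets.finite_INT sets.Int borel_closed borel_open closed_Collect_le open_Collect_less
        continuous_intros) auto
  finally show ?thesis .
qed

lemma proj_measurable [measurable]: "proj \<in> borel_measurable borel"
  by (rule borel_measurable_continuous_onI[OF continuous_on_proj])

lemma torus_measure_eq: "torus_measure = distr (restrict_space lborel period_box) borel proj"
  by (simp add: torus_measure_def period_box_def)

lemma sets_torus_measure [simp, measurable_cong]: "sets torus_measure = sets borel"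
  by (simp add: torus_measure_eq)

lemma space_torus_measure [simp]: "space torus_measure = UNIV"
  by (simp add: torus_measure_eq)

lemma proj_measurable_box [measurable]: "proj \<in> measurable (restrict_space lborel period_box) borel"
  by (rule measurable_restrict_space1) simp

lemma emeasure_period_box: "emeasure lborel period_box < \<infinity>" "emeasure lborel period_box > 0"
proof -
  have "emeasure lborel period_box \<le> emeasure lborel (cbox 0 (\<chi> i. 2 * pi :: real^3))"
    by (rule emeasure_mono) (auto simp: period_box_def mem_box_cart less_imp_le)
  also have "\<dots> < \<infinity>" by (rule emeasure_lborel_cbox_finite)
  finally show "emeasure lborel period_box < \<infinity>" .
  have "emeasure lborel (box 0 (\<chi> i. 2 * pi :: real^3)) \<le> emeasure lborel period_box"
    by (rule emeasure_mono) (auto simp: period_box_def mem_box_cart less_imp_le)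
  moreover have "emeasure lborel (box 0 (\<chi> i. 2 * pi :: real^3)) > 0"
    by (subst emeasure_lborel_box) (auto simp: Basis_vec_def inner_axis less_imp_le intro!: prod_pos)
  ultimately show "emeasure lborel period_box > 0" by (rule less_le_trans[rotated])
qed

lemma emeasure_torus_measure: "emeasure torus_measure UNIV = emeasure lborel period_box"
proof -
  have "emeasure torus_measure UNIV = emeasure (restrict_space lborel period_box) period_box"
    unfolding torus_measure_eq by (subst emeasure_distr) (auto simp: space_restrict_space)
  also have "\<dots> = emeasure lborel period_box" by (subst emeasure_restrict_space) auto
  finally show ?thesis .
qed

interpretation torus: finite_measure torus_measure
  by (rule finite_measureI) (use emeasure_period_box(1) in \<open>simp add: emeasure_torus_measure\<close>)

definition vol :: real where "vol = measure torus_measure UNIV"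

lemma vol_pos: "vol > 0"
  using emeasure_period_box(2) by (simp add: vol_def torus.emeasure_eq_measure flip: emeasure_torus_measure)

lemma borel_measurable_torus_continuous:
  fixes f :: "torus3 \<Rightarrow> real"
  assumes "continuous_on UNIV f"
  shows "f \<in> borel_measurable torus_measure"
  using borel_measurable_continuous_onI[OF assms] by (simp cong: measurable_cong_sets)

lemma integrable_torus_continuous:
  fixes f :: "torus3 \<Rightarrow> real"
  assumes "continuous_on UNIV f"
  shows "integrable torus_measure f"
proof -
  obtain M where "\<And>x. \<bar>f x\<bar> \<le> M" by (rule continuous_torus_bounded[OF assms]) blast
  then show ?thesis
    by (intro torus.integrable_const_bound[of _ M] borel_measurable_torus_continuous assms) auto
qed

lemma integral_torus_box:
  fixes f :: "torus3 \<Rightarrow> real"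
  assumes "f \<in> borel_measurable borel"
  shows "(\<integral>p. f p \<partial>torus_measure) = (\<integral>x. indicator period_box x * f (proj x) \<partial>lborel)"
proof -
  have "(\<integral>p. f p \<partial>torus_measure) = (\<integral>x. f (proj x) \<partial>restrict_space lborel period_box)"
    unfolding torus_measure_eq by (rule integral_distr) (use assms in auto)
  also have "\<dots> = (\<integral>x. indicator period_box x *\<^sub>R f (proj x) \<partial>lborel)"
    by (rule integral_restrict_space) auto
  finally show ?thesis by simp
qed

lemma lborel_integral_shift:
  fixes h :: "real^3 \<Rightarrow> real"
  assumes "h \<in> borel_measurable borel"
  shows "(\<integral>x. h (c + x) \<partial>lborel) = (\<integral>x. h x \<partial>lborel)"
proof -
  have "(\<integral>x. h x \<partial>lborel) = (\<integral>x. h x \<partial>distr lborel borel ((+) c))" by (simp add: lborel_distr_plus)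
  also have "\<dots> = (\<integral>x. h (c + x) \<partial>lborel)" by (rule integral_distr) (use assms in auto)
  finally show ?thesis by simp
qed

text \<open>Cut the translated period box along the plane \<open>x\<^sub>j = 2 \<pi>\<close> and move the part beyond it back by one
  period.\<close>

lemma integral_torus_translate:
  fixes f :: "torus3 \<Rightarrow> real"
  assumes f: "continuous_on UNIV f" and t: "0 \<le> t" "t \<le> 2 * pi"
  shows "(\<integral>x. indicator period_box x * f (proj (x + t *\<^sub>R axis j 1)) \<partial>lborel)
    = (\<integral>x. indicator period_box x * f (proj x) \<partial>lborel)"
proof -
  define F where "F x = f (proj x)" for x
  have Fm [measurable]: "F \<in> borel_measurable borel"
    unfolding F_def using borel_measurable_continuous_onI[OF f] by measurable
  let ?e = "axis j 1 :: real^3"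
  obtain M where M: "\<And>p. \<bar>f p\<bar> \<le> M" by (rule continuous_torus_bounded[OF f]) blast
  have int: "integrable lborel (\<lambda>x. indicator S x * F x)"
    if "S \<in> sets borel" "S \<subseteq> cbox a b" for S a b
  proof (rule Bochner_Integration.integrable_bound)
    show "integrable lborel (\<lambda>x. indicator (cbox a b) x * M)"
      using emeasure_lborel_cbox_finite[of a b] by (intro integrable_mult_left integrable_real_indicator) auto
    show "(\<lambda>x. indicator S x * F x) \<in> borel_measurable lborel" using that(1) by measurable
    show "AE x in lborel. norm (indicator S x * F x) \<le> norm (indicator (cbox a b) x * M)"
      using that(2) M by (intro AE_I2) (auto simp: F_def indicator_def abs_le_iff intro: order_trans[OF _ abs_ge_self])
  qed
  have per: "F ((2 * pi) *\<^sub>R ?e + x) = F x" for x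
  proof -
    have "torus_rel ((2 * pi) *\<^sub>R ?e + x) x"
      unfolding torus_rel_def
    proof
      fix i show "\<exists>n::int. ((2 * pi) *\<^sub>R ?e + x) $ i - x $ i = 2 * pi * of_int n"
        by (rule exI[of _ "if i = j then 1 else 0"]) (simp add: axis_def)
    qed
    then show ?thesis by (simp add: F_def proj_eq_iff[symmetric])
  qed
  \<comment> \<open>Membership in the period box, as far as the directions other than \<open>j\<close> are concerned.\<close>
  define R where "R x \<longleftrightarrow> (\<forall>i. i \<noteq> j \<longrightarrow> 0 \<le> x $ i \<and> x $ i < 2 * pi)" for x :: "real^3"
  have Q: "x \<in> period_box \<longleftrightarrow> R x \<and> 0 \<le> x $ j \<and> x $ j < 2 * pi" for x
    unfolding R_def period_box_def mem_Collect_eq by metis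
  have Rs: "R (- (c *\<^sub>R ?e) + x) \<longleftrightarrow> R x" for c x
    unfolding R_def by (simp add: axis_def)
  have cj: "(- (c *\<^sub>R ?e) + x) $ j = x $ j - c" for c x by simp
  define A where "A = {x\<in>period_box. t \<le> x $ j}"
  define B where "B = {x\<in>period_box. x $ j < t}"
  define B' where "B' = {x. - ((2 * pi) *\<^sub>R ?e) + x \<in> B}"
  have Am [measurable]: "A \<in> sets borel"
  proof -
    have "A = period_box \<inter> {x. t \<le> x $ j}" by (auto simp: A_def)
    also have "\<dots> \<in> sets borel" by (intro sets.Int period_box_sets borel_closed closed_Collect_le continuous_intros)
    finally show ?thesis .
  qed
  have Bm [measurable]: "B \<in> sets borel"
  proof -
    have "B = period_box \<inter> {x. x $ j < t}" by (auto simp: B_def)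
    also have "\<dots> \<in> sets borel" by (intro sets.Int period_box_sets borel_open open_Collect_less continuous_intros)
    finally show ?thesis .
  qed
  have B'm [measurable]: "B' \<in> sets borel"
  proof -
    have "(\<lambda>x. - ((2 * pi) *\<^sub>R ?e) + x) -` B \<inter> space borel \<in> sets borel"
      by (rule measurable_sets[OF _ Bm]) measurable
    then show ?thesis by (simp add: B'_def vimage_def)
  qed
  have shift: "- (t *\<^sub>R ?e) + x \<in> period_box \<longleftrightarrow> x \<in> A \<or> x \<in> B'" for x
    using t unfolding A_def B_def B'_def mem_Collect_eq Q Rs cj by auto
  have disj: "\<not> (x \<in> A \<and> x \<in> B')" for x
    unfolding A_def B_def B'_def mem_Collect_eq Q Rs cj by auto
  have AB: "x \<in> period_box \<longleftrightarrow> x \<in> A \<or> x \<in> B" "\<not> (x \<in> A \<and> x \<in> B)" for x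
    by (auto simp: A_def B_def)
  have sub: "A \<subseteq> cbox 0 (\<chi> i. 4 * pi)" "B \<subseteq> cbox 0 (\<chi> i. 4 * pi)" "B' \<subseteq> cbox 0 (\<chi> i. 4 * pi)"
  proof -
    have "period_box \<subseteq> cbox 0 (\<chi> i. 4 * pi)"
    proof
      fix x assume "x \<in> period_box"
      then have "0 \<le> x $ i \<and> x $ i \<le> 4 * pi" for i
        using pi_gt_zero unfolding period_box_def mem_Collect_eq by (smt (verit))
      then show "x \<in> cbox 0 (\<chi> i. 4 * pi)" by (simp add: mem_box_cart)
    qed
    then show "A \<subseteq> cbox 0 (\<chi> i. 4 * pi)" "B \<subseteq> cbox 0 (\<chi> i. 4 * pi)" by (auto simp: A_def B_def)
    show "B' \<subseteq> cbox 0 (\<chi> i. 4 * pi)"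
    proof
      fix x assume "x \<in> B'"
      then have x: "R x" "0 \<le> x $ j - 2 * pi" "x $ j - 2 * pi < 2 * pi"
        unfolding B'_def B_def mem_Collect_eq Q Rs cj by auto
      have "0 \<le> x $ i \<and> x $ i \<le> 4 * pi" for i
      proof (cases "i = j")
        case True
        then show ?thesis using x(2,3) pi_gt_zero by auto
      next
        case False
        then have "0 \<le> x $ i" "x $ i < 2 * pi" using x(1) by (auto simp: R_def)
        then show ?thesis using pi_gt_zero by linarith
      qed
      then show "x \<in> cbox 0 (\<chi> i. 4 * pi)" by (simp add: mem_box_cart)
    qed
  qed
  note I = int[OF Am sub(1)] int[OF Bm sub(2)] int[OF B'm sub(3)]
  have "(\<integral>x. indicator period_box x * F (x + t *\<^sub>R ?e) \<partial>lborel)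
      = (\<integral>x. indicator period_box (- (t *\<^sub>R ?e) + (t *\<^sub>R ?e + x)) * F (t *\<^sub>R ?e + x) \<partial>lborel)"
    by (simp add: add.commute)
  also have "\<dots> = (\<integral>x. indicator period_box (- (t *\<^sub>R ?e) + x) * F x \<partial>lborel)"
    by (rule lborel_integral_shift[where h = "\<lambda>x. indicator period_box (- (t *\<^sub>R ?e) + x) * F x"]) measurable
  also have "\<dots> = (\<integral>x. indicator A x * F x + indicator B' x * F x \<partial>lborel)"
    by (rule Bochner_Integration.integral_cong) (use shift disj in \<open>auto simp: indicator_def\<close>)
  also have "\<dots> = (\<integral>x. indicator A x * F x \<partial>lborel) + (\<integral>x. indicator B' x * F x \<partial>lborel)"
    by (rule Bochner_Integration.integral_add[OF I(1,3)])
  also have "(\<integral>x. indicator B' x * F x \<partial>lborel) = (\<integral>x. indicator B' ((2 * pi) *\<^sub>R ?e + x) * F ((2 * pi) *\<^sub>R ?e + x) \<partial>lborel)"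
    by (rule lborel_integral_shift[symmetric]) measurable
  also have "\<dots> = (\<integral>x. indicator B x * F x \<partial>lborel)"
    by (simp add: per B'_def indicator_def)
  also have "(\<integral>x. indicator A x * F x \<partial>lborel) + (\<integral>x. indicator B x * F x \<partial>lborel)
      = (\<integral>x. indicator A x * F x + indicator B x * F x \<partial>lborel)"
    by (rule Bochner_Integration.integral_add[OF I(1,2), symmetric])
  also have "\<dots> = (\<integral>x. indicator period_box x * F x \<partial>lborel)"
    by (rule Bochner_Integration.integral_cong) (use AB in \<open>auto simp: indicator_def\<close>)
  finally show ?thesis by (simp add: F_def)
qed

text \<open>Differentiate the translation invariance of the integral at zero. The difference quotients have integral
  zero and converge boundedly to the derivative by the mean value theorem.\<close>

lemma integral_partial_zero:
  fixes f :: "torus3 \<Rightarrow> real"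
  assumes f: "f \<in> Ck (Suc 0)"
  shows "(\<integral>p. partial j f p \<partial>torus_measure) = 0"
proof -
  let ?e = "axis j 1 :: real^3"
  have fc: "continuous_on UNIV f" using f by (rule Ck_continuous)
  have pc: "continuous_on UNIV (partial j f)" using f by simp
  define F where "F = f \<circ> proj"
  have Fd: "F differentiable (at x)" for x using f by (simp add: F_def)
  have pF: "partial j f (proj x) = pd j F x" for x
    using partial_o_proj[of f j] f by (simp add: F_def fun_eq_iff)
  obtain M where M: "\<And>p. \<bar>partial j f p\<bar> \<le> M" by (rule continuous_torus_bounded[OF pc]) blast
  have Fm [measurable]: "F \<in> borel_measurable borel"
    unfolding F_def using borel_measurable_continuous_onI[OF fc] by measurable
  have pm [measurable]: "partial j f \<in> borel_measurable borel"
    by (rule borel_measurable_continuous_onI[OF pc])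
  have der: "((\<lambda>s. F (x + s *\<^sub>R ?e)) has_real_derivative pd j F (x + s *\<^sub>R ?e)) (at s)" for x s
  proof -
    have "((\<lambda>s. x + s *\<^sub>R ?e) has_derivative (\<lambda>h. h *\<^sub>R ?e)) (at s)"
      by (auto intro!: derivative_eq_intros)
    from has_derivative_compose[OF this has_derivative_pd[OF Fd]]
    have "((\<lambda>s. F (x + s *\<^sub>R ?e)) has_derivative
        (\<lambda>h. \<Sum>i\<in>UNIV. (h *\<^sub>R ?e) $ i * pd i F (x + s *\<^sub>R ?e))) (at s)" .
    moreover have "(\<Sum>i\<in>UNIV. (h *\<^sub>R ?e) $ i * c i) = c j * h" for h and c :: "3 \<Rightarrow> real"
      by (simp add: axis_def if_distrib[of "\<lambda>c. c * _"] if_distrib[of "\<lambda>c. _ * c"] cong: if_cong)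
    ultimately show ?thesis by (simp only: has_field_derivative_def)
  qed
  define t where "t n = 1 / real (Suc n)" for n
  have t: "0 < t n" "t n \<le> 1" for n by (auto simp: t_def)
  have t0: "t \<longlonglongrightarrow> 0" unfolding t_def by (rule LIMSEQ_Suc[OF lim_1_over_n])
  define q where "q n x = indicator period_box x * ((F (x + t n *\<^sub>R ?e) - F x) / t n)" for n x
  obtain N where N: "\<And>p. \<bar>f p\<bar> \<le> N" by (rule continuous_torus_bounded[OF fc]) blast
  have Fint: "integrable lborel (\<lambda>x. indicator period_box x * F (x + c))" for c
  proof (rule Bochner_Integration.integrable_bound)
    show "integrable lborel (\<lambda>x. indicator period_box x * N)"
      using emeasure_period_box(1) by (intro integrable_mult_left integrable_real_indicator) auto
    show "AE x in lborel. norm (indicator period_box x * F (x + c)) \<le> norm (indicator period_box x * N)"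
      using N by (intro AE_I2) (auto simp: F_def indicator_def intro: order_trans[OF _ abs_ge_self])
  qed measurable
  have q0: "(\<integral>x. q n x \<partial>lborel) = 0" for n
  proof -
    have "t n \<le> 2 * pi" using t(2)[of n] pi_gt3 by linarith
    have "q n = (\<lambda>x. (indicator period_box x * F (x + t n *\<^sub>R ?e) - indicator period_box x * F (x + 0)) / t n)"
      by (auto simp: q_def algebra_simps diff_divide_distrib)
    then have "(\<integral>x. q n x \<partial>lborel) = ((\<integral>x. indicator period_box x * F (x + t n *\<^sub>R ?e) \<partial>lborel)
        - (\<integral>x. indicator period_box x * F (x + 0) \<partial>lborel)) / t n"
      using Bochner_Integration.integral_diff[OF Fint Fint, of "t n *\<^sub>R ?e" 0] by simp
    also have "\<dots> = 0"
      using integral_torus_translate[OF fc less_imp_le[OF t(1)] \<open>t n \<le> 2 * pi\<close>, of j] by (simp add: F_def)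
    finally show ?thesis .
  qed
  have "(\<lambda>n. \<integral>x. q n x \<partial>lborel) \<longlonglongrightarrow> (\<integral>x. indicator period_box x * pd j F x \<partial>lborel)"
  proof (rule integral_dominated_convergence)
    show "integrable lborel (\<lambda>x. indicator period_box x * M)"
      using emeasure_period_box(1) by (intro integrable_mult_left integrable_real_indicator) auto
    show "(\<lambda>x. indicator period_box x * pd j F x) \<in> borel_measurable lborel"
      unfolding pF[symmetric] by measurable
    show "q n \<in> borel_measurable lborel" for n unfolding q_def by measurable
    show "AE x in lborel. (\<lambda>n. q n x) \<longlonglongrightarrow> indicator period_box x * pd j F x"
    proof (rule AE_I2)
      fix x
      have "((\<lambda>h. (F (x + h *\<^sub>R ?e) - F x) / h) \<longlongrightarrow> pd j F x) (at 0)"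
        using der[of x 0] by (simp add: DERIV_def)
      moreover have "filterlim t (at 0) sequentially"
        using t0 t(1) by (auto simp: filterlim_at less_imp_neq[symmetric] intro: always_eventually)
      ultimately have "(\<lambda>n. (F (x + t n *\<^sub>R ?e) - F x) / t n) \<longlonglongrightarrow> pd j F x"
        by (rule filterlim_compose)
      then show "(\<lambda>n. q n x) \<longlonglongrightarrow> indicator period_box x * pd j F x"
        unfolding q_def by (intro tendsto_intros)
    qed
    fix n
    show "AE x in lborel. norm (q n x) \<le> indicator period_box x * M"
    proof (rule AE_I2)
      fix x
      obtain z where z: "F (x + t n *\<^sub>R ?e) - F (x + 0 *\<^sub>R ?e) = (t n - 0) * pd j F (x + z *\<^sub>R ?e)"
        using MVT2[OF t(1)[of n], of "\<lambda>s. F (x + s *\<^sub>R ?e)" "\<lambda>s. pd j F (x + s *\<^sub>R ?e)"] der by blast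
      have "\<bar>pd j F (x + z *\<^sub>R ?e)\<bar> \<le> M" using M unfolding pF[symmetric] .
      then show "norm (q n x) \<le> indicator period_box x * M"
        using z t(1)[of n] by (simp add: q_def indicator_def)
    qed
  qed
  then have "(\<integral>x. indicator period_box x * pd j F x \<partial>lborel) = 0"
    unfolding q0 using LIMSEQ_unique tendsto_const by blast
  then show ?thesis unfolding integral_torus_box[OF pm] pF .
qed

section \<open>Square-integrable functions on the torus\<close>

abbreviation tint :: "(torus3 \<Rightarrow> real) \<Rightarrow> real" where
  "tint f \<equiv> (\<integral>p. f p \<partial>torus_measure)"

text \<open>The squared \<open>L\<^sup>2\<close> norm. Working with the square replaces the triangle inequality by
  \<open>(a + b)\<^sup>2 \<le> 2 a\<^sup>2 + 2 b\<^sup>2\<close>.\<close>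

definition sqint :: "(torus3 \<Rightarrow> real) \<Rightarrow> real" where
  "sqint f = tint (\<lambda>p. (f p)\<^sup>2)"

lemma L2_measurable: "f \<in> L2 \<Longrightarrow> f \<in> borel_measurable torus_measure"
  by (simp add: L2_def)

lemma L2_integrable_square: "f \<in> L2 \<Longrightarrow> integrable torus_measure (\<lambda>p. (f p)\<^sup>2)"
  by (simp add: L2_def)

lemma L2_mult_integrable:
  assumes "f \<in> L2" "g \<in> L2"
  shows "integrable torus_measure (\<lambda>p. f p * g p)"
proof (rule Bochner_Integration.integrable_bound)
  show "integrable torus_measure (\<lambda>p. (f p)\<^sup>2 + (g p)\<^sup>2)"
    using assms by (intro Bochner_Integration.integrable_add L2_integrable_square)
  show "(\<lambda>p. f p * g p) \<in> borel_measurable torus_measure"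
    using assms by (intro borel_measurable_times L2_measurable)
  have "norm (f p * g p) \<le> norm ((f p)\<^sup>2 + (g p)\<^sup>2)" for p
  proof -
    have "2 * (\<bar>f p\<bar> * \<bar>g p\<bar>) \<le> (f p)\<^sup>2 + (g p)\<^sup>2"
      using sum_squares_bound[of "\<bar>f p\<bar>" "\<bar>g p\<bar>"] by simp
    moreover have "0 \<le> \<bar>f p\<bar> * \<bar>g p\<bar>" by simp
    ultimately show ?thesis unfolding real_norm_def abs_mult by linarith
  qed
  then show "AE p in torus_measure. norm (f p * g p) \<le> norm ((f p)\<^sup>2 + (g p)\<^sup>2)" by simp
qed

lemma L2_add:
  assumes "f \<in> L2" "g \<in> L2"
  shows "(\<lambda>p. f p + g p) \<in> L2"
proof -
  have "integrable torus_measure (\<lambda>p. (f p)\<^sup>2 + 2 * (f p * g p) + (g p)\<^sup>2)"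
    using assms by (intro Bochner_Integration.integrable_add integrable_mult_right L2_integrable_square L2_mult_integrable)
  moreover have "(\<lambda>p. f p + g p) \<in> borel_measurable torus_measure"
    using assms by (intro borel_measurable_add L2_measurable)
  ultimately show ?thesis by (simp add: L2_def power2_sum algebra_simps)
qed

lemma L2_cmult:
  assumes "f \<in> L2"
  shows "(\<lambda>p. c * f p) \<in> L2"
  using assms by (auto simp: L2_def power_mult_distrib)

lemma L2_diff:
  assumes "f \<in> L2" "g \<in> L2"
  shows "(\<lambda>p. f p - g p) \<in> L2"
  using L2_add[OF assms(1) L2_cmult[OF assms(2), of "-1"]] by simp

lemma L2_continuous:
  assumes "continuous_on UNIV f"
  shows "f \<in> L2"
proof -
  have "continuous_on UNIV (\<lambda>p. (f p)\<^sup>2)" using assms by (intro continuous_intros)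
  then show ?thesis
    using assms by (simp add: L2_def borel_measurable_torus_continuous integrable_torus_continuous)
qed

lemma L2_Cinf: "f \<in> Cinf \<Longrightarrow> f \<in> L2"
  by (rule L2_continuous[OF Ck_continuous[OF CinfD[of f 0]]])

lemma sqint_nonneg: "sqint f \<ge> 0"
  by (simp add: sqint_def)

lemma sqint_add_le:
  assumes "f \<in> L2" "g \<in> L2"
  shows "sqint (\<lambda>p. f p + g p) \<le> 2 * sqint f + 2 * sqint g"
proof -
  have "sqint (\<lambda>p. f p + g p) \<le> tint (\<lambda>p. 2 * (f p)\<^sup>2 + 2 * (g p)\<^sup>2)"
    unfolding sqint_def
  proof (rule integral_mono)
    show "integrable torus_measure (\<lambda>p. (f p + g p)\<^sup>2)"
      using L2_integrable_square[OF L2_add[OF assms]] .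
    show "integrable torus_measure (\<lambda>p. 2 * (f p)\<^sup>2 + 2 * (g p)\<^sup>2)"
      using assms by (intro Bochner_Integration.integrable_add integrable_mult_right L2_integrable_square)
    show "(f p + g p)\<^sup>2 \<le> 2 * (f p)\<^sup>2 + 2 * (g p)\<^sup>2" for p
      using zero_le_power2[of "f p - g p"] by (simp add: power2_sum power2_diff)
  qed
  also have "\<dots> = 2 * sqint f + 2 * sqint g"
    unfolding sqint_def using assms
    by (subst Bochner_Integration.integral_add) (auto intro!: integrable_mult_right L2_integrable_square)
  finally show ?thesis .
qed

lemma sqint_diff_le:
  assumes "f \<in> L2" "g \<in> L2" "h \<in> L2"
  shows "sqint (\<lambda>p. f p - h p) \<le> 2 * sqint (\<lambda>p. f p - g p) + 2 * sqint (\<lambda>p. g p - h p)"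
  using sqint_add_le[OF L2_diff[OF assms(1,2)] L2_diff[OF assms(2,3)]] by simp

lemma sqint_cmult: "sqint (\<lambda>p. c * f p) = c\<^sup>2 * sqint f"
  by (simp add: sqint_def power_mult_distrib)

lemma sqint_le_sup:
  assumes "\<And>p. \<bar>f p\<bar> \<le> c"
  shows "sqint f \<le> c\<^sup>2 * vol"
proof (cases "integrable torus_measure (\<lambda>p. (f p)\<^sup>2)")
  case True
  have "(f p)\<^sup>2 \<le> c\<^sup>2" for p using power_mono[OF assms abs_ge_zero, of p 2] by simp
  then have "sqint f \<le> tint (\<lambda>p. c\<^sup>2)"
    unfolding sqint_def by (intro integral_mono True) auto
  then show ?thesis by (simp add: vol_def mult.commute)
next
  case False
  then have "sqint f = 0" by (simp add: sqint_def not_integrable_integral_eq)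
  then show ?thesis using vol_pos by simp
qed

section \<open>Density of the continuous functions in \<open>L\<^sup>2\<close>\<close>

definition L2_approx :: "(torus3 \<Rightarrow> real) set \<Rightarrow> (torus3 \<Rightarrow> real) \<Rightarrow> bool" where
  "L2_approx S f \<longleftrightarrow> f \<in> L2 \<and> (\<forall>\<epsilon>>0. \<exists>g\<in>S. sqint (\<lambda>p. f p - g p) < \<epsilon>)"

lemma L2_approx_trans:
  assumes "f \<in> L2" "\<And>\<epsilon>. \<epsilon> > 0 \<Longrightarrow> \<exists>h. L2_approx S h \<and> sqint (\<lambda>p. f p - h p) < \<epsilon>" "S \<subseteq> L2"
  shows "L2_approx S f"
  unfolding L2_approx_def
proof (intro conjI allI impI)
  fix \<epsilon> :: real assume "\<epsilon> > 0"
  then have e: "\<epsilon> / 4 > 0" by simp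
  obtain h where h: "L2_approx S h" "sqint (\<lambda>p. f p - h p) < \<epsilon> / 4" using assms(2)[OF e] by blast
  obtain g where g: "g \<in> S" "sqint (\<lambda>p. h p - g p) < \<epsilon> / 4" using h(1) e unfolding L2_approx_def by blast
  have "h \<in> L2" using h(1) by (simp add: L2_approx_def)
  from sqint_diff_le[OF assms(1) this, of g] g h assms(3)
  have "sqint (\<lambda>p. f p - g p) < \<epsilon>" by auto
  then show "\<exists>g\<in>S. sqint (\<lambda>p. f p - g p) < \<epsilon>" using g(1) by blast
qed (rule assms(1))

abbreviation cont_funs :: "(torus3 \<Rightarrow> real) set" where
  "cont_funs \<equiv> {g. continuous_on UNIV g}"

lemma cont_funs_L2: "cont_funs \<subseteq> L2"
  using L2_continuous by blast

lemma L2_approx_cont_add: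
  assumes "L2_approx cont_funs f" "L2_approx cont_funs g"
  shows "L2_approx cont_funs (\<lambda>p. f p + g p)"
  unfolding L2_approx_def
proof (intro conjI allI impI)
  have fg: "f \<in> L2" "g \<in> L2" using assms by (simp_all add: L2_approx_def)
  then show "(\<lambda>p. f p + g p) \<in> L2" by (rule L2_add)
  fix \<epsilon> :: real assume "\<epsilon> > 0"
  then have e: "\<epsilon> / 4 > 0" by simp
  obtain f' where f': "continuous_on UNIV f'" "sqint (\<lambda>p. f p - f' p) < \<epsilon> / 4"
    using assms(1) e unfolding L2_approx_def by blast
  obtain g' where g': "continuous_on UNIV g'" "sqint (\<lambda>p. g p - g' p) < \<epsilon> / 4"
    using assms(2) e unfolding L2_approx_def by blast
  have "sqint (\<lambda>p. (f p - f' p) + (g p - g' p)) < \<epsilon>"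
    using sqint_add_le[OF L2_diff[OF fg(1) L2_continuous[OF f'(1)]] L2_diff[OF fg(2) L2_continuous[OF g'(1)]]] f' g'
    by simp
  then have "sqint (\<lambda>p. f p + g p - (f' p + g' p)) < \<epsilon>" by (simp add: algebra_simps)
  moreover have "continuous_on UNIV (\<lambda>p. f' p + g' p)" using f' g' by (intro continuous_intros)
  ultimately show "\<exists>h\<in>cont_funs. sqint (\<lambda>p. f p + g p - h p) < \<epsilon>"
    by (intro bexI[of _ "\<lambda>p. f' p + g' p"]) auto
qed

lemma L2_approx_cont_cmult:
  assumes "L2_approx cont_funs f"
  shows "L2_approx cont_funs (\<lambda>p. c * f p)"
  unfolding L2_approx_def
proof (intro conjI allI impI)
  show "(\<lambda>p. c * f p) \<in> L2" using assms by (simp add: L2_approx_def L2_cmult)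
  fix \<epsilon> :: real assume "\<epsilon> > 0"
  then have e: "\<epsilon> / (c\<^sup>2 + 1) > 0" by (intro divide_pos_pos) (auto simp: add_nonneg_pos)
  obtain f' where f': "continuous_on UNIV f'" "sqint (\<lambda>p. f p - f' p) < \<epsilon> / (c\<^sup>2 + 1)"
    using assms(1) e unfolding L2_approx_def by blast
  have "sqint (\<lambda>p. c * f p - c * f' p) = c\<^sup>2 * sqint (\<lambda>p. f p - f' p)"
    using sqint_cmult[of c "\<lambda>p. f p - f' p"] by (simp add: right_diff_distrib)
  also have "\<dots> \<le> c\<^sup>2 * (\<epsilon> / (c\<^sup>2 + 1))" using f'(2) by (intro mult_left_mono) auto
  also have "\<dots> < \<epsilon>" using \<open>\<epsilon> > 0\<close> by (simp add: divide_simps add_nonneg_pos)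
  finally have "sqint (\<lambda>p. c * f p - c * f' p) < \<epsilon>" .
  moreover have "continuous_on UNIV (\<lambda>p. c * f' p)" using f' by (intro continuous_intros)
  ultimately show "\<exists>h\<in>cont_funs. sqint (\<lambda>p. c * f p - h p) < \<epsilon>"
    by (intro bexI[of _ "\<lambda>p. c * f' p"]) auto
qed

lemma L2_approx_cont_self: "continuous_on UNIV f \<Longrightarrow> L2_approx cont_funs f"
  unfolding L2_approx_def using L2_continuous by (auto intro!: bexI[of _ f] simp: sqint_def)

lemma L2_approx_cont_sum:
  "(\<And>i. i \<in> A \<Longrightarrow> L2_approx cont_funs (f i)) \<Longrightarrow> L2_approx cont_funs (\<lambda>p. \<Sum>i\<in>A. f i p)"
  by (induction A rule: infinite_finite_induct) (auto intro: L2_approx_cont_add L2_approx_cont_self)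

text \<open>Dominated convergence; the way from open sets to measurable sets and from step functions to \<open>L\<^sup>2\<close>.\<close>

lemma L2_approx_cont_limit:
  assumes s: "\<And>n. L2_approx cont_funs (s n)" and lim: "\<And>p. (\<lambda>n. s n p) \<longlonglongrightarrow> f p"
    and w: "w \<in> L2" "\<And>n p. \<bar>s n p\<bar> \<le> w p"
  shows "L2_approx cont_funs f"
proof (rule L2_approx_trans[OF _ _ cont_funs_L2])
  have sL: "s n \<in> L2" for n using s by (simp add: L2_approx_def)
  have fw: "\<bar>f p\<bar> \<le> w p" for p
    by (rule LIMSEQ_le_const2[OF tendsto_rabs[OF lim]]) (use w(2) in auto)
  have fm: "f \<in> borel_measurable torus_measure"
    by (rule borel_measurable_LIMSEQ_real[OF lim]) (use sL L2_measurable in auto)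
  have sq: "x\<^sup>2 \<le> (w p)\<^sup>2" if "\<bar>x\<bar> \<le> w p" for x p
    using power_mono[OF that abs_ge_zero, of 2] by simp
  have w2: "integrable torus_measure (\<lambda>p. (w p)\<^sup>2)" using w(1) by (rule L2_integrable_square)
  have "integrable torus_measure (\<lambda>p. (f p)\<^sup>2)"
    by (rule Bochner_Integration.integrable_bound[OF w2]) (use fm sq[OF fw] in auto)
  then show fL: "f \<in> L2" using fm by (simp add: L2_def)
  fix \<epsilon> :: real assume "\<epsilon> > 0"
  have "(\<lambda>n. sqint (\<lambda>p. f p - s n p)) \<longlonglongrightarrow> tint (\<lambda>p. 0)"
    unfolding sqint_def
  proof (rule integral_dominated_convergence)
    show "integrable torus_measure (\<lambda>p. 4 * (w p)\<^sup>2)" using w2 by simp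
    show "(\<lambda>p. (f p - s n p)\<^sup>2) \<in> borel_measurable torus_measure" for n
      using fm L2_measurable[OF sL] by measurable
    show "AE p in torus_measure. (\<lambda>n. (f p - s n p)\<^sup>2) \<longlonglongrightarrow> 0"
    proof (rule AE_I2)
      fix p show "(\<lambda>n. (f p - s n p)\<^sup>2) \<longlonglongrightarrow> 0"
        using tendsto_power[OF tendsto_diff[OF tendsto_const[of "f p"] lim[of p]], of 2] by simp
    qed
    show "AE p in torus_measure. norm ((f p - s n p)\<^sup>2) \<le> 4 * (w p)\<^sup>2" for n
    proof (rule AE_I2)
      fix p
      have "\<bar>f p - s n p\<bar> \<le> 2 * w p" using fw[of p] w(2)[of n p] by linarith
      from power_mono[OF this abs_ge_zero, of 2] show "norm ((f p - s n p)\<^sup>2) \<le> 4 * (w p)\<^sup>2"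
        by (simp add: power_mult_distrib)
    qed
  qed auto
  then have "(\<lambda>n. sqint (\<lambda>p. f p - s n p)) \<longlonglongrightarrow> 0" by simp
  from order_tendstoD(2)[OF this \<open>\<epsilon> > 0\<close>] obtain n where "sqint (\<lambda>p. f p - s n p) < \<epsilon>"
    by (auto simp: eventually_sequentially)
  then show "\<exists>h. L2_approx cont_funs h \<and> sqint (\<lambda>p. f p - h p) < \<epsilon>" using s by blast
qed

text \<open>The distance to a periodic set is periodic. It replaces a metric on the torus.\<close>

lemma infdist_proj_continuous:
  assumes "C = proj -` K" "C \<noteq> {}"
  obtains d where "continuous_on UNIV d" "\<And>x. d (proj x) = infdist x C"
proof -
  have inv: "infdist x C \<le> infdist y C" if "torus_rel x y" for x y
  proof -
    have "infdist x C \<le> dist y a" if a: "a \<in> C" for a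
    proof -
      have "torus_rel (a + (x - y)) a" using \<open>torus_rel x y\<close> by (simp add: torus_rel_def)
      then have "proj (a + (x - y)) = proj a" by (simp add: proj_eq_iff)
      then have "a + (x - y) \<in> C" using a assms(1) by simp
      from infdist_le[OF this, of x] show ?thesis by (simp add: dist_norm)
    qed
    then show ?thesis unfolding infdist_notempty[OF assms(2), of y] by (intro cINF_greatest assms(2))
  qed
  define d where "d p = infdist (rep_torus3 p) C" for p
  have "d (proj x) = infdist x C" for x
  proof (rule antisym)
    have r: "torus_rel (rep_torus3 (proj x)) x" by (rule torus_rel_rep_proj)
    then show "d (proj x) \<le> infdist x C" unfolding d_def by (rule inv)
    have "torus_rel x (rep_torus3 (proj x))" using r equivp_symp[OF torus_rel_equivp] by blast
    then show "infdist x C \<le> d (proj x)" unfolding d_def by (rule inv)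
  qed
  moreover from this have "d \<circ> proj = (\<lambda>x. infdist x C)" by auto
  then have "continuous_on UNIV d"
    unfolding continuous_on_torus_iff by (simp add: continuous_on_infdist)
  ultimately show ?thesis using that by blast
qed

text \<open>The functions \<open>min 1 (n d)\<close>, with \<open>d\<close> the distance to the complement, increase to the indicator.\<close>

lemma L2_approx_cont_open:
  assumes "open U"
  shows "L2_approx cont_funs (indicator U)"
proof (cases "U = UNIV")
  case True
  then show ?thesis by (intro L2_approx_cont_self) simp
next
  case False
  define C where "C = proj -` (- U)"
  have C: "closed C" using assms unfolding C_def open_torus3_def by (simp add: vimage_Compl closed_Compl)
  obtain p0 where "p0 \<notin> U" using False by blast
  then have "C \<noteq> {}" unfolding C_def using proj_rep[of p0] by (auto intro!: exI[of _ "rep_torus3 p0"])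
  then obtain d where d: "continuous_on UNIV d" "\<And>x. d (proj x) = infdist x C"
    using infdist_proj_continuous[OF C_def] by blast
  have d0: "d p \<ge> 0" "d p = 0 \<longleftrightarrow> p \<notin> U" for p
  proof -
    obtain x where p: "p = proj x" using proj_surj by blast
    show "d p \<ge> 0" by (simp add: p d(2) infdist_nonneg)
    have "d p = 0 \<longleftrightarrow> x \<in> C" using in_closed_iff_infdist_zero[OF C \<open>C \<noteq> {}\<close>] by (simp add: p d(2))
    then show "d p = 0 \<longleftrightarrow> p \<notin> U" by (simp add: C_def p)
  qed
  show ?thesis
  proof (rule L2_approx_cont_limit)
    show "L2_approx cont_funs (\<lambda>p. min 1 (real n * d p))" for n
      by (intro L2_approx_cont_self continuous_intros d(1))
    show "(\<lambda>p. 1) \<in> L2" by (rule L2_continuous) simp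
    show "\<bar>min 1 (real n * d p)\<bar> \<le> 1" for n p using mult_nonneg_nonneg[OF of_nat_0_le_iff d0(1), of n p] by (simp add: abs_if min_def)
    show "(\<lambda>n. min 1 (real n * d p)) \<longlonglongrightarrow> indicator U p" for p
    proof (cases "p \<in> U")
      case True
      then have "d p \<noteq> 0" using d0(2) by blast
      then have pos: "d p > 0" using d0(1)[of p] by linarith
      obtain N :: nat where N: "1 / d p < real N" using reals_Archimedean2[of "1 / d p"] ..
      have "min 1 (real n * d p) = 1" if "n \<ge> N" for n
      proof -
        have "1 / d p \<le> real n" using N that by linarith
        then show ?thesis using pos by (simp add: field_simps)
      qed
      then have "\<forall>\<^sub>F n in sequentially. min 1 (real n * d p) = indicator U p"
        using True by (auto simp: eventually_sequentially)
      then show ?thesis by (rule tendsto_eventually)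
    next
      case False
      then have "d p = 0" using d0(2) by blast
      then show ?thesis using False by simp
    qed
  qed
qed

lemma L2_approx_cont_indicator:
  assumes "A \<in> sets borel"
  shows "L2_approx cont_funs (indicator A)"
proof -
  have A: "A \<in> sigma_sets UNIV {U :: torus3 set. open U}" using assms by (simp add: borel_def)
  have I: "Int_stable {U :: torus3 set. open U}" by (auto intro: Int_stableI)
  have G: "{U :: torus3 set. open U} \<subseteq> Pow UNIV" by simp
  from I G A show ?thesis
  proof (induction rule: sigma_sets_induct_disjoint)
    case (basic A)
    then show ?case by (intro L2_approx_cont_open) simp
  next
    case empty
    show ?case by (intro L2_approx_cont_self) simp
  next
    case (compl A)
    have "L2_approx cont_funs (\<lambda>p. 1 + (-1) * indicator A p)"
      by (intro L2_approx_cont_add L2_approx_cont_cmult compl L2_approx_cont_self) simp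
    moreover have "(\<lambda>p. 1 + (-1) * indicator A p) = (indicator (UNIV - A) :: torus3 \<Rightarrow> real)"
      by (auto simp: indicator_def)
    ultimately show ?case by simp
  next
    case (union A)
    show ?case
    proof (rule L2_approx_cont_limit)
      show "L2_approx cont_funs (\<lambda>p. \<Sum>i<n. indicator (A i) p)" for n
        by (intro L2_approx_cont_sum union)
      have dis: "(\<Sum>i<n. indicator (A i) p) = (indicator (\<Union>i<n. A i) p :: real)" for n p
        using union(1) by (intro indicator_UN_disjoint[symmetric]) (auto intro: disjoint_family_on_mono)
      show "(\<lambda>n. \<Sum>i<n. indicator (A i) p) \<longlonglongrightarrow> (indicator (\<Union> (range A)) p :: real)" for p
        unfolding dis by (rule LIMSEQ_indicator_UN)
      show "(\<lambda>p. 1) \<in> L2" by (rule L2_continuous) simp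
      show "\<bar>\<Sum>i<n. indicator (A i) p\<bar> \<le> (1::real)" for n p unfolding dis by (simp add: indicator_def)
    qed
  qed
qed

text \<open>Indicators of measurable sets are reached by induction over the Borel sets, then step functions by
  linearity, and general functions as dominated limits of step functions.\<close>

theorem continuous_dense_L2:
  assumes "f \<in> L2"
  shows "L2_approx cont_funs f"
proof -
  from borel_measurable_implies_sequence_metric[OF L2_measurable[OF assms], of 0]
  obtain s where "\<forall>i. simple_function torus_measure (s i)"
    and "\<forall>x\<in>space torus_measure. (\<lambda>i. s i x) \<longlonglongrightarrow> f x"
    and "\<forall>i. \<forall>x\<in>space torus_measure. dist (s i x) 0 \<le> 2 * dist (f x) 0"
    by (elim exE conjE)
  then have s: "\<And>i. simple_function torus_measure (s i)" "\<And>x. (\<lambda>i. s i x) \<longlonglongrightarrow> f x"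
    "\<And>i x. \<bar>s i x\<bar> \<le> 2 * \<bar>f x\<bar>"
    by simp_all
  show ?thesis
  proof (rule L2_approx_cont_limit)
    show "L2_approx cont_funs (s n)" for n
    proof -
      have e: "s n p = (\<Sum>y\<in>range (s n). y * indicator (s n -` {y}) p)" for p
      proof -
        have "s n p = (\<Sum>y\<in>range (s n). indicator (s n -` {y}) p * y)"
        proof -
          have "p \<in> space torus_measure" by simp
          from simple_function_indicator_representation_banach[OF s(1)[of n] this]
          show ?thesis unfolding space_torus_measure Int_UNIV_right real_scaleR_def .
        qed
        also have "\<dots> = (\<Sum>y\<in>range (s n). y * indicator (s n -` {y}) p)"
          by (rule sum.cong[OF refl mult.commute])
        finally show ?thesis .
      qed
      have "L2_approx cont_funs (\<lambda>p. \<Sum>y\<in>range (s n). y * indicator (s n -` {y}) p)"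
      proof (intro L2_approx_cont_sum L2_approx_cont_cmult L2_approx_cont_indicator)
        fix y show "s n -` {y} \<in> sets borel"
          using simple_functionD(2)[OF s(1)[of n], of "{y}"] by simp
      qed
      moreover have "s n = (\<lambda>p. \<Sum>y\<in>range (s n). y * indicator (s n -` {y}) p)" by (rule ext) (rule e)
      ultimately show ?thesis by (rule ssubst[rotated])
    qed
    show "(\<lambda>i. s i p) \<longlonglongrightarrow> f p" for p by (rule s(2))
    show "(\<lambda>p. 2 * \<bar>f p\<bar>) \<in> L2"
      using assms by (intro L2_cmult) (auto simp: L2_def)
    show "\<bar>s n p\<bar> \<le> 2 * \<bar>f p\<bar>" for n p by (rule s(3))
  qed
qed

section \<open>Weak derivatives\<close>

lemma partial_proj_eq_pd:
  fixes f :: "torus3 \<Rightarrow> real"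
  assumes "f \<in> Ck (Suc k)"
  shows "partial j f (proj x) = pd j (f \<circ> proj) x"
  using partial_o_proj[of f j] assms by (metis (no_types, lifting) Ck.simps(2) comp_apply mem_Collect_eq)

lemma partial_mult:
  fixes f g :: "torus3 \<Rightarrow> real"
  assumes "f \<in> Ck (Suc 0)" "g \<in> Ck (Suc 0)"
  shows "partial j (\<lambda>p. f p * g p) p = partial j f p * g p + f p * partial j g p"
proof -
  obtain x where p: "p = proj x" using proj_surj by blast
  have d: "(f \<circ> proj) differentiable (at x)" "(g \<circ> proj) differentiable (at x)" using assms by simp_all
  have "(\<lambda>p. f p * g p) \<circ> proj = (\<lambda>x. (f \<circ> proj) x * (g \<circ> proj) x)" by auto
  then have "partial j (\<lambda>p. f p * g p) p = pd j (\<lambda>x. (f \<circ> proj) x * (g \<circ> proj) x) x"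
    using partial_proj_eq_pd[OF Ck_mult[OF assms], of j x] by (simp add: p)
  also have "\<dots> = partial j f p * g p + f p * partial j g p"
    unfolding pd_mult[OF d] p partial_proj_eq_pd[OF assms(1)] partial_proj_eq_pd[OF assms(2)] by simp
  finally show ?thesis .
qed

lemma partial_add:
  fixes f g :: "torus3 \<Rightarrow> real"
  assumes "f \<in> Ck (Suc 0)" "g \<in> Ck (Suc 0)"
  shows "partial j (\<lambda>p. f p + g p) p = partial j f p + partial j g p"
proof -
  obtain x where p: "p = proj x" using proj_surj by blast
  have d: "(f \<circ> proj) differentiable (at x)" "(g \<circ> proj) differentiable (at x)" using assms by simp_all
  have "(\<lambda>p. f p + g p) \<circ> proj = (\<lambda>x. (f \<circ> proj) x + (g \<circ> proj) x)" by auto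
  then have "partial j (\<lambda>p. f p + g p) p = pd j (\<lambda>x. (f \<circ> proj) x + (g \<circ> proj) x) x"
    using partial_proj_eq_pd[OF Ck_add[OF assms], of j x] by (simp add: p)
  also have "\<dots> = partial j f p + partial j g p"
    unfolding pd_add[OF d] p partial_proj_eq_pd[OF assms(1)] partial_proj_eq_pd[OF assms(2)] by simp
  finally show ?thesis .
qed

lemma partial_const: "partial j (\<lambda>p. c :: real) p = 0"
  unfolding partial_def by (simp add: o_def)

lemma partial_cmult:
  fixes f :: "torus3 \<Rightarrow> real"
  assumes "f \<in> Ck (Suc 0)"
  shows "partial j (\<lambda>p. c * f p) p = c * partial j f p"
  using partial_mult[OF Ck_const assms, of j c p] by (simp add: partial_const)

lemma partial_sum:
  fixes f :: "'i \<Rightarrow> torus3 \<Rightarrow> real"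
  assumes "\<And>i. i \<in> A \<Longrightarrow> f i \<in> Ck (Suc 0)"
  shows "partial j (\<lambda>p. \<Sum>i\<in>A. f i p) p = (\<Sum>i\<in>A. partial j (f i) p)"
  using assms
proof (induction A rule: infinite_finite_induct)
  case (insert i A)
  have "(\<lambda>p. \<Sum>i\<in>A. f i p) \<in> Ck (Suc 0)" using insert.prems by (intro Ck_sum) blast
  moreover have "f i \<in> Ck (Suc 0)" using insert.prems by blast
  ultimately have "partial j (\<lambda>p. f i p + (\<Sum>i\<in>A. f i p)) p = partial j (f i) p + partial j (\<lambda>p. \<Sum>i\<in>A. f i p) p"
    by (intro partial_add)
  then show ?case using insert by (simp del: Ck.simps)
qed (simp_all add: partial_const)

text \<open>Integration by parts: the derivative of \<open>u \<phi>\<close> has integral zero.\<close>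

lemma weak_partial_classical:
  assumes "u \<in> Cinf"
  shows "weak_partial j u (partial j u)"
  unfolding weak_partial_def
proof
  fix \<phi> :: "torus3 \<Rightarrow> real" assume \<phi>: "\<phi> \<in> Cinf"
  have C: "u \<in> Ck (Suc 0)" "\<phi> \<in> Ck (Suc 0)" by (rule CinfD[OF assms], rule CinfD[OF \<phi>])
  have L: "partial j u \<in> L2" "\<phi> \<in> L2" "u \<in> L2" "partial j \<phi> \<in> L2"
    using assms \<phi> Cinf_partial L2_Cinf by blast+
  have "0 = tint (partial j (\<lambda>p. u p * \<phi> p))" by (rule integral_partial_zero[OF Ck_mult[OF C], symmetric])
  also have "\<dots> = tint (\<lambda>p. partial j u p * \<phi> p + u p * partial j \<phi> p)"
    by (simp only: partial_mult[OF C])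
  also have "\<dots> = tint (\<lambda>p. partial j u p * \<phi> p) + tint (\<lambda>p. u p * partial j \<phi> p)"
    by (rule Bochner_Integration.integral_add[OF L2_mult_integrable[OF L(1,2)] L2_mult_integrable[OF L(3,4)]])
  finally show "tint (\<lambda>p. u p * partial j \<phi> p) = - tint (\<lambda>p. partial j u p * \<phi> p)" by simp
qed

lemma weak_partial_diff:
  assumes "weak_partial j f g" "weak_partial j f' g'" "f \<in> L2" "g \<in> L2" "f' \<in> L2" "g' \<in> L2"
  shows "weak_partial j (\<lambda>p. f p - f' p) (\<lambda>p. g p - g' p)"
  unfolding weak_partial_def
proof
  fix \<phi> :: "torus3 \<Rightarrow> real" assume \<phi>: "\<phi> \<in> Cinf"
  have L: "\<phi> \<in> L2" "partial j \<phi> \<in> L2" using \<phi> Cinf_partial L2_Cinf by blast+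
  have "tint (\<lambda>p. (f p - f' p) * partial j \<phi> p) = tint (\<lambda>p. f p * partial j \<phi> p) - tint (\<lambda>p. f' p * partial j \<phi> p)"
    unfolding left_diff_distrib
    by (rule Bochner_Integration.integral_diff[OF L2_mult_integrable[OF assms(3) L(2)] L2_mult_integrable[OF assms(5) L(2)]])
  also have "\<dots> = - (tint (\<lambda>p. g p * \<phi> p) - tint (\<lambda>p. g' p * \<phi> p))"
    using assms(1,2) \<phi> by (simp add: weak_partial_def)
  also have "\<dots> = - tint (\<lambda>p. (g p - g' p) * \<phi> p)"
    unfolding left_diff_distrib
    by (simp add: Bochner_Integration.integral_diff[OF L2_mult_integrable[OF assms(4) L(1)] L2_mult_integrable[OF assms(6) L(1)]])
  finally show "tint (\<lambda>p. (f p - f' p) * partial j \<phi> p) = - tint (\<lambda>p. (g p - g' p) * \<phi> p)" .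
qed

lemma Cinf_H1: "u \<in> Cinf \<Longrightarrow> u \<in> H1"
  unfolding H1_def using weak_partial_classical L2_Cinf Cinf_partial by blast

section \<open>Fourier sums\<close>

abbreviation ccos :: "(3 \<Rightarrow> int) \<Rightarrow> torus3 \<Rightarrow> real" where
  "ccos m \<equiv> trig m 0"

abbreviation csin :: "(3 \<Rightarrow> int) \<Rightarrow> torus3 \<Rightarrow> real" where
  "csin m \<equiv> trig m (- (pi / 2))"

lemma freq_dot_diff: "freq_dot (\<lambda>i. m i - n i) x = freq_dot m x - freq_dot n x"
  by (simp add: freq_dot_def left_diff_distrib sum_subtractf)

lemma freq_dot_add: "freq_dot (\<lambda>i. m i + n i) x = freq_dot m x + freq_dot n x"
  by (simp add: freq_dot_def distrib_right sum.distrib)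

lemma freq_dot_minus: "freq_dot (\<lambda>i. - m i) x = - freq_dot m x"
  by (simp add: freq_dot_def sum_negf)

lemma trig_mult:
  "trig m c p * trig n d p =
    (trig (\<lambda>i. m i - n i) (c - d) p + trig (\<lambda>i. m i + n i) (c + d) p) / 2"
proof -
  obtain x where p: "p = proj x" using proj_surj by blast
  show ?thesis
    unfolding p trig_proj freq_dot_diff freq_dot_add cos_times_cos by (simp add: algebra_simps)
qed

lemma trig_expand: "trig m c p = cos c * ccos m p - sin c * csin m p"
proof -
  obtain x where p: "p = proj x" using proj_surj by blast
  have "cos (freq_dot m x - pi / 2) = sin (freq_dot m x)"
    by (simp add: cos_diff)
  then show ?thesis unfolding p trig_proj by (simp add: cos_add mult.commute)
qed

lemma trig_uminus: "ccos (\<lambda>i. - m i) = ccos m" "csin (\<lambda>i. - m i) = (\<lambda>p. - csin m p)"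
proof -
  have "ccos (\<lambda>i. - m i) p = ccos m p \<and> csin (\<lambda>i. - m i) p = - csin m p" for p
  proof -
    obtain x where p: "p = proj x" using proj_surj by blast
    show ?thesis unfolding p trig_proj freq_dot_minus by (simp add: cos_diff)
  qed
  then show "ccos (\<lambda>i. - m i) = ccos m" "csin (\<lambda>i. - m i) = (\<lambda>p. - csin m p)" by auto
qed

lemma partial_ccos: "partial j (ccos m) p = - of_int (m j) * csin m p"
  unfolding partial_trig trig_expand[of m "0 + pi / 2"] by simp

lemma partial_csin: "partial j (csin m) p = of_int (m j) * ccos m p"
  unfolding partial_trig by simp

text \<open>A trigonometric function of nonzero frequency is a partial derivative.\<close>

lemma tint_trig: "tint (trig m c) = (if m = (\<lambda>i. 0) then cos c * vol else 0)"
proof (cases "m = (\<lambda>i. 0)")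
  case True
  have "trig m c p = cos c" for p by (simp add: True trig_def freq_dot_def)
  then have "tint (trig m c) = tint (\<lambda>p. cos c)" by simp
  then show ?thesis using True by (simp add: vol_def mult.commute)
next
  case False
  then obtain j where j: "m j \<noteq> 0" by auto
  have "partial j (trig m (c - pi / 2)) = (\<lambda>p. of_int (m j) * trig m c p)"
    by (simp add: partial_trig)
  moreover have "tint (partial j (trig m (c - pi / 2))) = 0"
    by (rule integral_partial_zero[OF CinfD[OF trig_Cinf]])
  ultimately have "of_int (m j) * tint (trig m c) = 0" by simp
  then show ?thesis using j False by simp
qed

lemma tint_trig_mult:
  "tint (\<lambda>p. trig m c p * trig n d p) =
    ((if m = n then cos (c - d) * vol else 0) + (if m = (\<lambda>i. - n i) then cos (c + d) * vol else 0)) / 2"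
proof -
  have I: "integrable torus_measure (trig m c)" for m c
    by (rule integrable_torus_continuous[OF Ck_continuous[OF CinfD[OF trig_Cinf, of m c 0]]])
  have "(\<lambda>i. m i - n i) = (\<lambda>i. 0) \<longleftrightarrow> m = n" "(\<lambda>i. m i + n i) = (\<lambda>i. 0) \<longleftrightarrow> m = (\<lambda>i. - n i)"
    by (auto simp: fun_eq_iff eq_neg_iff_add_eq_0)
  then show ?thesis
    unfolding trig_mult by (simp add: tint_trig Bochner_Integration.integral_add[OF I I] del: One_nat_def)
qed

text \<open>The real form of \<open>\<Sum>\<^sub>m\<^sub>\<in>\<^sub>M c\<^sub>m(f) e\<^sup>i\<^sup>m\<^sup>x\<close>. For \<open>M\<close> symmetric it is the orthogonal projection of \<open>f\<close> to
  the span of these waves, each pair \<open>m, -m\<close> being counted twice with half the weight.\<close>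

definition fourier_sum :: "(3 \<Rightarrow> int) set \<Rightarrow> (torus3 \<Rightarrow> real) \<Rightarrow> torus3 \<Rightarrow> real" where
  "fourier_sum M f p =
    (\<Sum>m\<in>M. (tint (\<lambda>q. f q * ccos m q) * ccos m p + tint (\<lambda>q. f q * csin m q) * csin m p) / vol)"

lemma fourier_sum_Cinf: "fourier_sum M f \<in> Cinf"
proof -
  have "(\<lambda>p. \<Sum>m\<in>M. (1 / vol) * (tint (\<lambda>q. f q * ccos m q) * ccos m p + tint (\<lambda>q. f q * csin m q) * csin m p)) \<in> Cinf"
    by (intro Cinf_sum Cinf_mult Cinf_add Cinf_const trig_Cinf)
  then show ?thesis by (simp add: fourier_sum_def[abs_def])
qed

text \<open>The weak derivative, tested against sines and cosines, multiplies the Fourier coefficients just as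
  differentiation of the partial sum does.\<close>

lemma partial_fourier_sum:
  assumes "weak_partial j f g"
  shows "partial j (fourier_sum M f) = fourier_sum M g"
proof
  fix p
  define A where "A m = tint (\<lambda>q. f q * ccos m q)" for m
  define B where "B m = tint (\<lambda>q. f q * csin m q)" for m
  have gA: "tint (\<lambda>q. g q * ccos m q) = of_int (m j) * B m" for m
  proof -
    have "tint (\<lambda>q. f q * partial j (ccos m) q) = - tint (\<lambda>q. g q * ccos m q)"
      using assms trig_Cinf by (simp add: weak_partial_def)
    moreover have "(\<lambda>q. f q * partial j (ccos m) q) = (\<lambda>q. - of_int (m j) * (f q * csin m q))"
      by (simp add: partial_ccos mult_ac)
    ultimately show ?thesis by (simp add: B_def)
  qed
  have gB: "tint (\<lambda>q. g q * csin m q) = - of_int (m j) * A m" for m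
  proof -
    have "tint (\<lambda>q. f q * partial j (csin m) q) = - tint (\<lambda>q. g q * csin m q)"
      using assms trig_Cinf by (simp add: weak_partial_def)
    moreover have "(\<lambda>q. f q * partial j (csin m) q) = (\<lambda>q. of_int (m j) * (f q * ccos m q))"
      by (simp add: partial_csin mult_ac)
    ultimately show ?thesis by (simp add: A_def)
  qed
  have C: "trig m c \<in> Ck (Suc 0)" for m c by (rule CinfD[OF trig_Cinf])
  have C2: "(\<lambda>p. a * trig m c p) \<in> Ck (Suc 0)" for a m c by (rule Ck_mult[OF Ck_const C])
  have C3: "(\<lambda>p. A m * ccos m p + B m * csin m p) \<in> Ck (Suc 0)" for m by (rule Ck_add[OF C2 C2])
  have C4: "(\<lambda>p. 1 / vol * (A m * ccos m p + B m * csin m p)) \<in> Ck (Suc 0)" for m by (rule Ck_mult[OF Ck_const C3])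
  have "fourier_sum M f = (\<lambda>p. \<Sum>m\<in>M. 1 / vol * (A m * ccos m p + B m * csin m p))"
    by (simp add: fourier_sum_def[abs_def] A_def B_def)
  then have "partial j (fourier_sum M f) p = (\<Sum>m\<in>M. 1 / vol * (A m * (- of_int (m j) * csin m p) + B m * (of_int (m j) * ccos m p)))"
    by (simp only: partial_sum[OF C4] partial_cmult[OF C3] partial_add[OF C2 C2] partial_cmult[OF C] partial_ccos partial_csin)
  also have "\<dots> = fourier_sum M g p"
    unfolding fourier_sum_def gA gB by (rule sum.cong) (auto simp: algebra_simps diff_divide_distrib)
  finally show "partial j (fourier_sum M f) p = fourier_sum M g p" .
qed

lemma fourier_sum_orthogonal:
  assumes f: "f \<in> L2" and M: "finite M" "\<And>m. m \<in> M \<Longrightarrow> (\<lambda>i. - m i) \<in> M" and n: "n \<in> M"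
  shows "tint (\<lambda>p. fourier_sum M f p * trig n d p) = tint (\<lambda>p. f p * trig n d p)"
proof -
  define A where "A m = tint (\<lambda>q. f q * ccos m q)" for m
  define B where "B m = tint (\<lambda>q. f q * csin m q)" for m
  have tL: "trig m c \<in> L2" for m c by (rule L2_Cinf[OF trig_Cinf])
  have I: "integrable torus_measure (\<lambda>p. f p * trig m c p)" for m c by (rule L2_mult_integrable[OF f tL])
  have I2: "integrable torus_measure (\<lambda>p. trig m c p * trig n d p)" for m c by (rule L2_mult_integrable[OF tL tL])
  let ?T = "\<lambda>m. A m / vol * tint (\<lambda>p. ccos m p * trig n d p) + B m / vol * tint (\<lambda>p. csin m p * trig n d p)"
  have "fourier_sum M f p * trig n d p = (\<Sum>m\<in>M. A m / vol * (ccos m p * trig n d p) + B m / vol * (csin m p * trig n d p))" for p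
    by (simp add: fourier_sum_def A_def B_def sum_distrib_left sum_distrib_right algebra_simps add_divide_distrib)
  then have "tint (\<lambda>p. fourier_sum M f p * trig n d p) =
      tint (\<lambda>p. \<Sum>m\<in>M. A m / vol * (ccos m p * trig n d p) + B m / vol * (csin m p * trig n d p))" by simp
  also have "\<dots> = (\<Sum>m\<in>M. tint (\<lambda>p. A m / vol * (ccos m p * trig n d p) + B m / vol * (csin m p * trig n d p)))"
    by (rule Bochner_Integration.integral_sum) (intro Bochner_Integration.integrable_add integrable_mult_right I2)
  also have "\<dots> = (\<Sum>m\<in>M. ?T m)"
    by (rule sum.cong[OF refl], subst Bochner_Integration.integral_add) (auto intro!: integrable_mult_right I2)
  also have "\<dots> = (\<Sum>m\<in>M. (if m = n then (A n * cos d - B n * sin d) / 2 else 0)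
      + (if m = (\<lambda>i. - n i) then (A n * cos d - B n * sin d) / 2 else 0))"
  proof (rule sum.cong[OF refl])
    fix m
    have v: "vol \<noteq> 0" using vol_pos by simp
    have c1: "cos (- (pi / 2) - d) = - sin d" "cos (- (pi / 2) + d) = sin d"
      by (simp_all add: cos_add cos_diff)
    have mn: "A (\<lambda>i. - n i) = A n" "B (\<lambda>i. - n i) = - B n"
      by (simp_all add: A_def B_def trig_uminus)
    show "?T m = (if m = n then (A n * cos d - B n * sin d) / 2 else 0)
      + (if m = (\<lambda>i. - n i) then (A n * cos d - B n * sin d) / 2 else 0)"
      unfolding tint_trig_mult c1 using v mn by (auto simp: field_simps)
  qed
  also have "\<dots> = A n * cos d - B n * sin d"
    using M(1) n M(2)[OF n] by (simp add: sum.distrib)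
  also have "\<dots> = tint (\<lambda>p. cos d * (f p * ccos n p) - sin d * (f p * csin n p))"
    using Bochner_Integration.integral_diff[OF integrable_mult_right[OF I] integrable_mult_right[OF I], of "cos d" n 0 "sin d" n "- (pi / 2)"]
    by (simp add: A_def B_def mult.commute)
  also have "\<dots> = tint (\<lambda>p. f p * trig n d p)"
    by (rule Bochner_Integration.integral_cong) (auto simp: trig_expand[of n d] algebra_simps)
  finally show ?thesis .
qed

definition trig_polys :: "(3 \<Rightarrow> int) set \<Rightarrow> (torus3 \<Rightarrow> real) set" where
  "trig_polys M = fun_span {trig m c | m c. m \<in> M}"

lemma trig_polys_mono: "M \<subseteq> N \<Longrightarrow> q \<in> trig_polys M \<Longrightarrow> q \<in> trig_polys N"
  unfolding trig_polys_def fun_span_def by blast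

lemma trig_polys_Cinf: "q \<in> trig_polys M \<Longrightarrow> q \<in> Cinf"
  unfolding trig_polys_def
proof (induction rule: fun_span_induct)
  case (add c \<phi> g)
  then have "\<phi> \<in> Cinf" using trig_Cinf by blast
  then show ?case by (intro Cinf_add Cinf_mult Cinf_const add)
qed (rule Cinf_const)

lemma fourier_sum_trig_polys: "fourier_sum M f \<in> trig_polys M"
proof -
  have "(\<lambda>p. \<Sum>m\<in>M. (1 / vol) * (tint (\<lambda>q. f q * ccos m q) * ccos m p + tint (\<lambda>q. f q * csin m q) * csin m p)) \<in> trig_polys M"
    unfolding trig_polys_def by (intro fun_span_sum fun_span_cmult fun_span_add fun_span_base) blast+
  then show ?thesis by (simp add: fourier_sum_def[abs_def])
qed

text \<open>Pythagoras: the error \<open>f - S f\<close> is orthogonal to the trigonometric polynomials with frequencies in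
  \<open>M\<close>.\<close>

lemma fourier_sum_best_approximation:
  assumes f: "f \<in> L2" and M: "finite M" "\<And>m. m \<in> M \<Longrightarrow> (\<lambda>i. - m i) \<in> M" and q: "q \<in> trig_polys M"
  shows "sqint (\<lambda>p. f p - fourier_sum M f p) \<le> sqint (\<lambda>p. f p - q p)"
proof -
  let ?S = "fourier_sum M f"
  have SL: "?S \<in> L2" by (rule L2_Cinf[OF fourier_sum_Cinf])
  have eL: "(\<lambda>p. f p - ?S p) \<in> L2" by (rule L2_diff[OF f SL])
  have tL: "trig m c \<in> L2" for m c by (rule L2_Cinf[OF trig_Cinf])
  have orth: "r \<in> L2 \<and> tint (\<lambda>p. (f p - ?S p) * r p) = 0" if "r \<in> trig_polys M" for r
    using that unfolding trig_polys_def
  proof (induction rule: fun_span_induct)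
    case zero
    show ?case by (simp add: L2_continuous)
  next
    case (add c \<phi> g)
    then obtain n d where \<phi>: "\<phi> = trig n d" "n \<in> M" by blast
    have gL: "g \<in> L2" using add(2) by blast
    have "tint (\<lambda>p. (f p - ?S p) * \<phi> p) = tint (\<lambda>p. f p * trig n d p) - tint (\<lambda>p. ?S p * trig n d p)"
      unfolding \<phi>(1) left_diff_distrib
      by (rule Bochner_Integration.integral_diff[OF L2_mult_integrable[OF f tL] L2_mult_integrable[OF SL tL]])
    then have 0: "tint (\<lambda>p. (f p - ?S p) * \<phi> p) = 0" using fourier_sum_orthogonal[OF f M \<phi>(2)] by simp
    have \<phi>L: "\<phi> \<in> L2" using tL \<phi>(1) by simp
    have "tint (\<lambda>p. (f p - ?S p) * (c * \<phi> p + g p)) = tint (\<lambda>p. c * ((f p - ?S p) * \<phi> p) + (f p - ?S p) * g p)"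
      by (rule Bochner_Integration.integral_cong) (auto simp: algebra_simps)
    also have "\<dots> = tint (\<lambda>p. c * ((f p - ?S p) * \<phi> p)) + tint (\<lambda>p. (f p - ?S p) * g p)"
      by (rule Bochner_Integration.integral_add[OF integrable_mult_right[OF L2_mult_integrable[OF eL \<phi>L]] L2_mult_integrable[OF eL gL]])
    finally have "tint (\<lambda>p. (f p - ?S p) * (c * \<phi> p + g p)) = 0" using 0 add(2) by simp
    moreover have "(\<lambda>p. c * \<phi> p + g p) \<in> L2" by (intro L2_add L2_cmult \<phi>L gL)
    ultimately show ?case by blast
  qed
  define r where "r p = ?S p - q p" for p
  have "(\<lambda>p. ?S p + (-1) * q p) \<in> trig_polys M"
    using fourier_sum_trig_polys[of M f] q unfolding trig_polys_def by (intro fun_span_add fun_span_cmult)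
  then have rT: "r \<in> trig_polys M" by (simp add: r_def[abs_def])
  have rL: "r \<in> L2" and r0: "tint (\<lambda>p. (f p - ?S p) * r p) = 0" using orth[OF rT] by blast+
  note I = L2_integrable_square[OF eL] integrable_mult_right[OF L2_mult_integrable[OF eL rL], of 2] L2_integrable_square[OF rL]
  have "sqint (\<lambda>p. f p - q p) = tint (\<lambda>p. (f p - ?S p)\<^sup>2 + 2 * ((f p - ?S p) * r p) + (r p)\<^sup>2)"
    unfolding sqint_def by (rule Bochner_Integration.integral_cong) (auto simp: r_def power2_eq_square algebra_simps)
  also have "\<dots> = tint (\<lambda>p. (f p - ?S p)\<^sup>2 + 2 * ((f p - ?S p) * r p)) + sqint r"
    unfolding sqint_def by (rule Bochner_Integration.integral_add[OF Bochner_Integration.integrable_add[OF I(1,2)] I(3)])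
  also have "tint (\<lambda>p. (f p - ?S p)\<^sup>2 + 2 * ((f p - ?S p) * r p)) = sqint (\<lambda>p. f p - ?S p) + 0"
    unfolding sqint_def Bochner_Integration.integral_add[OF I(1,2)] using r0 by simp
  finally show ?thesis using sqint_nonneg[of r] by simp
qed

lemma trig_polys_finite_support:
  assumes "q \<in> trig_polys UNIV"
  obtains M where "finite M" "q \<in> trig_polys M"
proof -
  have "\<exists>M. finite M \<and> q \<in> trig_polys M"
    using assms unfolding trig_polys_def
  proof (induction rule: fun_span_induct)
    case zero
    show ?case by (rule exI[of _ "{}"]) (simp add: fun_span_zero)
  next
    case (add c \<phi> g)
    then obtain M where M: "finite M" "g \<in> trig_polys M" unfolding trig_polys_def by blast
    obtain n d where \<phi>: "\<phi> = trig n d" using add(1) by blast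
    have "\<phi> \<in> trig_polys (insert n M)" unfolding trig_polys_def \<phi> by (rule fun_span_base) blast
    moreover have "g \<in> trig_polys (insert n M)" by (rule trig_polys_mono[OF _ M(2)]) blast
    ultimately have "(\<lambda>x. c * \<phi> x + g x) \<in> trig_polys (insert n M)"
      unfolding trig_polys_def by (intro fun_span_add fun_span_cmult)
    then show ?case using M(1) unfolding trig_polys_def by (intro exI[of _ "insert n M"]) simp
  qed
  then show ?thesis using that by blast
qed

lemma trig_polys_mult:
  assumes "f \<in> trig_polys UNIV" "g \<in> trig_polys UNIV"
  shows "(\<lambda>p. f p * g p) \<in> trig_polys UNIV"
proof -
  have base: "trig m c \<in> trig_polys UNIV" for m c
    unfolding trig_polys_def by (rule fun_span_base) blast
  have step: "(\<lambda>p. trig m c p * g p) \<in> trig_polys UNIV" for m c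
    using assms(2) unfolding trig_polys_def
  proof (induction rule: fun_span_induct)
    case zero
    then show ?case by (simp add: fun_span_zero)
  next
    case (add e \<phi> g)
    then obtain n d where \<phi>: "\<phi> = trig n d" by blast
    have "(\<lambda>p. (e / 2) * (trig (\<lambda>i. m i - n i) (c - d) p + trig (\<lambda>i. m i + n i) (c + d) p) + trig m c p * g p)
        \<in> fun_span {trig m c | m c. m \<in> UNIV}"
      using base unfolding trig_polys_def by (intro fun_span_add fun_span_cmult add(2))
    moreover have "(e / 2) * (trig (\<lambda>i. m i - n i) (c - d) p + trig (\<lambda>i. m i + n i) (c + d) p) + trig m c p * g p
        = trig m c p * (e * \<phi> p + g p)" for p
    proof -
      have "trig m c p * (e * \<phi> p + g p) = e * (trig m c p * trig n d p) + trig m c p * g p"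
        by (simp add: \<phi> algebra_simps)
      then show ?thesis unfolding trig_mult by simp
    qed
    ultimately show ?case by simp
  qed
  show ?thesis
    using assms(1) unfolding trig_polys_def
  proof (induction rule: fun_span_induct)
    case zero
    then show ?case by (simp add: fun_span_zero)
  next
    case (add e \<phi> f)
    then obtain n d where \<phi>: "\<phi> = trig n d" by blast
    have "(\<lambda>p. e * (trig n d p * g p) + f p * g p) \<in> fun_span {trig m c | m c. m \<in> UNIV}"
      using step unfolding trig_polys_def by (intro fun_span_add fun_span_cmult add(2))
    then show ?case by (simp add: \<phi> algebra_simps)
  qed
qed

lemma trig_polys_dense_C0:
  assumes "continuous_on UNIV f" "\<epsilon> > 0"
  shows "\<exists>q\<in>trig_polys UNIV. \<forall>p. \<bar>f p - q p\<bar> < \<epsilon>"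
proof -
  have base: "trig m c \<in> trig_polys UNIV" for m c
    unfolding trig_polys_def by (rule fun_span_base) blast
  have one: "(\<lambda>p. c) \<in> trig_polys UNIV" for c
  proof -
    have "(\<lambda>p. c * trig (\<lambda>i. 0) 0 p) \<in> trig_polys UNIV"
      using base unfolding trig_polys_def by (intro fun_span_cmult)
    then show ?thesis by (simp add: trig_def freq_dot_def)
  qed
  have "\<exists>g. g \<in> trig_polys UNIV \<and> (\<forall>x\<in>UNIV. \<bar>f x - g x\<bar> < \<epsilon>)"
  proof (rule Stone_Weierstrass_HOL[where P = "\<lambda>g. g \<in> trig_polys UNIV", OF compact_UNIV_torus])
    show "(\<lambda>x. c) \<in> trig_polys UNIV" for c by (rule one)
    show "continuous_on UNIV g" if "g \<in> trig_polys UNIV" for g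
      by (rule Ck_continuous[OF CinfD[OF trig_polys_Cinf[OF that], of 0]])
    show "(\<lambda>x. f x + g x) \<in> trig_polys UNIV" if "f \<in> trig_polys UNIV \<and> g \<in> trig_polys UNIV" for f g
      using that unfolding trig_polys_def by (intro fun_span_add) auto
    show "(\<lambda>x. f x * g x) \<in> trig_polys UNIV" if "f \<in> trig_polys UNIV \<and> g \<in> trig_polys UNIV" for f g
      using that by (intro trig_polys_mult) auto
    show "\<exists>f. f \<in> trig_polys UNIV \<and> f x \<noteq> f y" if xy: "x \<in> UNIV \<and> y \<in> UNIV \<and> x \<noteq> y" for x y
    proof (intro exI conjI)
      have "(\<lambda>p. \<Sum>i\<in>UNIV. 1 + (-1) * trig (\<lambda>k. if k = i then 1 else 0) (- rep_torus3 y $ i) p) \<in> trig_polys UNIV"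
        using one[of 1] base unfolding trig_polys_def by (intro fun_span_sum fun_span_add fun_span_cmult)
      then show "bump_at (rep_torus3 y) \<in> trig_polys UNIV" by (simp add: bump_at_def[abs_def])
      have "bump_at (rep_torus3 y) x \<noteq> 0" "bump_at (rep_torus3 y) y = 0"
        using xy by (simp_all add: bump_at_eq_0 proj_rep)
      then show "bump_at (rep_torus3 y) x \<noteq> bump_at (rep_torus3 y) y" by simp
    qed
  qed (use assms in auto)
  then show ?thesis by blast
qed

text \<open>By best approximation it suffices to approximate \<open>f\<close> by some trigonometric polynomial, which is possible
  since continuous functions are dense in \<open>L\<^sup>2\<close> and trigonometric polynomials are uniformly dense in
  them. A threshold set of frequencies, instead of a sequence, permits treating several functions at
  once.\<close>

lemma fourier_sum_converges:
  assumes f: "f \<in> L2" and "\<epsilon> > 0"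
  obtains M0 where "finite M0"
    "\<And>M. finite M \<Longrightarrow> (\<And>m. m \<in> M \<Longrightarrow> (\<lambda>i. - m i) \<in> M) \<Longrightarrow> M0 \<subseteq> M \<Longrightarrow> sqint (\<lambda>p. f p - fourier_sum M f p) < \<epsilon>"
proof -
  have e4: "\<epsilon> / 4 > 0" using assms(2) by simp
  obtain g where g: "continuous_on UNIV g" "sqint (\<lambda>p. f p - g p) < \<epsilon> / 4"
    using continuous_dense_L2[OF f] e4 unfolding L2_approx_def by blast
  define \<delta> where "\<delta> = sqrt (\<epsilon> / (4 * vol))"
  have "\<epsilon> / (4 * vol) > 0" using assms(2) vol_pos by simp
  then have \<delta>: "\<delta> > 0" "\<delta>\<^sup>2 * vol = \<epsilon> / 4" using vol_pos by (auto simp: \<delta>_def)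
  obtain q where q: "q \<in> trig_polys UNIV" "\<forall>p. \<bar>g p - q p\<bar> < \<delta>"
    using trig_polys_dense_C0[OF g(1) \<delta>(1)] by blast
  have gq: "sqint (\<lambda>p. g p - q p) \<le> \<epsilon> / 4"
    using sqint_le_sup[of "\<lambda>p. g p - q p" \<delta>] q(2) \<delta>(2) by (simp add: less_imp_le)
  have qL: "q \<in> L2" by (rule L2_Cinf[OF trig_polys_Cinf[OF q(1)]])
  have fq: "sqint (\<lambda>p. f p - q p) < \<epsilon>"
    using sqint_diff_le[OF f L2_continuous[OF g(1)] qL] g(2) gq by linarith
  obtain M0 where M0: "finite M0" "q \<in> trig_polys M0" using trig_polys_finite_support[OF q(1)] by blast
  have "sqint (\<lambda>p. f p - fourier_sum M f p) < \<epsilon>"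
    if M: "finite M" "\<And>m. m \<in> M \<Longrightarrow> (\<lambda>i. - m i) \<in> M" "M0 \<subseteq> M" for M
  proof -
    have "sqint (\<lambda>p. f p - fourier_sum M f p) \<le> sqint (\<lambda>p. f p - q p)"
      by (rule fourier_sum_best_approximation[OF f M(1,2) trig_polys_mono[OF M(3) M0(2)]])
    then show ?thesis using fq by linarith
  qed
  then show ?thesis using that M0(1) by blast
qed

lemma exists_symmetric_superset:
  fixes M :: "(3 \<Rightarrow> int) set"
  assumes "finite M"
  obtains N where "finite N" "M \<subseteq> N" "\<And>m. m \<in> N \<Longrightarrow> (\<lambda>i. - m i) \<in> N"
proof
  show "finite (M \<union> (\<lambda>m i. - m i) ` M)" using assms by simp
  show "(\<lambda>i. - m i) \<in> M \<union> (\<lambda>m i. - m i) ` M" if "m \<in> M \<union> (\<lambda>m i. - m i) ` M" for m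
    using that by auto
qed auto

text \<open>All Fourier sums of such a function vanish. This is the uniqueness of weak derivatives.\<close>

lemma orthogonal_Cinf_imp_sqint_zero:
  assumes g: "g \<in> L2" and "\<And>\<phi>. \<phi> \<in> Cinf \<Longrightarrow> tint (\<lambda>p. g p * \<phi> p) = 0"
  shows "sqint g = 0"
proof -
  have S0: "fourier_sum M g p = 0" for M p
    using assms(2)[OF trig_Cinf] by (simp add: fourier_sum_def)
  have "sqint g \<le> 0 + \<epsilon>" if \<epsilon>: "\<epsilon> > 0" for \<epsilon>
  proof -
    obtain M0 where M0: "finite M0" "\<And>M. finite M \<Longrightarrow> (\<And>m. m \<in> M \<Longrightarrow> (\<lambda>i. - m i) \<in> M) \<Longrightarrow> M0 \<subseteq> M \<Longrightarrow>
        sqint (\<lambda>p. g p - fourier_sum M g p) < \<epsilon>"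
      using fourier_sum_converges[OF g \<epsilon>] by blast
    obtain N where "finite N" "M0 \<subseteq> N" "\<And>m. m \<in> N \<Longrightarrow> (\<lambda>i. - m i) \<in> N"
      using exists_symmetric_superset[OF M0(1)] by blast
    then show ?thesis using M0(2)[of N] by (simp add: S0)
  qed
  then have "sqint g \<le> 0" by (rule field_le_epsilon)
  then show ?thesis using sqint_nonneg[of g] by simp
qed

text \<open>The choice in \<open>H1_norm\<close> picks some weak derivative, which agrees with \<open>g j\<close> almost everywhere. The
  crude factor two avoids proving that the squared norms are equal.\<close>

lemma H1_norm_le:
  assumes f: "f \<in> L2" and g: "\<And>j. g j \<in> L2" "\<And>j. weak_partial j f (g j)"
  shows "H1_norm f \<le> sqrt (sqint f + 2 * (\<Sum>j\<in>UNIV. sqint (g j)))"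
proof -
  have "tint (\<lambda>x. ((SOME h. h \<in> L2 \<and> weak_partial j f h) x)\<^sup>2) \<le> 2 * sqint (g j)" for j
  proof -
    define h where "h = (SOME h. h \<in> L2 \<and> weak_partial j f h)"
    have "h \<in> L2 \<and> weak_partial j f h"
      unfolding h_def by (rule someI[of _ "g j"]) (use g in simp)
    then have h: "h \<in> L2" "weak_partial j f h" by simp_all
    have "sqint (\<lambda>p. h p - g j p) = 0"
    proof (rule orthogonal_Cinf_imp_sqint_zero[OF L2_diff[OF h(1) g(1)]])
      fix \<phi> :: "torus3 \<Rightarrow> real" assume \<phi>: "\<phi> \<in> Cinf"
      have "tint (\<lambda>p. (h p - g j p) * \<phi> p) = tint (\<lambda>p. h p * \<phi> p) - tint (\<lambda>p. g j p * \<phi> p)"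
        unfolding left_diff_distrib
        by (rule Bochner_Integration.integral_diff[OF L2_mult_integrable[OF h(1) L2_Cinf[OF \<phi>]] L2_mult_integrable[OF g(1) L2_Cinf[OF \<phi>]]])
      also have "\<dots> = 0"
      proof -
        have "tint (\<lambda>p. f p * partial j \<phi> p) = - tint (\<lambda>p. h p * \<phi> p)"
          "tint (\<lambda>p. f p * partial j \<phi> p) = - tint (\<lambda>p. g j p * \<phi> p)"
          using h(2) g(2)[of j] \<phi> unfolding weak_partial_def by blast+
        then show ?thesis by linarith
      qed
      finally show "tint (\<lambda>p. (h p - g j p) * \<phi> p) = 0" .
    qed
    moreover have "sqint h \<le> 2 * sqint (\<lambda>p. h p - g j p) + 2 * sqint (g j)"
      using sqint_add_le[OF L2_diff[OF h(1) g(1)] g(1), of j j] by simp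
    ultimately show ?thesis by (simp add: h_def[symmetric] sqint_def)
  qed
  then have "(\<Sum>j\<in>UNIV. tint (\<lambda>x. ((SOME h. h \<in> L2 \<and> weak_partial j f h) x)\<^sup>2)) \<le> (\<Sum>j\<in>UNIV. 2 * sqint (g j))"
    by (intro sum_mono)
  then show ?thesis unfolding H1_norm_def by (simp add: sqint_def sum_distrib_left)
qed

section \<open>Density in \<open>H\<^sup>1\<close>\<close>

text \<open>Fourier sums of \<open>f\<close> converge in \<open>L\<^sup>2\<close>, and so do their derivatives, since these are the Fourier sums of
  the weak derivatives.\<close>

lemma smooth_dense_H1:
  assumes f: "f \<in> H1" and g: "\<And>j. g j \<in> L2" "\<And>j. weak_partial j f (g j)" and \<delta>: "\<delta> > 0"
  obtains u where "u \<in> Cinf" "sqint (\<lambda>p. f p - u p) < \<delta>" "\<And>j. sqint (\<lambda>p. g j p - partial j u p) < \<delta>"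
proof -
  let ?good = "\<lambda>M0 f. finite M0 \<and> (\<forall>M. finite M \<longrightarrow> (\<forall>m\<in>M. (\<lambda>i. - m i) \<in> M) \<longrightarrow> M0 \<subseteq> M \<longrightarrow>
      sqint (\<lambda>p. f p - fourier_sum M f p) < \<delta>)"
  have ex: "\<exists>M0. ?good M0 h" if h: "h \<in> L2" for h
  proof -
    obtain M0 where "finite M0" "\<And>M. finite M \<Longrightarrow> (\<And>m. m \<in> M \<Longrightarrow> (\<lambda>i. - m i) \<in> M) \<Longrightarrow> M0 \<subseteq> M \<Longrightarrow>
        sqint (\<lambda>p. h p - fourier_sum M h p) < \<delta>"
      using fourier_sum_converges[OF h \<delta>] by blast
    then show ?thesis by (intro exI[of _ M0]) simp
  qed
  have fL: "f \<in> L2" using f by (simp add: H1_def)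
  obtain M0 where M0: "?good M0 f" using ex[OF fL] by (elim exE)
  have "\<forall>j. \<exists>M1. ?good M1 (g j)" using ex[OF g(1)] by (rule allI)
  from choice[OF this] obtain M1 where M1: "\<forall>j. ?good (M1 j) (g j)" by (elim exE)
  have "finite (M0 \<union> (\<Union>j. M1 j))" using M0 M1 by simp
  from exists_symmetric_superset[OF this]
  obtain N where N: "finite N" "M0 \<union> (\<Union>j. M1 j) \<subseteq> N" "\<And>m. m \<in> N \<Longrightarrow> (\<lambda>i. - m i) \<in> N" by blast
  have N3: "\<forall>m\<in>N. (\<lambda>i. - m i) \<in> N" using N(3) by blast
  show ?thesis
  proof (rule that[of "fourier_sum N f"])
    show "fourier_sum N f \<in> Cinf" by (rule fourier_sum_Cinf)
    have "M0 \<subseteq> N" using N(2) by blast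
    then show "sqint (\<lambda>p. f p - fourier_sum N f p) < \<delta>" using M0 N(1) N3 by simp
    fix j
    have "M1 j \<subseteq> N" using N(2) by blast
    then show "sqint (\<lambda>p. g j p - partial j (fourier_sum N f) p) < \<delta>"
      using M1 N(1) N3 unfolding partial_fourier_sum[OF g(2)] by simp
  qed
qed

text \<open>Approximate in \<open>H\<^sup>1\<close> by a smooth function, and this function in \<open>C\<^sup>1\<close> by elements of \<open>S\<close>; on a space of finite volume the
  \<open>C\<^sup>1\<close> norm dominates the \<open>H\<^sup>1\<close> norm.\<close>

lemma approximable_C1_imp_dense_H1:
  assumes S: "S \<subseteq> Cinf" and dense: "\<And>u. u \<in> Cinf \<Longrightarrow> approximable (Suc 0) S u"
  shows "closure_in H1 H1_norm S = H1"
proof (intro equalityI subsetI)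
  fix f assume f: "f \<in> H1"
  then have fL: "f \<in> L2" by (simp add: H1_def)
  have "\<forall>j. \<exists>g. g \<in> L2 \<and> weak_partial j f g" using f by (auto simp: H1_def)
  from choice[OF this] obtain g where g: "\<And>j. g j \<in> L2" "\<And>j. weak_partial j f (g j)" by blast
  have "\<exists>v\<in>S \<inter> H1. H1_norm (\<lambda>x. f x - v x) < \<epsilon>" if \<epsilon>: "\<epsilon> > 0" for \<epsilon>
  proof -
    \<comment> \<open>The squared norm of \<open>f - v\<close> is at most \<open>7 (2 \<delta> + 2 \<eta>\<^sup>2 vol)\<close>.\<close>
    define \<delta> where "\<delta> = \<epsilon>\<^sup>2 / 32"
    have \<delta>: "\<delta> > 0" using \<epsilon> by (simp add: \<delta>_def)
    define \<eta> where "\<eta> = sqrt (\<delta> / vol)"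
    have "\<delta> / vol > 0" using \<delta> vol_pos by simp
    then have \<eta>: "\<eta> > 0" "\<eta>\<^sup>2 * vol = \<delta>" using vol_pos by (auto simp: \<eta>_def)
    obtain u where u: "u \<in> Cinf" "sqint (\<lambda>p. f p - u p) < \<delta>" "\<And>j. sqint (\<lambda>p. g j p - partial j u p) < \<delta>"
      using smooth_dense_H1[OF f g \<delta>] by blast
    obtain v where v: "v \<in> S" "Cbound (Suc 0) UNIV \<eta> ((\<lambda>x. u x - v x) \<circ> proj)"
      using dense[OF u(1)] \<eta>(1) unfolding approximable_def by blast
    have vC: "v \<in> Cinf" using v(1) S by blast
    have C1: "u \<in> Ck (Suc 0)" "v \<in> Ck (Suc 0)" by (rule CinfD[OF u(1)], rule CinfD[OF vC])
    have L: "u \<in> L2" "v \<in> L2" "partial j u \<in> L2" "partial j v \<in> L2" for j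
      using u(1) vC L2_Cinf Cinf_partial by blast+
    have uv: "\<bar>u p - v p\<bar> \<le> \<eta>" for p
    proof -
      obtain x where p: "p = proj x" using proj_surj by blast
      show ?thesis using Cbound_pointwise[OF v(2), of x] by (simp add: p)
    qed
    have duv: "\<bar>partial j u p - partial j v p\<bar> \<le> \<eta>" for j p
    proof -
      obtain x where p: "p = proj x" using proj_surj by blast
      have "partial j (\<lambda>x. u x - v x) p = partial j u p - partial j v p"
      proof -
        have "(\<lambda>x. u x - v x) = (\<lambda>x. u x + (-1) * v x)" by auto
        then show ?thesis
          using partial_add[OF C1(1) Ck_mult[OF Ck_const[of "-1"] C1(2)], of j p] partial_cmult[OF C1(2), of j "-1" p] by simp
      qed
      moreover have "\<bar>pd j ((\<lambda>x. u x - v x) \<circ> proj) x\<bar> \<le> \<eta>" using v(2) by simp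
      ultimately show ?thesis using partial_proj_eq_pd[OF Ck_diff[OF C1], of j x] by (simp add: p)
    qed
    have fv: "sqint (\<lambda>p. f p - v p) \<le> 4 * \<delta>"
      using sqint_diff_le[OF fL L(1,2)] u(2) sqint_le_sup[of "\<lambda>p. u p - v p", OF uv] \<eta>(2) by linarith
    have gv: "sqint (\<lambda>p. g j p - partial j v p) \<le> 4 * \<delta>" for j
      using sqint_diff_le[OF g(1) L(3,4), of j j j] u(3)[of j]
        sqint_le_sup[of "\<lambda>p. partial j u p - partial j v p", OF duv] \<eta>(2) by linarith
    have "H1_norm (\<lambda>p. f p - v p) \<le> sqrt (sqint (\<lambda>p. f p - v p) + 2 * (\<Sum>j\<in>UNIV. sqint (\<lambda>p. g j p - partial j v p)))"
      using weak_partial_diff[OF g(2) weak_partial_classical[OF vC] fL g(1) L(2) L(4)]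
      by (intro H1_norm_le L2_diff fL g(1) L) auto
    also have "\<dots> < \<epsilon>"
    proof (rule real_less_lsqrt)
      have "(\<Sum>j\<in>UNIV. sqint (\<lambda>p. g j p - partial j v p)) \<le> (\<Sum>j\<in>(UNIV::3 set). 4 * \<delta>)"
        using gv by (rule sum_mono)
      then have "sqint (\<lambda>p. f p - v p) + 2 * (\<Sum>j\<in>UNIV. sqint (\<lambda>p. g j p - partial j v p)) \<le> 28 * \<delta>"
        using fv by simp
      also have "\<dots> < \<epsilon>\<^sup>2" using \<epsilon> by (simp add: \<delta>_def)
      finally show "sqint (\<lambda>p. f p - v p) + 2 * (\<Sum>j\<in>UNIV. sqint (\<lambda>p. g j p - partial j v p)) < \<epsilon>\<^sup>2" .
    qed (use \<epsilon> in \<open>auto simp: sqint_nonneg sum_nonneg\<close>)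
    finally show ?thesis using v(1) Cinf_H1[OF vC] by blast
  qed
  then show "f \<in> closure_in H1 H1_norm S" using f by (simp add: closure_in_def)
qed (simp add: closure_in_def)

theorem smooth_embedding_imp_cubically_saturating:
  fixes b :: "torus3 \<Rightarrow> real^'m::finite"
  assumes b: "\<forall>j. (\<lambda>x. b x $ j) \<in> Cinf" and emb: "smooth_embedding Sym (Gamma_mat b)"
  shows "cubically_saturating b"
  unfolding cubically_saturating_def
proof (rule approximable_C1_imp_dense_H1)
  show "sat_inf b \<subseteq> Cinf" using sat_inf_Cinf[OF b] by blast
  show "approximable (Suc 0) (sat_inf b) u" if "u \<in> Cinf" for u
    using smooth_embedding_imp_approximable[OF b emb _ CinfD[OF that]] by simp
qed

theorem theorem4p17:
  fixes b :: "torus3 \<Rightarrow> real^'m"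
  assumes "\<forall>j. (\<lambda>x. b x $ j) \<in> Cinf"
  shows "sat_inf b = {(\<lambda>x. poly_eval P (b x)) | P. P \<in> odd_polys}
    \<and> (closure_in (Ck 0) (Ck_norm 0) (sat_inf b) = Ck 0
         \<longleftrightarrow> (\<forall>x. b x \<noteq> 0) \<and> inj (Gamma_mat b))
    \<and> (\<forall>k\<ge>1. closure_in (Ck k) (Ck_norm k) (sat_inf b) = Ck k
         \<longleftrightarrow> smooth_embedding Sym (Gamma_mat b))
    \<and> (smooth_embedding Sym (Gamma_mat b) \<longrightarrow> cubically_saturating b)"
  using sat_inf_eq_odd_polys[of b] closure_C0_iff[OF assms] closure_Ck_iff[OF assms]
    smooth_embedding_imp_cubically_saturating[OF assms] by blast

end
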